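(* For all $n\ge 1$, we have $$M(B_n,q)=\sum_{j=0}^{\lfloor (n-1)/2\rfloor}\gamma_{n,j}\,q^j(1+q)^{n-1-2j},$$ where $\gamma_{n,j}$ counts each of the following families of objects: (i) the parking functions $\alpha$ in $\mathrm{PF}^B_n$ with $\mathrm{reluc}(\alpha)=j$ such that there are no two consecutive reluctant cars, and the last car of $\alpha$ is lucky; (ii) the maximal chains $\mathbf{w}:e=\omega_0<\omega_1<\cdots<\omega_n=c$ in $\mathrm{NC}(B_n,c)$ with $\mathrm{bad}(\mathbf{w})=j$ such that there are no two consecutive bad edges, and $(\omega_{n-1},\omega_n)$ is a good edge. Moreover, $\gamma_{n,j}$ can be calculated by $$\gamma_{n,j}=n!\cdot\sum_{(b_1,b_2,\dots,b_j)\in B(n,j)}\ \prod_{i=1}^{j}\left(\frac{n-b_i}{b_i}\right).$$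
   Context: Parking functions of type $B$: $\mathrm{PF}^B_n$ is the set of all $n$-tuples $\alpha=(a_1,\dots,a_n)$ with $a_i\in\{1,\dots,n\}$. The $n$ parking spaces $1,\dots,n$ are arranged in a circle (space $1$ follows space $n$). Cars $C_1,\dots,C_n$ arrive in order; $C_i$ parks at its preferred space $a_i$ if free and otherwise at the next available space around the circle. If $C_i$ parks at $p_i$, then $C_i$ is lucky if $p_i=a_i$ and reluctant if $p_i\ne a_i$; $\mathrm{reluc}(\alpha)$ is the number of reluctant cars. Two cars are consecutive if they are $C_i,C_{i+1}$ for some $i$. Noncrossing partition lattice: $B_n$ is the group of bijections $\omega$ of $\{\pm1,\dots,\pm n\}$ with $\omega(-i)=-\omega(i)$, and $c=(1,2,\dots,n,-1,-2,\dots,-n)$. Its simple generators $S$ are $(1,-1)$ and $(i,i+1)(-i,-(i+1))$ for $1\le i\le n-1$; its set $T$ of reflections consists of $(i,-i)$ for $1\le i\le n$ and $(i,j)(-i,-j)$, $(i,-j)(-i,j)$ for $1\le i<j\le n$. The product $\sigma\tau$ means: first apply $\tau$, then $\sigma$. Let $\ell_S$ (resp. $\ell_T$) be the word length with respect to $S$ (resp. $T$). The absolute order is: $\omega<\omega'$ iff $\omega\ne\omega'$ and $\ell_T(\omega')=\ell_T(\omega)+\ell_T(\omega^{-1}\omega')$. Then $\mathrm{NC}(B_n,c)=\{\omega\in B_n:e\le\omega\le c\}$ with the absolute order. The (strong) Bruhat order $\le_B$ is the partial order generated by $\omega<_B\omega t$ for $t\in T$ with $\ell_S(\omega)<\ell_S(\omega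 t)$. An edge is a pair $(\mu,\nu)$ of elements of $\mathrm{NC}(B_n,c)$ such that $\nu$ covers $\mu$ in the absolute order; it is good if $\mu<_B\nu$ and bad if $\mu>_B\nu$. For a maximal chain $\mathbf{w}:e=\omega_0<\cdots<\omega_n=c$, $\mathrm{bad}(\mathbf{w})$ is the number of $i\in\{1,\dots,n\}$ such that $(\omega_{i-1},\omega_i)$ is bad; two edges of $\mathbf{w}$ are consecutive if they are $(\omega_{i-1},\omega_i)$ and $(\omega_i,\omega_{i+1})$ for some $i$. Define $M(B_n,q)=\sum_{\mathbf{w}}q^{\mathrm{bad}(\mathbf{w})}$, summed over all maximal chains $\mathbf{w}$ in $\mathrm{NC}(B_n,c)$. For $0\le k\le\lfloor\frac{n-1}{2}\rfloor$, $B(n,k)$ is the set of $k$-tuples $(b_1,\dots,b_k)$ of integers with $1<b_1<b_2<\cdots<b_k<n$ and $b_{i+1}-b_i>1$ for each $1\le i\le k-1$ (for $k=0$ it consists of the empty tuple, and empty products equal $1$). *)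

theory Defs
  imports
    Complex_Main
    "HOL-Combinatorics.Combinatorics"
    "HOL-Computational_Algebra.Polynomial"
begin

subsection \<open>Parking functions of type B\<close>

definition PFB :: "nat \<Rightarrow> nat list set" where
  "PFB n = {\<alpha>. length \<alpha> = n \<and> set \<alpha> \<subseteq> {1..n}}"

definition next_space :: "nat \<Rightarrow> nat \<Rightarrow> nat" where
  "next_space n p = (if p = n then 1 else p + 1)"

(* first space not in Occ met when driving around the circle from a *)
definition park_at :: "nat \<Rightarrow> nat set \<Rightarrow> nat \<Rightarrow> nat" where
  "park_at n Occ a =
     (next_space n ^^ (LEAST k. (next_space n ^^ k) a \<notin> Occ)) a"

fun park :: "nat \<Rightarrow> nat set \<Rightarrow> nat list \<Rightarrow> nat list" where
  "park n Occ [] = []"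
| "park n Occ (a # \<alpha>) = (let p = park_at n Occ a in p # park n (insert p Occ) \<alpha>)"

definition outcome :: "nat \<Rightarrow> nat list \<Rightarrow> nat list" where
  "outcome n \<alpha> = park n {} \<alpha>"

(* cars are numbered 1, ..., n, whereas list positions start at 0 *)
definition lucky :: "nat \<Rightarrow> nat list \<Rightarrow> nat \<Rightarrow> bool" where
  "lucky n \<alpha> i \<longleftrightarrow> outcome n \<alpha> ! (i - 1) = \<alpha> ! (i - 1)"

abbreviation reluctant :: "nat \<Rightarrow> nat list \<Rightarrow> nat \<Rightarrow> bool" where
  "reluctant n \<alpha> i \<equiv> \<not> lucky n \<alpha> i"

definition reluc :: "nat \<Rightarrow> nat list \<Rightarrow> nat" where
  "reluc n \<alpha> = card {i \<in> {1..n}. reluctant n \<alpha> i}"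

definition PF_family :: "nat \<Rightarrow> nat \<Rightarrow> nat list set" where
  "PF_family n j = {\<alpha> \<in> PFB n. reluc n \<alpha> = j \<and>
     (\<forall>i\<in>{1..<n}. \<not> (reluctant n \<alpha> i \<and> reluctant n \<alpha> (i + 1))) \<and>
     lucky n \<alpha> n}"

subsection \<open>The Coxeter group of type B\<close>

definition pm_set :: "nat \<Rightarrow> int set" where
  "pm_set n = {1..int n} \<union> {- int n..- 1}"

(* elements are functions on all integers, the identity outside pm_set n *)
definition B_group :: "nat \<Rightarrow> (int \<Rightarrow> int) set" where
  "B_group n = {w. w permutes pm_set n \<and> (\<forall>i\<in>pm_set n. w (- i) = - w i)}"

(* cycle_of_list [x, y, z] sends x to y, y to z and z to x *)
definition cox :: "nat \<Rightarrow> int \<Rightarrow> int" where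
  "cox n = cycle_of_list ([1..int n] @ map uminus [1..int n])"

definition simple_gens :: "nat \<Rightarrow> (int \<Rightarrow> int) set" where
  "simple_gens n = insert (transpose 1 (- 1))
     {transpose i (i + 1) \<circ> transpose (- i) (- (i + 1)) | i. 1 \<le> i \<and> i \<le> int n - 1}"

definition reflections :: "nat \<Rightarrow> (int \<Rightarrow> int) set" where
  "reflections n =
     {transpose i (- i) | i. 1 \<le> i \<and> i \<le> int n} \<union>
     {transpose i j \<circ> transpose (- i) (- j) | i j. 1 \<le> i \<and> i < j \<and> j \<le> int n} \<union>
     {transpose i (- j) \<circ> transpose (- i) j | i j. 1 \<le> i \<and> i < j \<and> j \<le> int n}"

definition word_length :: "('a \<Rightarrow> 'a) set \<Rightarrow> ('a \<Rightarrow> 'a) \<Rightarrow> nat" where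
  "word_length X w = (LEAST k. \<exists>xs. length xs = k \<and> set xs \<subseteq> X \<and> foldr (\<circ>) xs id = w)"

abbreviation len_S :: "nat \<Rightarrow> (int \<Rightarrow> int) \<Rightarrow> nat" where
  "len_S n \<equiv> word_length (simple_gens n)"

abbreviation len_T :: "nat \<Rightarrow> (int \<Rightarrow> int) \<Rightarrow> nat" where
  "len_T n \<equiv> word_length (reflections n)"

subsection \<open>Absolute order, noncrossing partitions and Bruhat order\<close>

definition abs_less :: "nat \<Rightarrow> (int \<Rightarrow> int) \<Rightarrow> (int \<Rightarrow> int) \<Rightarrow> bool" where
  "abs_less n w w' \<longleftrightarrow> w \<in> B_group n \<and> w' \<in> B_group n \<and> w \<noteq> w' \<and>
     len_T n w' = len_T n w + len_T n (inv w \<circ> w')"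

definition abs_le :: "nat \<Rightarrow> (int \<Rightarrow> int) \<Rightarrow> (int \<Rightarrow> int) \<Rightarrow> bool" where
  "abs_le n w w' \<longleftrightarrow> w = w' \<or> abs_less n w w'"

definition abs_covers :: "nat \<Rightarrow> (int \<Rightarrow> int) \<Rightarrow> (int \<Rightarrow> int) \<Rightarrow> bool" where
  "abs_covers n \<nu> \<mu> \<longleftrightarrow> abs_less n \<mu> \<nu> \<and> (\<nexists>\<rho>. abs_less n \<mu> \<rho> \<and> abs_less n \<rho> \<nu>)"

definition NC :: "nat \<Rightarrow> (int \<Rightarrow> int) set" where
  "NC n = {w \<in> B_group n. abs_le n id w \<and> abs_le n w (cox n)}"

definition bruhat_step :: "nat \<Rightarrow> (int \<Rightarrow> int) \<Rightarrow> (int \<Rightarrow> int) \<Rightarrow> bool" where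
  "bruhat_step n w w' \<longleftrightarrow> w \<in> B_group n \<and>
     (\<exists>t\<in>reflections n. w' = w \<circ> t \<and> len_S n w < len_S n (w \<circ> t))"

definition bruhat_less :: "nat \<Rightarrow> (int \<Rightarrow> int) \<Rightarrow> (int \<Rightarrow> int) \<Rightarrow> bool" where
  "bruhat_less n = (bruhat_step n)\<^sup>+\<^sup>+"

definition edge :: "nat \<Rightarrow> (int \<Rightarrow> int) \<Rightarrow> (int \<Rightarrow> int) \<Rightarrow> bool" where
  "edge n \<mu> \<nu> \<longleftrightarrow> \<mu> \<in> NC n \<and> \<nu> \<in> NC n \<and> abs_covers n \<nu> \<mu>"

definition good_edge :: "nat \<Rightarrow> (int \<Rightarrow> int) \<Rightarrow> (int \<Rightarrow> int) \<Rightarrow> bool" where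
  "good_edge n \<mu> \<nu> \<longleftrightarrow> edge n \<mu> \<nu> \<and> bruhat_less n \<mu> \<nu>"

definition bad_edge :: "nat \<Rightarrow> (int \<Rightarrow> int) \<Rightarrow> (int \<Rightarrow> int) \<Rightarrow> bool" where
  "bad_edge n \<mu> \<nu> \<longleftrightarrow> edge n \<mu> \<nu> \<and> bruhat_less n \<nu> \<mu>"

subsection \<open>Maximal chains\<close>

(* A maximal chain is represented by its increasing enumeration ws.  As NC n is graded of
   rank n, ws has n + 1 entries, ws ! i being the element of rank i. *)
definition max_chains :: "nat \<Rightarrow> (int \<Rightarrow> int) list set" where
  "max_chains n =
     {ws. sorted_wrt (abs_less n) ws \<and> pred_on.maxchain (NC n) (abs_less n) (set ws)}"

definition bad :: "nat \<Rightarrow> (int \<Rightarrow> int) list \<Rightarrow> nat" where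
  "bad n ws = card {i \<in> {1..n}. bad_edge n (ws ! (i - 1)) (ws ! i)}"

definition chain_family :: "nat \<Rightarrow> nat \<Rightarrow> (int \<Rightarrow> int) list set" where
  "chain_family n j = {ws \<in> max_chains n. bad n ws = j \<and>
     (\<forall>i\<in>{1..<n}. \<not> (bad_edge n (ws ! (i - 1)) (ws ! i) \<and>
                      bad_edge n (ws ! i) (ws ! (i + 1)))) \<and>
     good_edge n (ws ! (n - 1)) (ws ! n)}"

definition M_poly :: "nat \<Rightarrow> int poly" where
  "M_poly n = (\<Sum>ws\<in>max_chains n. monom 1 (bad n ws))"

subsection \<open>Index tuples of the closed formula\<close>

definition B_tuples :: "nat \<Rightarrow> nat \<Rightarrow> int list set" where
  "B_tuples n k = {b. length b = k \<and> set b \<subseteq> {1<..<int n} \<and> sorted_wrt (<) b \<and>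
     (\<forall>i. i + 1 < k \<longrightarrow> b ! (i + 1) - b ! i > 1)}"

end

theory Submission
  imports Defs "HOL-Library.Multiset" "HOL-Library.Numeral_Type"
begin

text \<open>
The statement holds because the two kinds of objects have the same statistics position by position.
For a set \<open>I\<close> of positions in \<open>{1..n}\<close>, the parking functions whose reluctant cars are exactly those
in \<open>I\<close> and the maximal chains whose bad edges are exactly those in \<open>I\<close> are equinumerous: both are counted
by \<open>pattern_number n I\<close>, the product over all positions \<open>i\<close> of \<open>i - 1\<close> for \<open>i\<close> in \<open>I\<close> and of \<open>n - i + 1\<close>
for the other ones (\<open>card_reluctant_set\<close>, \<open>card_bad_set\<close>).  Hence \<open>M_poly n\<close> is the product of the factors
\<open>(n - i + 1) + (i - 1) q\<close>, and both families are counted by the sum of the pattern numbers over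
the sets without two adjacent elements and without \<open>n\<close>.

For parking functions this is immediate: car \<open>i\<close> finds \<open>i - 1\<close> occupied spaces, it is reluctant
exactly if it prefers one of them, and which spaces they are does not matter.

For maximal chains, a chain is a factorization of the Coxeter element \<open>c\<close> into \<open>n\<close> reflections, and
it is read downwards from \<open>c\<close>.  Each step down splits a cycle; that no other reflection can
occur follows from a lower bound on the reflection length, obtained by counting odd
invariant functions with values in the integers modulo 3 (\<open>card_odd_fix_word\<close>, \<open>not_split_odd_fix\<close>).
By strong exchange, a step down by the reflection \<open>t\<close> crosses a good edge exactly if \<open>t\<close> is an inversion.
The cycles of the elements below \<open>c\<close> run through their entries in the order \<open>1, \<dots>, n, -1, \<dots>, -n\<close>,
so the inversions can be counted: among the \<open>M\<close> ways to cut a pair of opposite cycles of length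
\<open>M\<close> into labelled pieces of given lengths, exactly two are good, and among the \<open>m\<close> ways to detach
a pair of cycles of given length from the self-opposite cycle on \<open>m\<close> pairs, exactly one is good.
Thus the number of downward paths with a given pattern depends only on the lengths of
the cycles (\<open>path_count_eq_split_count\<close>).

Single numbers of this kind are complicated, but their sums over all lists of \<open>k\<close> cycle lengths
have a product formula (\<open>total_count_Cons\<close>).  A list of \<open>k + 1\<close> lengths arises from its predecessors by merging two of its
entries, or one entry with the self-opposite cycle; the weight of such a merge is affine
in the lengths, and averaging over the order of the list replaces the lengths by their average.
What remains is a factor that depends on \<open>n\<close> and \<open>k\<close> only, and the factors multiply up to the pattern number.

The gamma expansion of the product is then an identity about continuants.  The sum over sets without
adjacent elements satisfies a three-term recurrence (\<open>continuant_sparse\<close>); solving the recurrence by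
binomial coefficients (\<open>continuant_expansion\<close>) leaves a single term at the index that is needed,
namely the product (\<open>continuant_diagonal\<close>).
\<close>

section \<open>Signed permutations and their reflections\<close>

lemma mem_pm_set: "x \<in> pm_set n \<longleftrightarrow> x \<noteq> 0 \<and> \<bar>x\<bar> \<le> int n"
  by (auto simp: pm_set_def)

lemma uminus_pm_set [simp]: "- x \<in> pm_set n \<longleftrightarrow> x \<in> pm_set n"
  by (auto simp: mem_pm_set)

lemma finite_pm_set [simp]: "finite (pm_set n)"
  by (simp add: pm_set_def)

lemma B_group_iff: "w \<in> B_group n \<longleftrightarrow> w permutes pm_set n \<and> (\<forall>x. w (- x) = - w x)"
proof -
  have "w (- x) = - w x" if "w permutes pm_set n" "\<forall>i\<in>pm_set n. w (- i) = - w i" for x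
    using that by (cases "x \<in> pm_set n") (auto simp: permutes_not_in)
  then show ?thesis by (auto simp: B_group_def)
qed

lemma B_permutes: "w \<in> B_group n \<Longrightarrow> w permutes pm_set n"
  and B_odd: "w \<in> B_group n \<Longrightarrow> w (- x) = - w x"
  by (auto simp: B_group_iff)

lemma B_mem: "w \<in> B_group n \<Longrightarrow> w x \<in> pm_set n \<longleftrightarrow> x \<in> pm_set n"
  by (metis B_permutes permutes_in_image)

lemma B_inj: "w \<in> B_group n \<Longrightarrow> w x = w y \<longleftrightarrow> x = y"
  by (metis B_permutes permutes_inj injD)

lemma B_id [simp]: "id \<in> B_group n"
  by (simp add: B_group_iff permutes_id)

lemma B_comp: "v \<in> B_group n \<Longrightarrow> w \<in> B_group n \<Longrightarrow> v \<circ> w \<in> B_group n"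
  by (auto simp: B_group_iff intro: permutes_compose)

lemma B_inv_simps:
  assumes "w \<in> B_group n"
  shows "inv w \<circ> w = id" "w \<circ> inv w = id" "inv w (w x) = x" "w (inv w x) = x"
  using B_permutes[OF assms] by (simp_all add: permutes_inv_o permutes_inverses)

lemma B_inv:
  assumes w: "w \<in> B_group n"
  shows "inv w \<in> B_group n"
proof -
  have "inv w (- x) = - inv w x" for x
  proof -
    have "inv w (- x) = inv w (w (- inv w x))" unfolding B_odd[OF w] B_inv_simps(4)[OF w] ..
    then show ?thesis unfolding B_inv_simps(3)[OF w] .
  qed
  then show ?thesis using permutes_inv[OF B_permutes[OF w]] by (simp add: B_group_iff)
qed

text \<open>
One formula for all reflections: the pairs \<open>u\<close>, \<open>v\<close> and \<open>- u\<close>, \<open>- v\<close> are exchanged, and for \<open>v = - u\<close> the two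
exchanges coincide.
\<close>
definition signed_swap :: "int \<Rightarrow> int \<Rightarrow> int \<Rightarrow> int" where
  "signed_swap u v x =
    (if x = u then v else if x = v then u else if x = - u then - v else if x = - v then - u else x)"

lemma signed_swap_commute: "u \<noteq> 0 \<Longrightarrow> v \<noteq> 0 \<Longrightarrow> signed_swap u v = signed_swap v u"
  by (auto simp: signed_swap_def fun_eq_iff)

lemma signed_swap_uminus: "u \<noteq> 0 \<Longrightarrow> v \<noteq> 0 \<Longrightarrow> signed_swap (- u) (- v) = signed_swap u v"
  by (auto simp: signed_swap_def fun_eq_iff)

lemma signed_swap_involutive: "u \<noteq> 0 \<Longrightarrow> v \<noteq> 0 \<Longrightarrow> signed_swap u v (signed_swap u v x) = x"
  by (auto simp: signed_swap_def)

lemma signed_swap_comp_self: "u \<noteq> 0 \<Longrightarrow> v \<noteq> 0 \<Longrightarrow> signed_swap u v \<circ> signed_swap u v = id"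
  by (simp add: fun_eq_iff signed_swap_involutive)

lemma signed_swap_B:
  assumes "u \<in> pm_set n" "v \<in> pm_set n"
  shows "signed_swap u v \<in> B_group n"
proof -
  have nz: "u \<noteq> 0" "v \<noteq> 0" using assms by (auto simp: mem_pm_set)
  have "bij (signed_swap u v)"
    using signed_swap_comp_self[OF nz] by (intro o_bij)
  moreover have "signed_swap u v x = x" if "x \<notin> pm_set n" for x
  proof -
    have "x \<noteq> u" "x \<noteq> v" "x \<noteq> - u" "x \<noteq> - v" using assms that by auto
    then show ?thesis by (simp add: signed_swap_def)
  qed
  ultimately have "signed_swap u v permutes pm_set n" by (simp add: permutes_def bij_iff)
  moreover have "signed_swap u v (- x) = - signed_swap u v x" for x
    using nz by (auto simp: signed_swap_def)
  ultimately show ?thesis by (simp add: B_group_iff)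
qed

text \<open>
Conjugation by a signed permutation moves the two points of a reflection.
\<close>
lemma B_comp_signed_swap:
  assumes "w \<in> B_group n"
  shows "w \<circ> signed_swap u v = signed_swap (w u) (w v) \<circ> w"
  using assms by (auto simp: fun_eq_iff signed_swap_def B_odd[OF assms, symmetric] B_inj[OF assms])

lemma transpose_signed_swap:
  assumes "i \<noteq> 0" "j \<noteq> 0" "\<bar>i\<bar> \<noteq> \<bar>j\<bar>"
  shows "transpose i j \<circ> transpose (- i) (- j) = signed_swap i j"
  using assms by (auto simp: fun_eq_iff signed_swap_def transpose_def)

lemma transpose_neg_signed_swap: "transpose i (- i) = signed_swap i (- i)"
  by (auto simp: fun_eq_iff signed_swap_def transpose_def)

lemma reflections_eq:
  "reflections n = {signed_swap u v | u v. u \<in> pm_set n \<and> v \<in> pm_set n \<and> u < v}" (is "?L = ?R")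
proof
  show "?L \<subseteq> ?R"
  proof
    fix t assume "t \<in> ?L"
    then consider i where "t = transpose i (- i)" "1 \<le> i" "i \<le> int n"
      | i j where "t = transpose i j \<circ> transpose (- i) (- j)" "1 \<le> i" "i < j" "j \<le> int n"
      | i j where "t = transpose i (- j) \<circ> transpose (- i) j" "1 \<le> i" "i < j" "j \<le> int n"
      by (auto simp: reflections_def)
    then show "t \<in> ?R"
    proof cases
      case 1
      then have "t = signed_swap (- i) i"
        by (simp add: transpose_neg_signed_swap signed_swap_commute[of i])
      moreover have "- i \<in> pm_set n" "i \<in> pm_set n" "- i < i" using 1 by (auto simp: mem_pm_set)
      ultimately show ?thesis by blast
    next
      case 2
      then have "t = signed_swap i j" by (simp add: transpose_signed_swap)
      moreover have "i \<in> pm_set n" "j \<in> pm_set n" using 2 by (auto simp: mem_pm_set)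
      ultimately show ?thesis using 2 by blast
    next
      case 3
      then have "t = signed_swap (- j) i"
        using transpose_signed_swap[of i "- j"] by (simp add: signed_swap_commute[of i])
      moreover have "i \<in> pm_set n" "- j \<in> pm_set n" "- j < i" using 3 by (auto simp: mem_pm_set)
      ultimately show ?thesis by blast
    qed
  qed
  show "?R \<subseteq> ?L"
  proof
    fix t assume "t \<in> ?R"
    then obtain u v where t: "t = signed_swap u v" and u: "u \<in> pm_set n" and v: "v \<in> pm_set n" and "u < v"
      by blast
    then have nz: "u \<noteq> 0" "v \<noteq> 0" by (auto simp: mem_pm_set)
    have bd: "\<bar>u\<bar> \<le> int n" "\<bar>v\<bar> \<le> int n" using u v by (auto simp: mem_pm_set)
    have A: "signed_swap i j \<in> ?L" if "1 \<le> i" "i < j" "j \<le> int n" for i j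
      using that transpose_signed_swap[of i j, symmetric] unfolding reflections_def by auto
    have B: "signed_swap i (- j) \<in> ?L" if "1 \<le> i" "i < j" "j \<le> int n" for i j
    proof -
      have "signed_swap i (- j) = transpose i (- j) \<circ> transpose (- i) j"
        using that transpose_signed_swap[of i "- j"] by simp
      then show ?thesis using that unfolding reflections_def by blast
    qed
    consider "v = - u" | "0 < u" | "v < 0" | "u < 0" "0 < v" "v < - u" | "u < 0" "0 < v" "- u < v"
      using nz \<open>u < v\<close> by linarith
    then show "t \<in> ?L"
    proof cases
      case 1
      then have "u = - v" by simp
      then have "t = transpose v (- v)"
        using t nz signed_swap_commute[of v "- v"] by (simp add: transpose_neg_signed_swap)
      moreover have "1 \<le> v" "v \<le> int n" using 1 \<open>u < v\<close> bd by auto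
      ultimately show ?thesis unfolding reflections_def by blast
    next
      case 2 then show ?thesis using A[of u v] t \<open>u < v\<close> bd by auto
    next
      case 3 then show ?thesis using A[of "- v" "- u"] t \<open>u < v\<close> bd nz
        by (simp add: signed_swap_uminus signed_swap_commute)
    next
      case 4 then show ?thesis using B[of v "- u"] t bd nz by (simp add: signed_swap_commute)
    next
      case 5 then show ?thesis using B[of "- u" v] t bd nz by (simp add: signed_swap_uminus)
    qed
  qed
qed

lemma reflectionE:
  assumes "t \<in> reflections n"
  obtains u v where "t = signed_swap u v" "u \<in> pm_set n" "v \<in> pm_set n" "u < v" "u \<noteq> 0" "v \<noteq> 0"
  using assms unfolding reflections_eq by (auto simp: mem_pm_set)

lemma signed_swap_reflection:
  assumes "u \<in> pm_set n" "v \<in> pm_set n" "u \<noteq> v"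
  shows "signed_swap u v \<in> reflections n"
proof (cases "u < v")
  case True then show ?thesis using assms unfolding reflections_eq by blast
next
  case False
  then have "v < u" using assms by simp
  moreover have "signed_swap u v = signed_swap v u"
    using assms by (intro signed_swap_commute) (auto simp: mem_pm_set)
  ultimately show ?thesis using assms unfolding reflections_eq by blast
qed

lemma reflection_B: "t \<in> reflections n \<Longrightarrow> t \<in> B_group n"
  by (auto elim!: reflectionE intro: signed_swap_B)

lemma reflection_comp_self: "t \<in> reflections n \<Longrightarrow> t \<circ> t = id"
  by (auto elim!: reflectionE simp: signed_swap_comp_self)

lemma reflection_neq_id: "t \<in> reflections n \<Longrightarrow> t \<noteq> id"
proof (erule reflectionE)
  fix u v assume "t = signed_swap u v" "u < v"
  then have "t u \<noteq> id u" by (simp add: signed_swap_def)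
  then show "t \<noteq> id" by auto
qed

lemma simple_gens_eq:
  "simple_gens n = insert (signed_swap (- 1) 1) {signed_swap i (i + 1) | i. 1 \<le> i \<and> i \<le> int n - 1}"
proof -
  have "{transpose i (i + 1) \<circ> transpose (- i) (- (i + 1)) | i. 1 \<le> i \<and> i \<le> int n - 1}
    = {signed_swap i (i + 1) | i. 1 \<le> i \<and> i \<le> int n - 1}"
  proof (rule Collect_cong, rule ex_cong1)
    fix t and i :: int
    have "transpose i (i + 1) \<circ> transpose (- i) (- (i + 1)) = signed_swap i (i + 1)" if "1 \<le> i"
      using that by (intro transpose_signed_swap) auto
    then show "(t = transpose i (i + 1) \<circ> transpose (- i) (- (i + 1)) \<and> 1 \<le> i \<and> i \<le> int n - 1)
      = (t = signed_swap i (i + 1) \<and> 1 \<le> i \<and> i \<le> int n - 1)"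
      by (cases "1 \<le> i") simp_all
  qed
  moreover have "transpose 1 (- 1) = signed_swap (- 1) (1 :: int)"
    by (simp add: transpose_neg_signed_swap signed_swap_commute)
  ultimately show ?thesis unfolding simple_gens_def by simp
qed

lemma simple_gens_subset: "1 \<le> n \<Longrightarrow> simple_gens n \<subseteq> reflections n"
  unfolding simple_gens_eq by (auto intro!: signed_swap_reflection simp: mem_pm_set)

text \<open>
A simple generator exchanges neighbours in the order \<open>- n, \<dots>, - 1, 1, \<dots>, n\<close> and so can reverse the order
of two points only by exchanging precisely these two.
\<close>
lemma simple_gen_inversion:
  assumes "s \<in> simple_gens n" "u \<noteq> 0" "v \<noteq> 0" "u < v" "s v < s u"
  shows "s = signed_swap u v"
proof -
  consider "s = signed_swap (- 1) 1" | i where "s = signed_swap i (i + 1)" "1 \<le> i"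
    using assms(1) unfolding simple_gens_eq by blast
  then show ?thesis
  proof cases
    case 1
    then have "u = - 1 \<and> v = 1"
      using assms(2-5) by (auto simp: signed_swap_def split: if_splits)
    then show ?thesis using 1 by simp
  next
    case 2
    have val: "s x = (if x = i \<or> x = - i - 1 then x + 1 else if x = i + 1 \<or> x = - i then x - 1 else x)" for x
      using 2 by (auto simp: signed_swap_def)
    have "x - 1 \<le> s x" "s x \<le> x + 1" for x unfolding val by auto
    from this(2)[of u] this(1)[of v] have "v = u + 1" using assms(4,5) by linarith
    then have "(u = i \<and> v = i + 1) \<or> (u = - (i + 1) \<and> v = - i)"
      using assms(5) 2(2) unfolding val by (auto split: if_splits)
    then show ?thesis
      using 2 signed_swap_uminus[of "i + 1" i] signed_swap_commute[of i "i + 1"] by auto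
  qed
qed

section \<open>Words in generators and strong exchange\<close>

definition word_prod :: "('a \<Rightarrow> 'a) list \<Rightarrow> 'a \<Rightarrow> 'a" where
  "word_prod xs = foldr (\<circ>) xs id"

lemma word_prod_Nil [simp]: "word_prod [] = id"
  and word_prod_Cons [simp]: "word_prod (x # xs) = x \<circ> word_prod xs"
  by (simp_all add: word_prod_def)

lemma word_prod_append: "word_prod (xs @ ys) = word_prod xs \<circ> word_prod ys"
  by (induction xs) (auto simp: comp_assoc)

lemma word_length_le:
  assumes "set xs \<subseteq> X" "word_prod xs = w"
  shows "word_length X w \<le> length xs"
  unfolding word_length_def using assms unfolding word_prod_def by (intro Least_le) blast

lemma word_length_word:
  assumes "set ys \<subseteq> X" "word_prod ys = w"
  obtains xs where "length xs = word_length X w" "set xs \<subseteq> X" "word_prod xs = w"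
proof -
  have "\<exists>k xs. length xs = k \<and> set xs \<subseteq> X \<and> foldr (\<circ>) xs id = w"
    using assms unfolding word_prod_def by blast
  from LeastI_ex[OF this] show ?thesis using that unfolding word_length_def word_prod_def by blast
qed

lemma word_prod_B: "set xs \<subseteq> B_group n \<Longrightarrow> word_prod xs \<in> B_group n"
  by (induction xs) (auto intro: B_comp)

text \<open>
Follow the images of \<open>u < v\<close> through the word, starting from its last letter.  Their order is reversed at some
letter, and by \<open>simple_gen_inversion\<close> that letter exchanges them; deleting it amounts to multiplying by the reflection.
\<close>
lemma strong_exchange:
  assumes "1 \<le> n" "set xs \<subseteq> simple_gens n" "u \<in> pm_set n" "v \<in> pm_set n" "u < v"
    and "word_prod xs v < word_prod xs u"
  shows "\<exists>ys. set ys \<subseteq> simple_gens n \<and> length ys < length xs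
    \<and> word_prod ys = word_prod xs \<circ> signed_swap u v"
  using assms(2,6)
proof (induction xs)
  case Nil
  then show ?case using assms by simp
next
  case (Cons s xs)
  let ?w = "word_prod xs"
  have S: "simple_gens n \<subseteq> reflections n" using assms by (simp add: simple_gens_subset)
  then have w: "?w \<in> B_group n" using Cons.prems reflection_B by (intro word_prod_B) auto
  have s: "s \<in> simple_gens n" using Cons.prems by simp
  have nz: "?w u \<noteq> 0" "?w v \<noteq> 0" using assms(3,4) B_mem[OF w] by (metis mem_pm_set)+
  consider "?w v < ?w u" | "?w u < ?w v" using B_inj[OF w, of u v] assms(5) by force
  then show ?case
  proof cases
    case 1
    \<comment> \<open>The order is already reversed by the shorter word, which contains the letter to be deleted.\<close>
    moreover have "set xs \<subseteq> simple_gens n" using Cons.prems by simp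
    ultimately obtain ys where ys: "set ys \<subseteq> simple_gens n" "length ys < length xs"
      "word_prod ys = ?w \<circ> signed_swap u v"
      using Cons.IH by blast
    have "word_prod (s # ys) = word_prod (s # xs) \<circ> signed_swap u v"
      by (simp only: word_prod_Cons ys comp_assoc)
    moreover have "set (s # ys) \<subseteq> simple_gens n" "length (s # ys) < length (s # xs)" using s ys by auto
    ultimately show ?thesis by blast
  next
    case 2
    \<comment> \<open>The first letter is the one that reverses the order.\<close>
    then have "s = signed_swap (?w u) (?w v)"
      using simple_gen_inversion[OF s nz] Cons.prems by simp
    then have "word_prod (s # xs) \<circ> signed_swap u v = s \<circ> s \<circ> ?w"
      using B_comp_signed_swap[OF w, of u v] by (simp add: comp_assoc)
    also have "\<dots> = ?w" using reflection_comp_self s S by auto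
    finally have "word_prod xs = word_prod (s # xs) \<circ> signed_swap u v" ..
    moreover have "set xs \<subseteq> simple_gens n" "length xs < length (s # xs)" using Cons.prems by auto
    ultimately show ?thesis by blast
  qed
qed

text \<open>
An increasing map from \<open>{1..n}\<close> to itself is the identity; positivity at 1 confines the values to that set.
\<close>
lemma B_no_descent:
  assumes w: "w \<in> B_group n" and pos: "0 < w 1" and asc: "\<And>i. 1 \<le> i \<Longrightarrow> i < int n \<Longrightarrow> w i < w (i + 1)"
  shows "w = id"
proof -
  have ge: "i \<le> w i" if "1 \<le> i" "i \<le> int n" for i
    using that
  proof (induction i rule: int_ge_induct)
    case (step i)
    then show ?case using asc[of i] by simp
  qed (use pos in simp)
  have le: "w (int n - int k) \<le> int n - int k" if "k < n" for k
    using that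
  proof (induction k)
    case 0
    have "w (int n) \<in> pm_set n" using 0 B_mem[OF w] by (simp add: mem_pm_set)
    then have "\<bar>w (int n)\<bar> \<le> int n" by (simp only: mem_pm_set)
    then show ?case by simp
  next
    case (Suc k)
    then have "w (int n - int (Suc k)) < w (int n - int (Suc k) + 1)" by (intro asc) auto
    moreover have "int n - int (Suc k) + 1 = int n - int k" by simp
    ultimately show ?case using Suc by simp
  qed
  have "w i = i" if "1 \<le> i" "i \<le> int n" for i
    using ge[OF that] le[of "n - nat i"] that by (simp add: of_nat_diff)
  then have "w x = x" if "x \<in> pm_set n" for x
  proof (cases "0 < x")
    case True
    then show ?thesis using that \<open>\<And>i. 1 \<le> i \<Longrightarrow> i \<le> int n \<Longrightarrow> w i = i\<close>[of x] by (simp add: mem_pm_set)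
  next
    case False
    then have "w (- x) = - x"
      using that \<open>\<And>i. 1 \<le> i \<Longrightarrow> i \<le> int n \<Longrightarrow> w i = i\<close>[of "- x"] by (simp add: mem_pm_set)
    then show ?thesis using B_odd[OF w, of x] by simp
  qed
  moreover have "w x = x" if "x \<notin> pm_set n" for x
    using B_permutes[OF w] that by (rule permutes_not_in)
  ultimately have "w x = id x" for x by (cases "x \<in> pm_set n") simp_all
  then show ?thesis by (rule ext)
qed

text \<open>
Without this, the word length with respect to the simple generators would be the least element
of an empty set.  Removing a descent increases the weighted sum of the values at the positive points, which is bounded.
\<close>
lemma simple_gens_generate:
  assumes n: "1 \<le> n" and w: "w \<in> B_group n"
  shows "\<exists>xs. set xs \<subseteq> simple_gens n \<and> word_prod xs = w"
proof -
  \<comment> \<open>The potential that grows whenever a descent is removed.\<close>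
  define \<Phi> where "\<Phi> w = (\<Sum>i\<in>{1..int n}. i * w i)" for w
  have bound: "\<Phi> w \<le> (\<Sum>i\<in>{1..int n}. i * int n)" if "w \<in> B_group n" for w
    unfolding \<Phi>_def
  proof (rule sum_mono)
    fix i assume i: "i \<in> {1..int n}"
    then have "w i \<in> pm_set n" using that B_mem by (auto simp: mem_pm_set)
    then show "i * w i \<le> i * int n" using i by (intro mult_left_mono) (auto simp: mem_pm_set)
  qed
  let ?N = "\<Sum>i\<in>{1..int n}. i * int n"
  have step: "\<exists>s\<in>simple_gens n. \<Phi> w < \<Phi> (w \<circ> s)" if w: "w \<in> B_group n" "w \<noteq> id" for w
  proof -
    have "\<not> 0 < w 1 \<or> (\<exists>i. 1 \<le> i \<and> i < int n \<and> \<not> w i < w (i + 1))"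
      using B_no_descent[OF w(1)] w(2) by blast
    then consider "w 1 < 0" | i where "1 \<le> i" "i < int n" "w (i + 1) < w i"
    proof
      assume "\<not> 0 < w 1"
      moreover have "w 1 \<noteq> 0" using B_mem[OF w(1), of 1] n by (auto simp: mem_pm_set)
      ultimately show thesis using that by simp
    next
      assume "\<exists>i. 1 \<le> i \<and> i < int n \<and> \<not> w i < w (i + 1)"
      then obtain i where i: "1 \<le> i" "i < int n" "\<not> w i < w (i + 1)" by blast
      then have "w i \<noteq> w (i + 1)" using B_inj[OF w(1)] by simp
      then show thesis using that i by simp
    qed
    then show ?thesis
    proof cases
      case 1
      let ?s = "signed_swap (- 1) 1"
      have split: "{1..int n} = insert 1 {2..int n}" using n by auto
      have "\<Phi> (w \<circ> ?s) = - w 1 + (\<Sum>i\<in>{2..int n}. i * w i)"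
      proof -
        have "(\<Sum>i\<in>{2..int n}. i * w (?s i)) = (\<Sum>i\<in>{2..int n}. i * w i)"
          by (rule sum.cong) (auto simp: signed_swap_def)
        moreover have "w (?s 1) = - w 1" using B_odd[OF w(1), of 1] by (simp add: signed_swap_def)
        ultimately show ?thesis unfolding \<Phi>_def split by simp
      qed
      then have "\<Phi> w < \<Phi> (w \<circ> ?s)" using 1 unfolding \<Phi>_def split by simp
      then show ?thesis unfolding simple_gens_eq by blast
    next
      case 2
      let ?s = "signed_swap i (i + 1)"
      let ?R = "{1..int n} - {i, i + 1}"
      have split: "{1..int n} = insert i (insert (i + 1) ?R)" using 2 by auto
      have eq: "(\<Sum>j\<in>{1..int n}. f j) = f i + f (i + 1) + (\<Sum>j\<in>?R. f j)" for f :: "int \<Rightarrow> int"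
        by (subst split) simp
      have "(\<Sum>j\<in>?R. j * w (?s j)) = (\<Sum>j\<in>?R. j * w j)"
        using 2 by (intro sum.cong) (auto simp: signed_swap_def)
      moreover have "?s i = i + 1" "?s (i + 1) = i" by (auto simp: signed_swap_def)
      ultimately have "\<Phi> (w \<circ> ?s) - \<Phi> w = w i - w (i + 1)"
        unfolding \<Phi>_def eq by (simp add: algebra_simps)
      then have "\<Phi> w < \<Phi> (w \<circ> ?s)" using 2 by simp
      moreover have "?s \<in> simple_gens n" using 2 unfolding simple_gens_eq by auto
      ultimately show ?thesis by blast
    qed
  qed
  show ?thesis using w
  proof (induction "nat (?N - \<Phi> w)" arbitrary: w rule: less_induct)
    case less
    show ?case
    proof (cases "w = id")
      case True
      then show ?thesis by (intro exI[of _ "[]"]) simp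
    next
      case False
      then obtain s where s: "s \<in> simple_gens n" "\<Phi> w < \<Phi> (w \<circ> s)"
        using step less.prems by blast
      have sB: "s \<in> reflections n" using s n simple_gens_subset by blast
      then have ws: "w \<circ> s \<in> B_group n" using less.prems reflection_B B_comp by blast
      have "nat (?N - \<Phi> (w \<circ> s)) < nat (?N - \<Phi> w)" using s(2) bound[OF ws] by simp
      then obtain xs where xs: "set xs \<subseteq> simple_gens n" "word_prod xs = w \<circ> s"
        using less.hyps ws by blast
      have "word_prod (xs @ [s]) = w \<circ> (s \<circ> s)"
        unfolding word_prod_append xs word_prod_Cons word_prod_Nil comp_id comp_assoc ..
      also have "\<dots> = w" unfolding reflection_comp_self[OF sB] by (rule comp_id)
      finally have "word_prod (xs @ [s]) = w" .
      moreover have "set (xs @ [s]) \<subseteq> simple_gens n" using xs s by simp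
      ultimately show ?thesis by blast
    qed
  qed
qed

text \<open>
Apply strong exchange to a shortest word.
\<close>
lemma len_S_swap_less:
  assumes "1 \<le> n" "w \<in> B_group n" "u \<in> pm_set n" "v \<in> pm_set n" "u < v" "w v < w u"
  shows "len_S n (w \<circ> signed_swap u v) < len_S n w"
proof -
  obtain xs0 where "set xs0 \<subseteq> simple_gens n" "word_prod xs0 = w"
    using simple_gens_generate assms by blast
  then obtain xs where xs: "length xs = len_S n w" "set xs \<subseteq> simple_gens n" "word_prod xs = w"
    by (rule word_length_word)
  then obtain ys where "set ys \<subseteq> simple_gens n" "length ys < length xs" "word_prod ys = w \<circ> signed_swap u v"
    using strong_exchange[OF assms(1) xs(2) assms(3-5)] assms(6) by auto
  then show ?thesis using word_length_le[of ys "simple_gens n" "w \<circ> signed_swap u v"] xs(1) by linarith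
qed

lemma len_S_swap_greater:
  assumes "1 \<le> n" "w \<in> B_group n" "u \<in> pm_set n" "v \<in> pm_set n" "u < v" "w u < w v"
  shows "len_S n w < len_S n (w \<circ> signed_swap u v)"
proof -
  let ?w = "w \<circ> signed_swap u v"
  have nz: "u \<noteq> 0" "v \<noteq> 0" using assms by (auto simp: mem_pm_set)
  have "?w \<in> B_group n" using assms signed_swap_B B_comp by blast
  moreover have "?w v < ?w u" using assms by (simp add: signed_swap_def)
  ultimately have "len_S n (?w \<circ> signed_swap u v) < len_S n ?w"
    using len_S_swap_less assms by blast
  then show ?thesis using signed_swap_comp_self[OF nz] by (simp add: comp_assoc)
qed

lemma len_S_swap_iff:
  assumes "1 \<le> n" "w \<in> B_group n" "u \<in> pm_set n" "v \<in> pm_set n" "u \<noteq> v"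
  shows "len_S n (w \<circ> signed_swap u v) < len_S n w \<longleftrightarrow> (u < v \<longleftrightarrow> w v < w u)"
    and "len_S n (w \<circ> signed_swap u v) \<noteq> len_S n w"
proof -
  have *: "(len_S n (w \<circ> signed_swap u v) < len_S n w \<longleftrightarrow> w v < w u) \<and> len_S n (w \<circ> signed_swap u v) \<noteq> len_S n w"
    if "u < v" "u \<in> pm_set n" "v \<in> pm_set n" for u v
  proof -
    have "w u \<noteq> w v" using that B_inj[OF assms(2)] by simp
    then consider "w u < w v" | "w v < w u" by linarith
    then show ?thesis
    proof cases
      case 1
      then show ?thesis using len_S_swap_greater[OF assms(1,2) that(2,3,1)] by simp
    next
      case 2
      then show ?thesis using len_S_swap_less[OF assms(1,2) that(2,3,1)] by simp
    qed
  qed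
  have nz: "u \<noteq> 0" "v \<noteq> 0" using assms by (auto simp: mem_pm_set)
  have ne: "w u \<noteq> w v" using assms B_inj by blast
  have "(len_S n (w \<circ> signed_swap u v) < len_S n w \<longleftrightarrow> (u < v \<longleftrightarrow> w v < w u))
    \<and> len_S n (w \<circ> signed_swap u v) \<noteq> len_S n w"
  proof (cases "u < v")
    case True
    then show ?thesis using *[OF True assms(3,4)] by simp
  next
    case False
    then have "v < u" using assms by simp
    from *[OF this assms(4,3)] show ?thesis
      unfolding signed_swap_commute[OF nz(2,1)] using False ne by auto
  qed
  then show "len_S n (w \<circ> signed_swap u v) < len_S n w \<longleftrightarrow> (u < v \<longleftrightarrow> w v < w u)"
    and "len_S n (w \<circ> signed_swap u v) \<noteq> len_S n w" by auto
qed

section \<open>Maximal chains as reflection factorizations\<close>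

text \<open>
Factorizations of the Coxeter element into \<open>n\<close> reflections, recorded by their partial products.
\<close>
definition factor_chain :: "nat \<Rightarrow> (int \<Rightarrow> int) list \<Rightarrow> bool" where
  "factor_chain n ws \<longleftrightarrow> length ws = Suc n \<and> ws ! 0 = id \<and> ws ! n = cox n \<and>
     (\<forall>i<n. \<exists>t\<in>reflections n. ws ! Suc i = ws ! i \<circ> t)"

lemma reflections_subset_B: "reflections n \<subseteq> B_group n"
  using reflection_B by blast

lemma reflection_word:
  assumes "1 \<le> n" "w \<in> B_group n"
  obtains xs where "length xs = len_T n w" "set xs \<subseteq> reflections n" "word_prod xs = w"
proof -
  obtain xs where "set xs \<subseteq> simple_gens n" "word_prod xs = w"
    using simple_gens_generate[OF assms] by blast
  then have "set xs \<subseteq> reflections n" using simple_gens_subset[OF assms(1)] by blast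
  then show ?thesis using \<open>word_prod xs = w\<close> by (rule word_length_word) (rule that)
qed

lemma len_T_triangle:
  assumes "1 \<le> n" "v \<in> B_group n" "w \<in> B_group n"
  shows "len_T n (v \<circ> w) \<le> len_T n v + len_T n w"
proof -
  obtain xs where xs: "length xs = len_T n v" "set xs \<subseteq> reflections n" "word_prod xs = v"
    using reflection_word assms by blast
  obtain ys where ys: "length ys = len_T n w" "set ys \<subseteq> reflections n" "word_prod ys = w"
    using reflection_word assms by blast
  have "len_T n (v \<circ> w) \<le> length (xs @ ys)"
    using xs ys by (intro word_length_le) (auto simp: word_prod_append)
  then show ?thesis using xs ys by simp
qed

lemma len_T_id [simp]: "len_T n id = 0"
  using word_length_le[of "[]" "reflections n" id] by simp

lemma len_T_eq_0:
  assumes "1 \<le> n" "w \<in> B_group n" "len_T n w = 0"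
  shows "w = id"
  using reflection_word[OF assms(1,2)] assms(3) by (metis length_0_conv word_prod_Nil)

lemma len_T_le_1: "t \<in> reflections n \<Longrightarrow> len_T n t \<le> 1"
  using word_length_le[of "[t]" "reflections n" t] by simp

lemma len_T_reflection:
  assumes "1 \<le> n" "t \<in> reflections n"
  shows "len_T n t = 1"
  using len_T_eq_0[OF assms(1) reflection_B[OF assms(2)]] reflection_neq_id[OF assms(2)] len_T_le_1[OF assms(2)]
  by linarith

lemma abs_less_B: "abs_less n a b \<Longrightarrow> a \<in> B_group n" "abs_less n a b \<Longrightarrow> b \<in> B_group n"
  by (simp_all add: abs_less_def)

lemma abs_less_len_T:
  assumes "1 \<le> n" "abs_less n a b"
  shows "len_T n a < len_T n b"
proof -
  have B: "a \<in> B_group n" "b \<in> B_group n" using assms abs_less_B by auto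
  have "len_T n (inv a \<circ> b) \<noteq> 0"
  proof
    assume "len_T n (inv a \<circ> b) = 0"
    then have "inv a \<circ> b = id" using len_T_eq_0[OF assms(1)] B_comp[OF B_inv[OF B(1)] B(2)] by blast
    then have "a \<circ> (inv a \<circ> b) = a" by simp
    then have "a = b" using B_inv_simps(2)[OF B(1)] by (simp add: comp_assoc[symmetric])
    then show False using assms(2) by (simp add: abs_less_def)
  qed
  then show ?thesis using assms(2) by (simp add: abs_less_def)
qed

lemma inv_comp_cancel:
  assumes "a \<in> B_group n"
  shows "a \<circ> (inv a \<circ> b) = b" "inv a \<circ> (a \<circ> b) = b"
  using B_inv_simps(1,2)[OF assms] by (simp_all add: comp_assoc[symmetric])

text \<open>
The triangle inequality for the reflection length, used twice, forces equality along \<open>a\<close>, \<open>b\<close>, \<open>d\<close>.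
\<close>
lemma abs_less_trans:
  assumes "1 \<le> n" "abs_less n a b" "abs_less n b d"
  shows "abs_less n a d"
proof -
  have B: "a \<in> B_group n" "b \<in> B_group n" "d \<in> B_group n" using assms abs_less_B by auto
  have q: "inv a \<circ> d = (inv a \<circ> b) \<circ> (inv b \<circ> d)"
    unfolding comp_assoc inv_comp_cancel(1)[OF B(2)] ..
  have "len_T n (inv a \<circ> d) \<le> len_T n (inv a \<circ> b) + len_T n (inv b \<circ> d)"
    unfolding q using B by (intro len_T_triangle assms(1) B_comp B_inv)
  moreover have "len_T n (a \<circ> (inv a \<circ> d)) \<le> len_T n a + len_T n (inv a \<circ> d)"
    using B by (intro len_T_triangle assms(1) B_comp B_inv)
  ultimately have "len_T n d = len_T n a + len_T n (inv a \<circ> d)"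
    using assms(2,3) unfolding inv_comp_cancel(1)[OF B(1)] by (simp add: abs_less_def)
  moreover have "a \<noteq> d"
    using abs_less_len_T[OF assms(1,2)] abs_less_len_T[OF assms(1,3)] by auto
  ultimately show ?thesis using B by (simp add: abs_less_def)
qed

text \<open>
The first letter of a shortest reflection word for the quotient leads to an intermediate element of the next rank.
\<close>
lemma abs_less_refine:
  assumes n: "1 \<le> n" and ab: "abs_less n a b" and gap: "len_T n a + 1 < len_T n b"
  obtains r where "abs_less n a r" "abs_less n r b" "len_T n r = len_T n a + 1"
proof -
  have B: "a \<in> B_group n" "b \<in> B_group n" using ab abs_less_B by auto
  have q: "inv a \<circ> b \<in> B_group n" using B by (intro B_comp B_inv)
  obtain xs where xs: "length xs = len_T n (inv a \<circ> b)" "set xs \<subseteq> reflections n" "word_prod xs = inv a \<circ> b"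
    using reflection_word[OF n q] .
  have lb: "len_T n b = len_T n a + length xs" using ab xs(1) by (simp add: abs_less_def)
  then obtain t ys where txs: "xs = t # ys" using gap by (cases xs) auto
  have t: "t \<in> reflections n" and ys: "set ys \<subseteq> reflections n" using xs txs by auto
  have tB: "t \<in> B_group n" using t reflection_B by blast
  have yB: "word_prod ys \<in> B_group n" using ys reflections_subset_B by (intro word_prod_B) blast
  define r where "r = a \<circ> t"
  have rB: "r \<in> B_group n" using B tB B_comp by (simp add: r_def)
  have "b = a \<circ> (inv a \<circ> b)" by (rule inv_comp_cancel(1)[OF B(1), symmetric])
  also have "\<dots> = r \<circ> word_prod ys" unfolding xs(3)[symmetric] txs r_def word_prod_Cons comp_assoc ..
  finally have br: "b = r \<circ> word_prod ys" .
  have ar: "inv a \<circ> r = t" unfolding r_def using inv_comp_cancel(2)[OF B(1)] .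
  have rb: "inv r \<circ> b = word_prod ys" unfolding br using inv_comp_cancel(2)[OF rB] .
  have "len_T n r \<le> len_T n a + 1"
    using len_T_triangle[OF n B(1) tB] len_T_reflection[OF n t] by (simp add: r_def)
  moreover have "len_T n b \<le> len_T n r + len_T n (word_prod ys)"
    unfolding br by (rule len_T_triangle[OF n rB yB])
  moreover have "len_T n (word_prod ys) \<le> length ys"
    using ys by (intro word_length_le) simp_all
  ultimately have "len_T n r = len_T n a + 1" "len_T n (word_prod ys) = length ys"
    using lb txs by simp_all
  moreover from this have "a \<noteq> r" "r \<noteq> b" using gap by auto
  ultimately show ?thesis
    using that[of r] B rB lb txs len_T_reflection[OF n t] unfolding abs_less_def ar rb by simp
qed

lemma abs_less_step:
  assumes n: "1 \<le> n" and ab: "abs_less n a b" and gap: "len_T n b = len_T n a + 1"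
  shows "\<exists>t\<in>reflections n. b = a \<circ> t"
proof -
  have B: "a \<in> B_group n" "b \<in> B_group n" using ab abs_less_B by auto
  have q: "inv a \<circ> b \<in> B_group n" using B by (intro B_comp B_inv)
  obtain xs where xs: "length xs = len_T n (inv a \<circ> b)" "set xs \<subseteq> reflections n" "word_prod xs = inv a \<circ> b"
    using reflection_word[OF n q] .
  have "length xs = 1" using ab gap xs(1) by (simp add: abs_less_def)
  then obtain t where "xs = [t]" by (auto simp: length_Suc_conv)
  then have t: "t \<in> reflections n" "t = inv a \<circ> b" using xs by auto
  have "b = a \<circ> t" unfolding t(2) by (rule inv_comp_cancel(1)[OF B(1), symmetric])
  then show ?thesis using t(1) by blast
qed

text \<open>
A product of \<open>j - i\<close> reflections has length at most \<open>j - i\<close>.  As the whole chain has \<open>n\<close> steps and its top has length \<open>n\<close>, every one of these estimates is sharp.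
\<close>
lemma factor_chain_facts:
  assumes n: "1 \<le> n" and c: "len_T n (cox n) = n" and ch: "factor_chain n ws"
  shows "\<And>i. i \<le> n \<Longrightarrow> ws ! i \<in> B_group n"
    and "\<And>i. i \<le> n \<Longrightarrow> len_T n (ws ! i) = i"
    and "\<And>i j. i < j \<Longrightarrow> j \<le> n \<Longrightarrow> abs_less n (ws ! i) (ws ! j)"
    and "\<And>i. i \<le> n \<Longrightarrow> ws ! i \<in> NC n"
proof -
  have ws: "ws ! 0 = id" "ws ! n = cox n" using ch by (simp_all add: factor_chain_def)
  have step: "\<exists>t\<in>reflections n. ws ! Suc i = ws ! i \<circ> t" if "i < n" for i
    using ch that by (simp add: factor_chain_def)
  show B: "ws ! i \<in> B_group n" if "i \<le> n" for i
    using that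
  proof (induction i)
    case (Suc i)
    then obtain t where t: "t \<in> reflections n" "ws ! Suc i = ws ! i \<circ> t" using step[of i] by auto
    have "ws ! i \<in> B_group n" using Suc by simp
    then show ?case unfolding t(2) by (rule B_comp) (rule reflection_B[OF t(1)])
  qed (simp add: ws)
  have quot: "\<exists>xs. set xs \<subseteq> reflections n \<and> length xs = j - i \<and> ws ! j = ws ! i \<circ> word_prod xs"
    if "i \<le> j" "j \<le> n" for i j
    using that
  proof (induction j rule: dec_induct)
    case base
    show ?case by (intro exI[of _ "[]"]) simp
  next
    case (step k)
    then obtain xs where xs: "set xs \<subseteq> reflections n" "length xs = k - i" "ws ! k = ws ! i \<circ> word_prod xs"
      using Suc_leD by blast
    obtain t where t: "t \<in> reflections n" "ws ! Suc k = ws ! k \<circ> t"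
      using \<open>\<And>i. i < n \<Longrightarrow> \<exists>t\<in>reflections n. ws ! Suc i = ws ! i \<circ> t\<close>[of k] step.prems by auto
    have "ws ! Suc k = ws ! i \<circ> word_prod (xs @ [t])"
      unfolding t(2) xs(3) word_prod_append by (simp add: comp_assoc)
    moreover have "set (xs @ [t]) \<subseteq> reflections n" "length (xs @ [t]) = Suc k - i"
      using xs t step.hyps by auto
    ultimately show ?case by blast
  qed
  have qlen: "len_T n (inv (ws ! i) \<circ> ws ! j) \<le> j - i \<and> len_T n (ws ! j) \<le> len_T n (ws ! i) + len_T n (inv (ws ! i) \<circ> ws ! j)"
    if ij: "i \<le> j" "j \<le> n" for i j
  proof -
    obtain xs where xs: "set xs \<subseteq> reflections n" "length xs = j - i" "ws ! j = ws ! i \<circ> word_prod xs"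
      using quot[OF ij] by blast
    have iB: "ws ! i \<in> B_group n" using B ij by simp
    have eq: "inv (ws ! i) \<circ> ws ! j = word_prod xs"
      unfolding xs(3) using inv_comp_cancel(2)[OF iB] .
    have "len_T n (word_prod xs) \<le> j - i" using word_length_le[OF xs(1) refl] xs(2) by simp
    moreover have "len_T n (ws ! j) \<le> len_T n (ws ! i) + len_T n (word_prod xs)"
      unfolding xs(3) using xs(1) reflections_subset_B by (intro len_T_triangle n iB word_prod_B) blast
    ultimately show ?thesis unfolding eq by simp
  qed
  show len: "len_T n (ws ! i) = i" if "i \<le> n" for i
    using qlen[of 0 i] qlen[of i n] that ws c by (simp, linarith)
  show less: "abs_less n (ws ! i) (ws ! j)" if "i < j" "j \<le> n" for i j
  proof -
    have "len_T n (inv (ws ! i) \<circ> ws ! j) = j - i"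
      using qlen[of i j] len[of i] len[of j] that by (simp, linarith)
    moreover have "ws ! i \<noteq> ws ! j" using len[of i] len[of j] that by auto
    ultimately show ?thesis using that B len by (simp add: abs_less_def)
  qed
  show "ws ! i \<in> NC n" if "i \<le> n" for i
  proof -
    have "abs_le n id (ws ! i)"
      using less[of 0 i] that ws by (cases "i = 0") (auto simp: abs_le_def)
    moreover have "abs_le n (ws ! i) (cox n)"
      using less[of i n] that ws by (cases "i = n") (auto simp: abs_le_def)
    ultimately show ?thesis using B that by (simp add: NC_def)
  qed
qed

text \<open>
The chain contains an element of each possible rank, and comparable elements of the same rank are equal.
\<close>
lemma factor_chain_max_chains:
  assumes n: "1 \<le> n" and c: "len_T n (cox n) = n" and ch: "factor_chain n ws"
  shows "ws \<in> max_chains n"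
proof -
  note facts = factor_chain_facts[OF assms]
  have l: "length ws = Suc n" using ch by (simp add: factor_chain_def)
  have sorted: "sorted_wrt (abs_less n) ws"
    unfolding sorted_wrt_iff_nth_less using facts(3) l by auto
  have sub: "set ws \<subseteq> NC n" using facts(4) l by (auto simp: in_set_conv_nth)
  have tot: "(abs_less n)\<^sup>=\<^sup>= x y \<or> (abs_less n)\<^sup>=\<^sup>= y x" if xy: "x \<in> set ws" "y \<in> set ws" for x y
  proof -
    obtain i where "i < length ws" "ws ! i = x" using xy(1) unfolding in_set_conv_nth by blast
    moreover obtain j where "j < length ws" "ws ! j = y" using xy(2) unfolding in_set_conv_nth by blast
    ultimately have ij: "x = ws ! i" "i \<le> n" "y = ws ! j" "j \<le> n" using l by simp_all
    consider "i = j" | "i < j" | "j < i" by linarith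
    then show ?thesis using facts(3)[of i j] facts(3)[of j i] ij by cases auto
  qed
  \<comment> \<open>A new element would have the rank of an element of the chain.\<close>
  have "\<not> (\<exists>S. pred_on.chain (NC n) (abs_less n) S \<and> set ws \<subset> S)"
  proof
    assume "\<exists>S. pred_on.chain (NC n) (abs_less n) S \<and> set ws \<subset> S"
    then obtain S where S0: "pred_on.chain (NC n) (abs_less n) S" "set ws \<subset> S" by (elim exE conjE)
    from psubset_imp_ex_mem[OF S0(2)] obtain r where S: "pred_on.chain (NC n) (abs_less n) S" "set ws \<subseteq> S" "r \<in> S" "r \<notin> set ws"
      using S0 by auto
    then have r: "r \<in> NC n" by (auto simp: pred_on.chain_def)
    have "len_T n r \<le> n"
    proof (cases "r = cox n")
      case False
      then have "abs_less n r (cox n)" using r by (simp add: NC_def abs_le_def)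
      then show ?thesis using abs_less_len_T[OF n, of r "cox n"] c by simp
    qed (simp add: c)
    then have i: "len_T n (ws ! len_T n r) = len_T n r" "ws ! len_T n r \<in> set ws"
      by (rule facts(2), simp add: l)
    have x: "ws ! len_T n r \<in> S" using S(2) i(2) by (rule subsetD)
    have "ws ! len_T n r \<noteq> r" using S(4) i(2) by metis
    then have "abs_less n (ws ! len_T n r) r \<or> abs_less n r (ws ! len_T n r)"
      using pred_on.chain_total[OF S(1) x S(3)] by simp
    then show False
    proof
      assume "abs_less n (ws ! len_T n r) r"
      from abs_less_len_T[OF n this] show False unfolding i(1) by simp
    next
      assume "abs_less n r (ws ! len_T n r)"
      from abs_less_len_T[OF n this] show False unfolding i(1) by simp
    qed
  qed
  moreover have "pred_on.chain (NC n) (abs_less n) (set ws)"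
    unfolding pred_on.chain_def using sub tot by blast
  ultimately have "pred_on.maxchain (NC n) (abs_less n) (set ws)"
    unfolding pred_on.maxchain_def by blast
  then show ?thesis using sorted by (simp add: max_chains_def)
qed

text \<open>
Maximality forces the bottom and the top element into the chain and, by \<open>abs_less_refine\<close>, excludes jumps of the rank.
\<close>
lemma max_chains_factor_chain:
  assumes n: "1 \<le> n" and c: "len_T n (cox n) = n" "cox n \<in> B_group n" and ws: "ws \<in> max_chains n"
  shows "factor_chain n ws"
proof -
  have sorted: "abs_less n (ws ! i) (ws ! j)" if "i < j" "j < length ws" for i j
    using ws that by (simp add: max_chains_def sorted_wrt_iff_nth_less)
  have mc: "pred_on.maxchain (NC n) (abs_less n) (set ws)" using ws by (simp add: max_chains_def)
  have sub: "set ws \<subseteq> NC n"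
    and tot: "\<And>x y. x \<in> set ws \<Longrightarrow> y \<in> set ws \<Longrightarrow> (abs_less n)\<^sup>=\<^sup>= x y \<or> (abs_less n)\<^sup>=\<^sup>= y x"
    using mc unfolding pred_on.maxchain_def pred_on.chain_def by blast+
  \<comment> \<open>Maximality: an element that is comparable with the whole chain belongs to it.\<close>
  have insert: "r \<in> set ws" if r: "r \<in> NC n" "\<And>x. x \<in> set ws \<Longrightarrow> x = r \<or> abs_less n x r \<or> abs_less n r x" for r
  proof (rule ccontr)
    assume "r \<notin> set ws"
    then have "set ws \<subset> insert r (set ws)" by blast
    moreover have "pred_on.chain (NC n) (abs_less n) (insert r (set ws))"
      unfolding pred_on.chain_def using sub r tot by auto
    ultimately show False using mc unfolding pred_on.maxchain_def by blast
  qed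
  have NC_le: "x = cox n \<or> abs_less n x (cox n)" and NC_ge: "x = id \<or> abs_less n id x" if "x \<in> NC n" for x
    using that by (auto simp: NC_def abs_le_def)
  have "id \<in> NC n" "cox n \<in> NC n"
    using c by (auto simp: NC_def abs_le_def abs_less_def)
  have idm: "id \<in> set ws"
    using \<open>id \<in> NC n\<close> by (rule insert) (use NC_ge sub in blast)
  have cm: "cox n \<in> set ws"
    using \<open>cox n \<in> NC n\<close> by (rule insert) (use NC_le sub in blast)
  have ne: "ws \<noteq> []" using idm by auto
  have first: "ws ! 0 = id"
  proof -
    obtain k where k: "k < length ws" "ws ! k = id" using idm by (auto simp: in_set_conv_nth)
    have "k = 0"
    proof (rule ccontr)
      assume "k \<noteq> 0"
      then have "abs_less n (ws ! 0) id" using sorted[of 0 k] k by simp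
      then show False using abs_less_len_T[OF n, of "ws ! 0" id] by simp
    qed
    then show ?thesis using k by simp
  qed
  have last: "ws ! (length ws - 1) = cox n"
  proof -
    obtain k where k: "k < length ws" "ws ! k = cox n" using cm by (auto simp: in_set_conv_nth)
    have "k = length ws - 1"
    proof (rule ccontr)
      assume "k \<noteq> length ws - 1"
      then have "abs_less n (cox n) (ws ! (length ws - 1))" using sorted[of k "length ws - 1"] k by simp
      then have *: "n < len_T n (ws ! (length ws - 1))" using abs_less_len_T[OF n, of "cox n" "ws ! (length ws - 1)"] c by simp
      have "ws ! (length ws - 1) \<in> NC n" using sub ne by auto
      from NC_le[OF this] show False using abs_less_len_T[OF n, of "ws ! (length ws - 1)" "cox n"] * c by auto
    qed
    then show ?thesis using k by simp
  qed
  have step: "len_T n (ws ! Suc k) = len_T n (ws ! k) + 1" if k: "Suc k < length ws" for k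
  proof (rule ccontr)
    assume ne1: "len_T n (ws ! Suc k) \<noteq> len_T n (ws ! k) + 1"
    have less: "abs_less n (ws ! k) (ws ! Suc k)" using sorted k by simp
    then have "len_T n (ws ! k) + 1 < len_T n (ws ! Suc k)" using abs_less_len_T[OF n less] ne1 by simp
    then obtain r where r: "abs_less n (ws ! k) r" "abs_less n r (ws ! Suc k)"
      using abs_less_refine[OF n less] by blast
    have below: "abs_less n x r" if "x = ws ! m" "m \<le> k" for x m
      using sorted[of m k] that k r(1) abs_less_trans[OF n, of x "ws ! k" r] by (cases "m = k") auto
    have above: "abs_less n r x" if "x = ws ! m" "Suc k \<le> m" "m < length ws" for x m
      using sorted[of "Suc k" m] that k r(2) abs_less_trans[OF n, of r "ws ! Suc k" x] by (cases "m = Suc k") auto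
    have cmp: "abs_less n x r \<or> abs_less n r x" if "x \<in> set ws" for x
    proof -
      obtain m where "m < length ws" "x = ws ! m" using \<open>x \<in> set ws\<close> by (auto simp: in_set_conv_nth)
      then show ?thesis using below[of x m] above[of x m] by (cases "m \<le> k") auto
    qed
    have "ws ! Suc k \<in> NC n" using sub k by auto
    then have "r = cox n \<or> abs_less n r (cox n)"
      using NC_le[of "ws ! Suc k"] r(2) abs_less_trans[OF n r(2)] by auto
    moreover have rB: "r \<in> B_group n" using r abs_less_B by blast
    moreover have "abs_le n id r" using rB by (simp add: abs_le_def abs_less_def inv_id)
    ultimately have "r \<in> NC n" by (auto simp: NC_def abs_le_def)
    then have "r \<in> set ws" by (rule insert) (use cmp in blast)
    then have "abs_less n r r" using cmp by blast
    then show False by (simp add: abs_less_def)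
  qed
  have len: "len_T n (ws ! k) = k" if "k < length ws" for k
    using that by (induction k) (auto simp: first step)
  have l: "length ws = Suc n"
    using len[of "length ws - 1"] last c ne by (cases ws) auto
  have "\<exists>t\<in>reflections n. ws ! Suc i = ws ! i \<circ> t" if "i < n" for i
    using abs_less_step[OF n sorted[of i "Suc i"]] step[of i] that l by simp
  then show ?thesis using first last l by (simp add: factor_chain_def)
qed

lemma bruhat_less_len_S: "bruhat_less n v w \<Longrightarrow> len_S n v < len_S n w"
  unfolding bruhat_less_def
proof (induction rule: tranclp_induct)
  case (step y z)
  then have "len_S n y < len_S n z" by (metis bruhat_step_def)
  then show ?case using step.IH by simp
qed (metis bruhat_step_def)

lemma reflection_len_S_neq:
  assumes "1 \<le> n" "w \<in> B_group n" "t \<in> reflections n"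
  shows "len_S n (w \<circ> t) \<noteq> len_S n w"
proof -
  obtain u v where "t = signed_swap u v" "u \<in> pm_set n" "v \<in> pm_set n" "u < v"
    using assms(3) by (rule reflectionE)
  then show ?thesis using len_S_swap_iff(2)[OF assms(1,2)] by simp
qed

text \<open>
Two elements that differ by a reflection are comparable in Bruhat order, in the direction of their lengths.
\<close>
lemma bruhat_less_reflection:
  assumes "1 \<le> n" "w \<in> B_group n" "t \<in> reflections n"
  shows "bruhat_less n w (w \<circ> t) \<longleftrightarrow> len_S n w < len_S n (w \<circ> t)"
proof
  assume "len_S n w < len_S n (w \<circ> t)"
  then have "bruhat_step n w (w \<circ> t)" using assms by (auto simp: bruhat_step_def)
  then show "bruhat_less n w (w \<circ> t)" by (simp add: bruhat_less_def)
qed (rule bruhat_less_len_S)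

lemma factor_chain_edges:
  assumes n: "1 \<le> n" and c: "len_T n (cox n) = n" and ch: "factor_chain n ws" and i: "i < n"
  shows "bad_edge n (ws ! i) (ws ! Suc i) \<longleftrightarrow> len_S n (ws ! Suc i) < len_S n (ws ! i)"
    and "good_edge n (ws ! i) (ws ! Suc i) \<longleftrightarrow> \<not> len_S n (ws ! Suc i) < len_S n (ws ! i)"
proof -
  note facts = factor_chain_facts[OF n c ch]
  obtain t where t: "t \<in> reflections n" "ws ! Suc i = ws ! i \<circ> t"
    using ch i by (auto simp: factor_chain_def)
  have B: "ws ! i \<in> B_group n" "ws ! Suc i \<in> B_group n" using facts(1) i by auto
  have ret: "ws ! i = ws ! Suc i \<circ> t" unfolding t(2) comp_assoc reflection_comp_self[OF t(1)] by simp
  have less: "abs_less n (ws ! i) (ws ! Suc i)" using facts(3) i by simp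
  have "\<nexists>r. abs_less n (ws ! i) r \<and> abs_less n r (ws ! Suc i)"
  proof
    assume "\<exists>r. abs_less n (ws ! i) r \<and> abs_less n r (ws ! Suc i)"
    then obtain r where "abs_less n (ws ! i) r" "abs_less n r (ws ! Suc i)" by blast
    then show False
      using abs_less_len_T[OF n, of "ws ! i" r] abs_less_len_T[OF n, of r "ws ! Suc i"] facts(2)[of i] facts(2)[of "Suc i"] i
      by simp
  qed
  then have edge: "edge n (ws ! i) (ws ! Suc i)"
    using less facts(4) i by (simp add: edge_def abs_covers_def)
  have bl: "bruhat_less n (ws ! i) (ws ! Suc i) \<longleftrightarrow> len_S n (ws ! i) < len_S n (ws ! Suc i)"
    using bruhat_less_reflection[OF n B(1) t(1)] unfolding t(2)[symmetric] .
  have bg: "bruhat_less n (ws ! Suc i) (ws ! i) \<longleftrightarrow> len_S n (ws ! Suc i) < len_S n (ws ! i)"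
    using bruhat_less_reflection[OF n B(2) t(1)] unfolding ret[symmetric] .
  have neq: "len_S n (ws ! Suc i) \<noteq> len_S n (ws ! i)"
    unfolding t(2) by (rule reflection_len_S_neq[OF n B(1) t(1)])
  show "bad_edge n (ws ! i) (ws ! Suc i) \<longleftrightarrow> len_S n (ws ! Suc i) < len_S n (ws ! i)"
    using edge bg by (simp add: bad_edge_def)
  show "good_edge n (ws ! i) (ws ! Suc i) \<longleftrightarrow> \<not> len_S n (ws ! Suc i) < len_S n (ws ! i)"
    using edge bl neq by (auto simp: good_edge_def)
qed

section \<open>A lower bound for reflection length\<close>

text \<open>
The size of this group is \<open>3\<close> to the number of pairs of opposite cycles of \<open>w\<close> that are not self-opposite; it plays the role of
the fixed space of \<open>w\<close>.  As 2 is invertible modulo 3, odd invariant functions vanish on self-opposite cycles.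
\<close>
definition odd_fix :: "nat \<Rightarrow> (int \<Rightarrow> int) \<Rightarrow> (int \<Rightarrow> 3) set" where
  "odd_fix n w = {f. (\<forall>x. f (- x) = - f x) \<and> (\<forall>x. x \<notin> pm_set n \<longrightarrow> f x = 0) \<and> (\<forall>x. f (w x) = f x)}"

lemma double_eq_0_mod3: "(d :: 3) + d = 0 \<Longrightarrow> d = 0"
proof -
  assume "d + d = 0"
  moreover have "d + d + d = 0"
  proof -
    have "d + d + d = 3 * d" by (simp add: algebra_simps)
    also have "(3 :: 3) = 0" by simp
    finally show ?thesis by simp
  qed
  ultimately show ?thesis by simp
qed

lemma finite_odd_fix [simp]: "finite (odd_fix n w)"
proof (rule finite_subset)
  show "odd_fix n w \<subseteq> {f. \<forall>x. (x \<in> pm_set n \<longrightarrow> f x \<in> UNIV) \<and> (x \<notin> pm_set n \<longrightarrow> f x = 0)}"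
    by (auto simp: odd_fix_def)
qed (rule finite_set_of_finite_funs; simp)

lemma odd_swap_invariant:
  fixes f :: "int \<Rightarrow> 3"
  assumes "\<And>x. f (- x) = - f x" "f u = f v"
  shows "f (signed_swap u v x) = f x"
  using assms by (simp add: signed_swap_def)

lemma odd_fix_swap:
  assumes "f \<in> odd_fix n w" "f u = f v"
  shows "f \<in> odd_fix n (w \<circ> signed_swap u v)"
  using assms odd_swap_invariant[of f u v] by (simp add: odd_fix_def)

text \<open>
The functions that take the same value at \<open>u\<close> and \<open>v\<close> form a subgroup of index at most 3, and they are also invariant under the product with the reflection.
\<close>
lemma card_odd_fix_swap: "card (odd_fix n w) \<le> 3 * card (odd_fix n (w \<circ> signed_swap u v))"
proof -
  let ?K = "{f \<in> odd_fix n w. f u = f v}"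
  let ?E = "\<lambda>d. {f \<in> odd_fix n w. f u - f v = d}"
  have E: "card (?E d) \<le> card ?K" for d
  proof (cases "?E d = {}")
    case False
    then obtain g where g: "g \<in> odd_fix n w" "g u - g v = d" by auto
    show ?thesis
    proof (rule card_inj_on_le)
      \<comment> \<open>The fibres of \<open>f u - f v\<close> are cosets, so they embed into the subgroup.\<close>
      show "inj_on (\<lambda>f x. f x - g x) (?E d)" by (auto simp: inj_on_def fun_eq_iff)
      show "(\<lambda>f x. f x - g x) ` ?E d \<subseteq> ?K" using g by (auto simp: odd_fix_def algebra_simps)
    qed simp
  next
    case True
    then show ?thesis by (metis card.empty le0)
  qed
  have "odd_fix n w = (\<Union>d\<in>UNIV. ?E d)" by auto
  then have "card (odd_fix n w) \<le> (\<Sum>d\<in>(UNIV :: 3 set). card (?E d))"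
    using card_UN_le[of "UNIV :: 3 set" ?E] by simp
  also have "\<dots> \<le> (\<Sum>d\<in>(UNIV :: 3 set). card ?K)" by (rule sum_mono) (rule E)
  also have "\<dots> = 3 * card ?K" by simp
  also have "card ?K \<le> card (odd_fix n (w \<circ> signed_swap u v))"
    by (rule card_mono) (auto intro: odd_fix_swap)
  finally show ?thesis by simp
qed

lemma card_odd_fix_id: "3 ^ n \<le> card (odd_fix n id)"
proof -
  let ?P = "PiE {1..int n} (\<lambda>_. UNIV :: 3 set)"
  let ?h = "\<lambda>g x. if x \<in> {1..int n} then g x else if - x \<in> {1..int n} then - g (- x) else (0 :: 3)"
  have "card ?P = 3 ^ n" by (simp add: card_PiE)
  moreover have "card ?P \<le> card (odd_fix n id)"
  proof (rule card_inj_on_le)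
    show "inj_on ?h ?P"
    proof (rule inj_onI)
      fix g g' assume gg: "g \<in> ?P" "g' \<in> ?P" "?h g = ?h g'"
      show "g = g'"
      proof (rule PiE_ext[OF gg(1,2)])
        fix x assume "x \<in> {1..int n}"
        then show "g x = g' x" using fun_cong[OF gg(3), of x] by simp
      qed
    qed
    show "?h ` ?P \<subseteq> odd_fix n id"
    proof
      fix f assume "f \<in> ?h ` ?P"
      then obtain g where f: "f = ?h g" by blast
      have "f (- x) = - f x" for x unfolding f by auto
      moreover have "f x = 0" if "x \<notin> pm_set n" for x using that unfolding f by (auto simp: pm_set_def)
      ultimately show "f \<in> odd_fix n id" by (simp add: odd_fix_def)
    qed
  qed simp
  ultimately show ?thesis by simp
qed

text \<open>
Multiplying by a reflection shrinks the group of invariant functions at most by the factor 3, and for the identity there are \<open>3 ^ n\<close> of them.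
\<close>
lemma card_odd_fix_word:
  assumes "set xs \<subseteq> reflections n"
  shows "3 ^ n \<le> card (odd_fix n (word_prod xs)) * 3 ^ length xs"
  using assms
proof (induction xs rule: rev_induct)
  case Nil
  show ?case unfolding word_prod_Nil list.size power_0 mult_1_right by (rule card_odd_fix_id)
next
  case (snoc t xs)
  then obtain u v where t: "t = signed_swap u v" by (auto elim: reflectionE)
  have "3 ^ n \<le> card (odd_fix n (word_prod xs)) * 3 ^ length xs" using snoc by simp
  also have "\<dots> \<le> (3 * card (odd_fix n (word_prod xs \<circ> t))) * 3 ^ length xs"
    unfolding t using card_odd_fix_swap by (rule mult_right_mono) simp
  also have "\<dots> = card (odd_fix n (word_prod (xs @ [t]))) * 3 ^ length (xs @ [t])"
    unfolding word_prod_append word_prod_Cons word_prod_Nil comp_id by simp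
  finally show ?case .
qed

text \<open>
If \<open>u\<close> lies on the cycle \<open>X\<close> and \<open>v\<close> does not, then multiplication by the reflection creates no new invariant functions:
summing the invariance over \<open>X\<close>, all terms cancel except for those at \<open>u\<close> and possibly \<open>- v\<close>, each of which contributes \<open>f v - f u\<close>.
\<close>
lemma odd_fix_merge:
  assumes w: "w \<in> B_group n" and X: "finite X" "w ` X = X" "\<And>x. x \<in> X \<Longrightarrow> - x \<notin> X" "0 \<notin> X"
    and u: "u \<in> X" and v: "v \<notin> X" "v \<noteq> 0"
  shows "odd_fix n (w \<circ> signed_swap u v) \<subseteq> odd_fix n w"
proof
  fix f assume f: "f \<in> odd_fix n (w \<circ> signed_swap u v)"
  let ?t = "signed_swap u v"
  have u0: "u \<noteq> 0" using X u by auto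
  have odd: "f (- x) = - f x" for x using f by (simp add: odd_fix_def)
  have wf: "f (w x) = f (?t x)" for x
  proof -
    have "f (w (?t (?t x))) = f (?t x)" using f by (simp add: odd_fix_def)
    then show ?thesis using signed_swap_involutive[OF u0 v(2)] by simp
  qed
  have inj: "inj_on w X" using B_inj[OF w] by (auto simp: inj_on_def)
  have "(\<Sum>x\<in>X. f (?t x)) = (\<Sum>x\<in>X. f (w x))" using wf by simp
  also have "\<dots> = (\<Sum>x\<in>X. f x)" using sum.reindex[OF inj, of f] X(2) by simp
  finally have "(\<Sum>x\<in>X. f (?t x) - f x) = 0" by (simp add: sum_subtractf)
  \<comment> \<open>The points \<open>v\<close> and \<open>- u\<close> do not lie in \<open>X\<close>.\<close>
  moreover have "(\<Sum>x\<in>X. f (?t x) - f x) = (\<Sum>x\<in>{u, - v} \<inter> X. f (?t x) - f x)"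
  proof (rule sum.mono_neutral_right)
    show "\<forall>x\<in>X - {u, - v} \<inter> X. f (?t x) - f x = 0"
    proof
      fix x assume x: "x \<in> X - {u, - v} \<inter> X"
      then have "x \<noteq> u" "x \<noteq> - v" "x \<noteq> v" "x \<noteq> - u" using X(3) u v by auto
      then show "f (?t x) - f x = 0" by (simp add: signed_swap_def)
    qed
  qed (use X in auto)
  moreover have "f (?t u) - f u = f v - f u" by (simp add: signed_swap_def)
  moreover have "f (?t (- v)) - f (- v) = f v - f u" if "- v \<in> X" "- v \<noteq> u"
    using that v X(3)[of "- v"] odd by (auto simp: signed_swap_def)
  ultimately have "f v - f u = 0 \<or> (f v - f u) + (f v - f u) = 0"
    using u by (cases "- v \<in> X \<and> - v \<noteq> u") (auto simp: Int_insert_left)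
  then have "f v - f u = 0" using double_eq_0_mod3 by blast
  then have "f u = f v" by simp
  then have "f (w x) = f x" for x using wf odd_swap_invariant[of f u v] odd by simp
  then show "f \<in> odd_fix n w" using f by (simp add: odd_fix_def)
qed

section \<open>Signed permutations given by cycle lists\<close>

text \<open>
\<open>walk w xs e\<close>: the map \<open>w\<close> sends each entry of \<open>xs\<close> to the next one and the last entry to \<open>e\<close>.  The list is a cycle
if \<open>e\<close> is its head, and one half of a self-opposite cycle if \<open>e\<close> is the negative of its head.
\<close>
fun walk :: "('a \<Rightarrow> 'a) \<Rightarrow> 'a list \<Rightarrow> 'a \<Rightarrow> bool" where
  "walk w [] e \<longleftrightarrow> True"
| "walk w (a # xs) e \<longleftrightarrow> w a = hd (xs @ [e]) \<and> walk w xs e"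

lemma walk_append: "walk w (xs @ ys) e \<longleftrightarrow> walk w xs (hd (ys @ [e])) \<and> walk w ys e"
  by (induction xs) (auto simp: hd_append)

lemma walk_cong: "(\<And>a. a \<in> set xs \<Longrightarrow> v a = w a) \<Longrightarrow> walk v xs e \<longleftrightarrow> walk w xs e"
  by (induction xs) auto

lemma walk_snoc: "walk w (xs @ [a]) e \<longleftrightarrow> walk w xs a \<and> w a = e"
  by (simp add: walk_append)

lemma walk_nth: "walk w xs e \<Longrightarrow> i < length xs \<Longrightarrow> w (xs ! i) = (xs @ [e]) ! Suc i"
  by (induction xs arbitrary: i) (auto simp: nth_Cons hd_conv_nth split: nat.splits)

lemma walk_uminus:
  fixes w :: "int \<Rightarrow> int"
  assumes "\<And>x. w (- x) = - w x"
  shows "walk w (map uminus xs) (- e) \<longleftrightarrow> walk w xs e"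
proof (induction xs)
  case (Cons a xs)
  have "hd (map uminus xs @ [- e]) = - hd (xs @ [e])" by (cases xs) auto
  then show ?case using Cons assms by simp
qed simp

lemma walk_invariant:
  assumes "walk w xs e" "\<And>x. f (w x) = f x" "b \<in> set xs"
  shows "f b = f e"
  using assms(1,3)
proof (induction xs arbitrary: b)
  case (Cons a xs)
  show ?case
  proof (cases "b = a")
    case True
    then have "f b = f (hd (xs @ [e]))" using Cons.prems assms(2)[of a] by simp
    then show ?thesis using Cons by (cases xs) auto
  qed (use Cons in auto)
qed simp

lemma walk_image: "walk w xs e \<Longrightarrow> xs \<noteq> [] \<Longrightarrow> insert (hd xs) (w ` set xs) = insert e (set xs)"
proof (induction xs)
  case (Cons a xs)
  then show ?case by (cases xs) auto
qed simp

text \<open>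
The order \<open>1, \<dots>, n, - 1, \<dots>, - n\<close> in which the Coxeter element runs through the nonzero points.
\<close>
definition cox_less :: "int \<Rightarrow> int \<Rightarrow> bool" where
  "cox_less a b \<longleftrightarrow> (0 < a \<and> (a < b \<or> b < 0)) \<or> (b < a \<and> a < 0)"

text \<open>
The list \<open>z\<close> holds the positive half of the only self-opposite cycle (if it is not empty), and \<open>xss\<close> holds one cycle from each of the
other pairs of opposite cycles.  Every point occurs exactly once up to sign, and each cycle is listed in the order of the Coxeter element.
This order passes to sublists, so it survives splitting.
\<close>
definition cycle_lists :: "nat \<Rightarrow> (int \<Rightarrow> int) \<Rightarrow> int list \<Rightarrow> int list list \<Rightarrow> bool" where
  "cycle_lists n w z xss \<longleftrightarrow> w \<in> B_group n
     \<and> mset (map abs (z @ concat xss)) = mset [1..int n]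
     \<and> sorted_wrt (<) z \<and> (\<forall>a\<in>set z. 0 < a) \<and> (z \<noteq> [] \<longrightarrow> walk w z (- hd z))
     \<and> (\<forall>x\<in>set xss. x \<noteq> [] \<and> sorted_wrt cox_less x \<and> walk w x (hd x))"

lemma cycle_lists_abs:
  assumes "cycle_lists n w z xss"
  shows "distinct (map abs (z @ concat xss))" "set (map abs (z @ concat xss)) = {1..int n}"
proof -
  have m: "mset (map abs (z @ concat xss)) = mset [1..int n]" using assms by (simp add: cycle_lists_def)
  show "distinct (map abs (z @ concat xss))" using mset_eq_imp_distinct_iff[OF m] by simp
  show "set (map abs (z @ concat xss)) = {1..int n}" using mset_eq_setD[OF m] by simp
qed

lemma cycle_lists_pm:
  assumes "cycle_lists n w z xss" "a \<in> set z \<or> (\<exists>x\<in>set xss. a \<in> set x)"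
  shows "a \<in> pm_set n" "a \<noteq> 0"
proof -
  have "a \<in> set (z @ concat xss)" using assms(2) by auto
  then have "\<bar>a\<bar> \<in> {1..int n}" using cycle_lists_abs(2)[OF assms(1)] by (metis image_eqI list.set_map)
  then show "a \<in> pm_set n" "a \<noteq> 0" by (auto simp: mem_pm_set)
qed

lemma cycle_lists_block:
  assumes "cycle_lists n w z xss" "x \<in> set xss"
  shows "distinct (map abs x)" "distinct x" "\<And>a. a \<in> set x \<Longrightarrow> - a \<notin> set x" "w ` set x = set x"
    "x \<noteq> []" "walk w x (hd x)" "sorted_wrt cox_less x"
proof -
  obtain L R where "xss = L @ x # R" using assms(2) by (meson split_list)
  then show d: "distinct (map abs x)" using cycle_lists_abs(1)[OF assms(1)] by simp
  then show "distinct x" by (simp add: distinct_map)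
  show x: "x \<noteq> []" "walk w x (hd x)" "sorted_wrt cox_less x" using assms by (auto simp: cycle_lists_def)
  show "- a \<notin> set x" if "a \<in> set x" for a
  proof
    assume "- a \<in> set x"
    have "inj_on abs (set x)" using d by (simp add: distinct_map)
    from inj_onD[OF this _ \<open>- a \<in> set x\<close> that] have "- a = a" by simp
    then show False using cycle_lists_pm[OF assms(1)] assms(2) that by auto
  qed
  have "hd x \<in> set x" using x by simp
  moreover have "insert (hd x) (w ` set x) = set x" using walk_image[OF x(2,1)] \<open>hd x \<in> set x\<close> by auto
  moreover have "card (w ` set x) = card (set x)"
    using assms(1) by (intro card_image) (auto simp: cycle_lists_def inj_on_def B_inj)
  ultimately show "w ` set x = set x" by (metis card_subset_eq finite_set subset_insertI)
qed

text \<open>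
An invariant odd function is constant along each cycle and vanishes on the self-opposite cycle, so it is determined by
one value for each entry of \<open>xss\<close>.
\<close>
lemma cycle_lists_card_odd_fix:
  assumes "cycle_lists n w z xss"
  shows "card (odd_fix n w) \<le> 3 ^ length xss"
proof -
  let ?h = "\<lambda>f :: int \<Rightarrow> 3. map (\<lambda>x. f (hd x)) xss"
  have "card (odd_fix n w) \<le> card {l :: 3 list. set l \<subseteq> UNIV \<and> length l = length xss}"
  proof (rule card_inj_on_le)
    show "inj_on ?h (odd_fix n w)"
    proof (rule inj_onI)
      fix f g assume f: "f \<in> odd_fix n w" and g: "g \<in> odd_fix n w" and eq: "?h f = ?h g"
      have val: "f (w y) = f y" "g (w y) = g y" "f (- y) = - f y" "g (- y) = - g y" for y
        using f g by (simp_all add: odd_fix_def)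
      have z0: "h a = 0" if a: "a \<in> set z" and h: "\<And>y. h (w y) = h y" "\<And>y. h (- y) = - h y" for h :: "int \<Rightarrow> 3" and a
      proof -
        have wz: "walk w z (- hd z)" using assms a by (auto simp: cycle_lists_def)
        have hz: "h b = - h (hd z)" if "b \<in> set z" for b
          using walk_invariant[OF wz, of h] h that by simp
        have "hd z \<in> set z" using a by (cases z) auto
        from hz[OF this] have "h (hd z) + h (hd z) = 0" by (simp add: eq_neg_iff_add_eq_0)
        then have "h (hd z) = 0" by (rule double_eq_0_mod3)
        then show ?thesis using hz[OF a] by simp
      qed
      have listed: "f a = g a" if a: "a \<in> set (z @ concat xss)" for a
      proof (cases "a \<in> set z")
        case True
        then show ?thesis using z0[of a f] z0[of a g] val by simp
      next
        case False
        then obtain x where x: "x \<in> set xss" "a \<in> set x" using a by auto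
        then have wx: "walk w x (hd x)" by (intro cycle_lists_block(6)[OF assms])
        have "f (hd x) = g (hd x)" using eq x(1) by simp
        then show ?thesis
          using walk_invariant[OF wx, of f a] walk_invariant[OF wx, of g a] val x(2) by simp
      qed
      show "f = g"
      proof
        fix a
        show "f a = g a"
        proof (cases "a \<in> pm_set n")
          case False
          then show ?thesis using f g by (simp add: odd_fix_def)
        next
          case True
          then have "\<bar>a\<bar> \<in> set (map abs (z @ concat xss))"
            unfolding cycle_lists_abs(2)[OF assms] by (auto simp: mem_pm_set)
          then obtain b where b: "b \<in> set (z @ concat xss)" "\<bar>a\<bar> = \<bar>b\<bar>" unfolding set_map by blast
          then have "a = b \<or> a = - b" by (auto simp: abs_eq_iff)
          then show ?thesis using listed[OF b(1)] val by auto
        qed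
      qed
    qed
    show "?h ` odd_fix n w \<subseteq> {l :: 3 list. set l \<subseteq> UNIV \<and> length l = length xss}" by auto
    show "finite {l :: 3 list. set l \<subseteq> UNIV \<and> length l = length xss}"
      by (rule finite_lists_length_eq) (rule finite)
  qed
  also have "\<dots> = card (UNIV :: 3 set) ^ length xss" by (rule card_lists_length_eq) (rule finite)
  finally show ?thesis by simp
qed

lemma swap_away:
  assumes "\<bar>a\<bar> \<noteq> \<bar>u\<bar>" "\<bar>a\<bar> \<noteq> \<bar>v\<bar>"
  shows "(w \<circ> signed_swap u v) a = w a"
  using assms by (auto simp: signed_swap_def)

text \<open>
Exchanging the successors of the last entries of \<open>P\<close> and \<open>Q\<close> cuts \<open>Q\<close> out and closes it up.
\<close>
lemma walk_split:
  fixes w :: "int \<Rightarrow> int"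
  assumes d: "distinct (map abs (P @ Q @ C))" and ne: "P \<noteq> []" "Q \<noteq> []"
    and walk: "walk w (P @ Q @ C) e"
  defines "w' \<equiv> w \<circ> signed_swap (last P) (last Q)"
  shows "walk w' (P @ C) e" "walk w' Q (hd Q)"
proof -
  define A u where "A = butlast P" "u = last P"
  define B v where "B = butlast Q" "v = last Q"
  have P: "P = A @ [u]" and Q: "Q = B @ [v]" using ne by (simp_all add: A_u_def B_v_def)
  have w': "w' = w \<circ> signed_swap u v" by (simp add: w'_def A_u_def B_v_def)
  have away: "w' a = w a" if a: "a \<in> set A \<union> set B \<union> set C" for a
  proof -
    have "\<bar>u\<bar> \<notin> abs ` (set A \<union> set B \<union> set C)" "\<bar>v\<bar> \<notin> abs ` (set A \<union> set B \<union> set C)"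
      using d unfolding P Q by auto
    then have "\<bar>a\<bar> \<noteq> \<bar>u\<bar>" "\<bar>a\<bar> \<noteq> \<bar>v\<bar>" using imageI[OF a, of abs] by metis+
    then show ?thesis unfolding w' by (rule swap_away)
  qed
  have W: "walk w A u" "w u = hd Q" "walk w B v" "w v = hd (C @ [e])" "walk w C e"
    using walk by (auto simp: P Q walk_append hd_append split: if_splits)
  have "walk w' A u" "walk w' B v" "walk w' C e"
    using W away walk_cong[of A w' w] walk_cong[of B w' w] walk_cong[of C w' w] by auto
  moreover have "w' u = w v" "w' v = w u" by (auto simp: w' signed_swap_def)
  ultimately show "walk w' (P @ C) e" "walk w' Q (hd Q)"
    using W by (simp_all add: P Q walk_append)
qed

text \<open>
Here the piece that is cut out of the self-opposite cycle reaches across the sign change: it consists of the end \<open>C\<close> of the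
positive half and the beginning \<open>P\<close> of the negative half.
\<close>
lemma walk_split_neg:
  fixes w :: "int \<Rightarrow> int"
  assumes d: "distinct (map abs (P @ Q @ C))" and ne: "P \<noteq> []" "0 \<notin> set (P @ Q @ C)"
    and odd: "\<And>x. w (- x) = - w x"
    and walk: "walk w (P @ Q @ C) (- hd P)"
  defines "w' \<equiv> w \<circ> signed_swap (last (P @ Q)) (- last P)"
  shows "Q \<noteq> [] \<Longrightarrow> walk w' Q (- hd Q)" "walk w' (C @ map uminus P) (hd (C @ map uminus P))"
proof -
  define A u where "A = butlast P" "u = last P"
  define v where "v = last (P @ Q)"
  have P: "P = A @ [u]" using ne by (simp add: A_u_def)
  have w': "w' = w \<circ> signed_swap v (- u)" by (simp add: w'_def A_u_def v_def)
  have nz: "u \<noteq> 0" "v \<noteq> 0" using ne by (auto simp: P v_def) (metis last_in_set)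
  have odd': "w' (- x) = - w' x" for x
    unfolding w' using nz odd by (auto simp: signed_swap_def)
  have v: "v = (if Q = [] then u else last Q)" by (simp add: v_def P)
  have away: "w' a = w a" if "a \<in> set A \<union> set (butlast Q) \<union> set C" for a
    unfolding w'
  proof (rule swap_away)
    have "\<bar>u\<bar> \<notin> abs ` (set A \<union> set Q \<union> set C)" using d unfolding P by auto
    moreover have "a \<in> set A \<union> set Q \<union> set C" using that in_set_butlastD by fast
    ultimately have "\<bar>a\<bar> \<noteq> \<bar>u\<bar>" by (metis imageI)
    then show "\<bar>a\<bar> \<noteq> \<bar>- u\<bar>" by simp
    show "\<bar>a\<bar> \<noteq> \<bar>v\<bar>"
    proof (cases "Q = []")
      case True
      then show ?thesis using \<open>\<bar>a\<bar> \<noteq> \<bar>u\<bar>\<close> v by simp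
    next
      case False
      then have "distinct (map abs (A @ [u] @ (butlast Q @ [v]) @ C))" using d by (simp add: P v)
      then have "\<bar>v\<bar> \<notin> abs ` (set A \<union> set (butlast Q) \<union> set C)" by auto
      then show ?thesis using imageI[OF that, of abs] by metis
    qed
  qed
  have W: "walk w A u" "w u = hd (Q @ C @ [- hd P])" "walk w Q (hd (C @ [- hd P]))" "walk w C (- hd P)"
    using walk by (auto simp: P walk_append)
  have hdC: "hd (C @ [- hd P]) = hd (C @ map uminus P)" using ne by (cases C; cases P) auto
  have wv: "w v = hd (C @ map uminus P)"
  proof (cases "Q = []")
    case True
    then show ?thesis using W(2) v hdC by simp
  next
    case False
    then have "Q = butlast Q @ [v]" using v by simp
    then show ?thesis using W(3) hdC by (metis walk_snoc)
  qed
  have w'v: "w' v = - w u" and w'u: "w' (- u) = w v" using odd by (auto simp: w' signed_swap_def)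
  show "walk w' Q (- hd Q)" if "Q \<noteq> []"
  proof -
    have Q: "Q = butlast Q @ [v]" using v that by simp
    then have "walk w (butlast Q) v" using W(3) by (metis walk_snoc)
    then have "walk w' (butlast Q) v" using away walk_cong[of "butlast Q" w' w] by auto
    moreover have "w' v = - hd Q" using w'v W(2) that by simp
    ultimately have "walk w' (butlast Q @ [v]) (- hd Q)" by (simp add: walk_snoc)
    then show ?thesis using Q by metis
  qed
  have "walk w' A u" using W(1) away walk_cong[of A w' w] by auto
  then have "walk w' (map uminus A) (- u)" using walk_uminus[of w' A u, OF odd'] by blast
  then have "walk w' (map uminus P) (hd (C @ map uminus P))"
    using w'u wv by (simp add: P walk_snoc)
  moreover have "walk w' C (- hd P)" using W(4) away walk_cong[of C w' w] by auto
  moreover have "hd (map uminus P @ [hd (C @ map uminus P)]) = - hd P" using ne by (cases P) auto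
  ultimately show "walk w' (C @ map uminus P) (hd (C @ map uminus P))"
    by (simp add: walk_append)
qed

section \<open>Splitting a cycle by a reflection\<close>

lemma cycle_lists_split_block:
  assumes c: "cycle_lists n w z (L @ (P @ Q @ C) # R)" and ne: "P \<noteq> []" "Q \<noteq> []"
  shows "cycle_lists n (w \<circ> signed_swap (last P) (last Q)) z (Q # (P @ C) # L @ R)"
proof -
  let ?w = "w \<circ> signed_swap (last P) (last Q)"
  let ?x = "P @ Q @ C"
  have x: "?x \<in> set (L @ ?x # R)" by simp
  note bl = cycle_lists_block[OF c x]
  have pm: "last P \<in> pm_set n" "last Q \<in> pm_set n"
    using ne by (auto intro!: cycle_lists_pm(1)[OF c])
  have dist: "distinct (map abs (z @ concat (L @ ?x # R)))" using cycle_lists_abs(1)[OF c] .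
  have away: "?w a = w a" if a: "a \<in> set z \<or> a \<in> set (concat (L @ R))" for a
  proof -
    have "mset (map abs (z @ concat (L @ ?x # R))) = mset (map abs ((z @ concat (L @ R)) @ ?x))" by simp
    then have "distinct (map abs ((z @ concat (L @ R)) @ ?x))"
      using dist mset_eq_imp_distinct_iff by blast
    then have "abs ` (set z \<union> set (concat (L @ R))) \<inter> abs ` set ?x = {}"
      unfolding map_append[of _ "z @ concat (L @ R)"] distinct_append by (metis set_append set_map)
    moreover have "last P \<in> set ?x" "last Q \<in> set ?x" using ne by simp_all
    moreover have "\<bar>a\<bar> \<in> abs ` (set z \<union> set (concat (L @ R)))" using a by blast
    ultimately have "\<bar>a\<bar> \<noteq> \<bar>last P\<bar>" "\<bar>a\<bar> \<noteq> \<bar>last Q\<bar>" by (metis disjoint_iff imageI)+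
    then show ?thesis by (rule swap_away)
  qed
  have wB: "?w \<in> B_group n" using c pm by (intro B_comp signed_swap_B) (simp_all add: cycle_lists_def)
  have walks: "walk ?w (P @ C) (hd (P @ C))" "walk ?w Q (hd Q)"
    using walk_split[of P Q C w "hd ?x"] bl ne by simp_all
  have others: "walk ?w y (hd y)" if y: "y \<in> set (L @ R)" for y
  proof -
    have "walk w y (hd y)" using c y by (auto simp: cycle_lists_def)
    then show ?thesis using walk_cong[of y ?w w] away y by auto
  qed
  have zwalk: "walk ?w z (- hd z)" if "z \<noteq> []"
    using c that walk_cong[of z ?w w] away by (auto simp: cycle_lists_def)
  have "sorted_wrt cox_less (P @ C)" "sorted_wrt cox_less Q"
    using bl(7) by (auto simp: sorted_wrt_append)
  moreover have "mset (map abs (z @ concat (Q # (P @ C) # L @ R))) = mset [1..int n]"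
    using c by (simp add: cycle_lists_def ac_simps)
  moreover have "y \<noteq> [] \<and> sorted_wrt cox_less y" if "y \<in> set (L @ R)" for y
    using c that by (auto simp: cycle_lists_def)
  moreover have "sorted_wrt (<) z \<and> (\<forall>a\<in>set z. 0 < a)" using c by (simp add: cycle_lists_def)
  ultimately show ?thesis
    using wB walks others zwalk ne unfolding cycle_lists_def by (auto simp del: comp_apply)
qed

lemma cycle_lists_away:
  assumes c: "cycle_lists n w z xss" and uv: "u \<in> set z" "\<bar>v\<bar> \<in> abs ` set z" and y: "y \<in> set xss" "a \<in> set y"
  shows "(w \<circ> signed_swap u v) a = w a"
proof -
  have dist: "distinct (map abs (z @ concat xss))" using cycle_lists_abs(1)[OF c] .
  have "\<bar>u\<bar> \<in> abs ` set z" using uv by simp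
  moreover have "abs ` set z \<inter> abs ` set (concat xss) = {}" using dist by simp
  moreover have "\<bar>a\<bar> \<in> abs ` set (concat xss)" using y by auto
  ultimately have "\<bar>a\<bar> \<noteq> \<bar>u\<bar>" "\<bar>a\<bar> \<noteq> \<bar>v\<bar>" using uv(2) by (metis disjoint_iff)+
  then show ?thesis by (rule swap_away)
qed

lemma cycle_lists_zero_distinct:
  assumes c: "cycle_lists n w z xss"
  shows "distinct (map abs z)"
  using cycle_lists_abs(1)[OF c] unfolding map_append[of abs z] distinct_append by blast

lemma cycle_lists_split_zero:
  assumes c: "cycle_lists n w (P @ Q @ C) xss" and ne: "P \<noteq> []" "Q \<noteq> []"
  shows "cycle_lists n (w \<circ> signed_swap (last P) (last Q)) (P @ C) (Q # xss)"
proof -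
  let ?w = "w \<circ> signed_swap (last P) (last Q)"
  let ?z = "P @ Q @ C"
  have mem: "last P \<in> set ?z" "last Q \<in> set ?z" using ne by auto
  have pm: "last P \<in> pm_set n" "last Q \<in> pm_set n"
    using mem by (auto intro!: cycle_lists_pm(1)[OF c])
  have wB: "?w \<in> B_group n" using c pm by (intro B_comp signed_swap_B) (simp_all add: cycle_lists_def)
  have d: "distinct (map abs ?z)" by (rule cycle_lists_zero_distinct[OF c])
  have "walk w ?z (- hd P)" using c ne by (simp add: cycle_lists_def)
  then have walks: "walk ?w (P @ C) (- hd P)" "walk ?w Q (hd Q)"
    by (rule walk_split[OF d ne])+
  have others: "walk ?w y (hd y)" if y: "y \<in> set xss" for y
  proof -
    have "walk w y (hd y)" using c y by (auto simp: cycle_lists_def)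
    moreover have "?w a = w a" if "a \<in> set y" for a
      using cycle_lists_away[OF c mem(1) _ y that] mem(2) by (metis imageI)
    ultimately show ?thesis using walk_cong[of y ?w w] by blast
  qed
  have pos: "\<forall>a\<in>set ?z. 0 < a" and sorted: "sorted_wrt (<) ?z" using c by (simp_all add: cycle_lists_def)
  have "sorted_wrt cox_less Q"
  proof (rule sorted_wrt_mono_rel[of Q "(<)"])
    show "cox_less a b" if "a \<in> set Q" "b \<in> set Q" "a < b" for a b
      using that pos by (simp add: cox_less_def)
    show "sorted_wrt (<) Q" using sorted by (simp add: sorted_wrt_append)
  qed
  moreover have "sorted_wrt (<) (P @ C)" using sorted by (auto simp: sorted_wrt_append)
  moreover have "mset (map abs ((P @ C) @ concat (Q # xss))) = mset [1..int n]"
    using c by (simp add: cycle_lists_def ac_simps)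
  moreover have "y \<noteq> [] \<and> sorted_wrt cox_less y" if "y \<in> set xss" for y
    using c that by (auto simp: cycle_lists_def)
  ultimately show ?thesis
    using wB walks others pos ne unfolding cycle_lists_def by (auto simp del: comp_apply)
qed

lemma cycle_lists_split_zero_neg:
  assumes c: "cycle_lists n w (P @ Q @ C) xss" and ne: "P \<noteq> []"
  shows "cycle_lists n (w \<circ> signed_swap (last (P @ Q)) (- last P)) Q ((C @ map uminus P) # xss)"
proof -
  let ?w = "w \<circ> signed_swap (last (P @ Q)) (- last P)"
  let ?z = "P @ Q @ C"
  have mem: "last P \<in> set ?z" "last (P @ Q) \<in> set ?z"
    using ne last_in_set[of "P @ Q"] by auto
  have pm: "- last P \<in> pm_set n" "last (P @ Q) \<in> pm_set n"
    using mem by (auto intro!: cycle_lists_pm(1)[OF c] simp del: last_append)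
  have wB: "?w \<in> B_group n"
    using c pm by (intro B_comp signed_swap_B) (simp_all add: cycle_lists_def)
  have pos: "\<forall>a\<in>set ?z. 0 < a" and sorted: "sorted_wrt (<) ?z" using c by (simp_all add: cycle_lists_def)
  have d: "distinct (map abs ?z)" by (rule cycle_lists_zero_distinct[OF c])
  have walk: "walk w ?z (- hd P)" using c ne by (auto simp: cycle_lists_def)
  have z0: "0 \<notin> set ?z" using pos by auto
  have odd: "w (- x) = - w x" for x using c B_odd by (auto simp: cycle_lists_def)
  have walks: "Q \<noteq> [] \<Longrightarrow> walk ?w Q (- hd Q)" "walk ?w (C @ map uminus P) (hd (C @ map uminus P))"
    using walk_split_neg[OF d ne z0 odd walk] by blast+
  have others: "walk ?w y (hd y)" if y: "y \<in> set xss" for y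
  proof -
    have "walk w y (hd y)" using c y by (auto simp: cycle_lists_def)
    moreover have "\<bar>- last P\<bar> \<in> abs ` set ?z" using mem(1) by (metis abs_minus_cancel imageI)
    then have "?w a = w a" if "a \<in> set y" for a
      using cycle_lists_away[OF c mem(2) _ y that] by blast
    ultimately show ?thesis using walk_cong[of y ?w w] by blast
  qed
  have "sorted_wrt cox_less C"
  proof (rule sorted_wrt_mono_rel[of C "(<)"])
    show "cox_less a b" if "a \<in> set C" "b \<in> set C" "a < b" for a b
      using that pos by (simp add: cox_less_def)
    show "sorted_wrt (<) C" using sorted by (simp add: sorted_wrt_append)
  qed
  moreover have "sorted_wrt cox_less (map uminus P)"
  proof -
    have "sorted_wrt (\<lambda>a b. cox_less (- a) (- b)) P"
    proof (rule sorted_wrt_mono_rel[of P "(<)"])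
      show "cox_less (- a) (- b)" if "a \<in> set P" "b \<in> set P" "a < b" for a b
        using that pos by (simp add: cox_less_def)
      show "sorted_wrt (<) P" using sorted by (simp add: sorted_wrt_append)
    qed
    then show ?thesis by (simp add: sorted_wrt_map)
  qed
  ultimately have block: "sorted_wrt cox_less (C @ map uminus P)"
    using pos by (auto simp: sorted_wrt_append cox_less_def)
  have "image_mset (abs \<circ> uminus) (mset P) = image_mset abs (mset P)"
    by (rule image_mset_cong) simp
  then have m: "mset (map abs (Q @ concat ((C @ map uminus P) # xss))) = mset [1..int n]"
    using c by (simp add: cycle_lists_def ac_simps)
  have zero: "sorted_wrt (<) Q" "\<forall>a\<in>set Q. 0 < a"
    using sorted pos by (auto simp: sorted_wrt_append)
  have "y \<noteq> [] \<and> sorted_wrt cox_less y \<and> walk ?w y (hd y)" if "y \<in> set ((C @ map uminus P) # xss)" for y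
  proof (cases "y = C @ map uminus P")
    case True
    then show ?thesis using block walks(2) ne by simp
  next
    case False
    then have "y \<in> set xss" using that by simp
    then show ?thesis using others c by (simp add: cycle_lists_def)
  qed
  then show ?thesis
    unfolding cycle_lists_def using wB m zero walks(1) by blast
qed

lemma list_split_at:
  assumes "i < j" "j < length x"
  obtains P Q C where "x = P @ Q @ C" "P \<noteq> []" "Q \<noteq> []" "last P = x ! i" "last Q = x ! j"
    "length P = Suc i" "length Q = j - i"
proof
  let ?P = "take (Suc i) x" and ?Q = "take (j - i) (drop (Suc i) x)" and ?C = "drop (Suc j) x"
  have "j - i + Suc i = Suc j" using assms by simp
  then have "drop (Suc i) x = ?Q @ ?C"
    using append_take_drop_id[of "j - i" "drop (Suc i) x"] by (simp only: drop_drop)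
  then show "x = ?P @ ?Q @ ?C" by (metis append_take_drop_id)
  show "?P \<noteq> []" "?Q \<noteq> []" "length ?P = Suc i" "length ?Q = j - i" using assms by auto
  show "last ?P = x ! i" using assms by (simp add: take_Suc_conv_app_nth)
  show "last ?Q = x ! j" using assms by (subst last_conv_nth) auto
qed

text \<open>
The reflections that split the cycle \<open>x\<close>, each listed once; applied to the positive half \<open>z\<close> of the self-opposite cycle, those that
cut out a piece inside \<open>z\<close>.
\<close>
definition block_pairs :: "int list \<Rightarrow> (int \<times> int) set" where
  "block_pairs x = (\<lambda>(i, j). (x ! i, x ! j)) ` {(i, j). i < j \<and> j < length x}"

text \<open>
The remaining reflections that split the self-opposite cycle: they cut out a piece that contains the sign change.
\<close>
definition neg_pairs :: "int list \<Rightarrow> (int \<times> int) set" where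
  "neg_pairs z = (\<lambda>(i, j). (z ! i, - z ! j)) ` {(i, j). j \<le> i \<and> i < length z}"

definition split_pairs :: "int list \<Rightarrow> int list list \<Rightarrow> (int \<times> int) set" where
  "split_pairs z xss = block_pairs z \<union> neg_pairs z \<union> (\<Union>x\<in>set xss. block_pairs x)"

lemma block_pairs_mem: "(u, v) \<in> block_pairs x \<Longrightarrow> u \<in> set x \<and> v \<in> set x"
  by (auto simp: block_pairs_def)

lemma neg_pairs_mem: "(u, v) \<in> neg_pairs z \<Longrightarrow> u \<in> set z \<and> - v \<in> set z"
  by (auto simp: neg_pairs_def)

lemma block_pairs_total:
  assumes "u \<in> set x" "v \<in> set x" "u \<noteq> v"
  shows "(u, v) \<in> block_pairs x \<or> (v, u) \<in> block_pairs x"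
proof -
  obtain i j where "i < length x" "x ! i = u" "j < length x" "x ! j = v"
    using assms by (metis in_set_conv_nth)
  moreover from this have "i < j \<or> j < i" using assms by (metis linorder_neqE_nat)
  ultimately show ?thesis unfolding block_pairs_def by force
qed

lemma neg_pairs_total:
  assumes "u \<in> set z" "- v \<in> set z"
  shows "(u, v) \<in> neg_pairs z \<or> (- v, - u) \<in> neg_pairs z"
proof -
  obtain i j where ij: "i < length z" "z ! i = u" "j < length z" "z ! j = - v"
    using assms by (metis in_set_conv_nth)
  consider "j \<le> i" | "i \<le> j" by linarith
  then show ?thesis
  proof cases
    case 1
    then have "(z ! i, - z ! j) \<in> neg_pairs z" using ij unfolding neg_pairs_def by force
    then show ?thesis using ij by simp
  next
    case 2
    then have "(z ! j, - z ! i) \<in> neg_pairs z" using ij unfolding neg_pairs_def by force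
    then show ?thesis using ij by simp
  qed
qed

lemma block_pairs_antisym:
  assumes "distinct x" "(u, v) \<in> block_pairs x" "(v, u) \<in> block_pairs x"
  shows False
proof -
  obtain i j where ij: "i < j" "j < length x" "u = x ! i" "v = x ! j"
    using assms(2) by (auto simp: block_pairs_def)
  obtain k l where kl: "k < l" "l < length x" "v = x ! k" "u = x ! l"
    using assms(3) by (auto simp: block_pairs_def)
  have "i = l" "j = k" using nth_eq_iff_index_eq[OF assms(1)] ij kl by (metis order.strict_trans)+
  then show False using ij kl by simp
qed

lemma neg_pairs_antisym:
  assumes "distinct z" "(u, v) \<in> neg_pairs z" "(- v, - u) \<in> neg_pairs z"
  shows "- v = u"
proof -
  obtain i j where ij: "j \<le> i" "i < length z" "u = z ! i" "v = - z ! j"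
    using assms(2) by (auto simp: neg_pairs_def)
  obtain k l where kl: "l \<le> k" "k < length z" "- v = z ! k" "- u = - z ! l"
    using assms(3) by (auto simp: neg_pairs_def)
  have "i = l" "j = k" using nth_eq_iff_index_eq[OF assms(1)] ij kl
    by (metis neg_equal_iff_equal minus_minus order.strict_trans1)+
  then show ?thesis using ij kl by simp
qed

text \<open>
A reflection determines its two points up to order and common sign.
\<close>
lemma signed_swap_eq_cases:
  assumes "signed_swap u v = signed_swap u' v'" "u' \<noteq> v'"
  shows "(u', v') \<in> {(u, v), (v, u), (- u, - v), (- v, - u)}"
proof -
  have "signed_swap u v u' = v'" unfolding assms(1) by (simp add: signed_swap_def)
  then show ?thesis using assms(2) by (auto simp: signed_swap_def split: if_splits)
qed

lemma cycle_lists_disjoint: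
  assumes c: "cycle_lists n w z xss"
  shows "\<And>a x. a \<in> set z \<Longrightarrow> x \<in> set xss \<Longrightarrow> a \<notin> set x \<and> - a \<notin> set x"
    and "\<And>a x y. x \<in> set xss \<Longrightarrow> y \<in> set xss \<Longrightarrow> a \<in> set x \<Longrightarrow> a \<in> set y \<Longrightarrow> x = y"
    and "\<And>a. a \<in> set (z @ concat xss) \<Longrightarrow> - a \<notin> set (z @ concat xss)"
    and "distinct z" and "distinct xss"
proof -
  have d: "distinct (map abs (z @ concat xss))" using cycle_lists_abs(1)[OF c] .
  then have inj: "inj_on abs (set (z @ concat xss))" and dd: "distinct (z @ concat xss)"
    by (simp_all only: distinct_map)
  show neg: "- a \<notin> set (z @ concat xss)" if a: "a \<in> set (z @ concat xss)" for a
  proof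
    assume "- a \<in> set (z @ concat xss)"
    from inj_onD[OF inj _ this a] have "a = 0" by simp
    moreover have "a \<noteq> 0" using cycle_lists_pm(2)[OF c, of a] a by auto
    ultimately show False by simp
  qed
  show "a \<notin> set x \<and> - a \<notin> set x" if "a \<in> set z" "x \<in> set xss" for a x
    using neg[of a] dd that by auto
  show "distinct z" using dd by simp
  have ne: "\<And>x. x \<in> set xss \<Longrightarrow> x \<noteq> []" using c by (auto simp: cycle_lists_def)
  have "distinct (concat xss)" using dd by simp
  then show "distinct xss" using ne by (metis distinct_concat_iff removeAll_id)
  show "x = y" if "x \<in> set xss" "y \<in> set xss" "a \<in> set x" "a \<in> set y" for a x y
    using \<open>distinct (concat xss)\<close> that by (auto simp: distinct_concat_iff)
qed

text \<open>
Each of the other names of a reflection is excluded: a reversed pair contradicts the order of the positions, and a pair with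
reversed signs contradicts that every point is listed with one sign only.
\<close>
lemma inj_on_split_pairs:
  assumes c: "cycle_lists n w z xss"
  shows "inj_on (\<lambda>(u, v). signed_swap u v) (split_pairs z xss)"
proof -
  note disj = cycle_lists_disjoint[OF c]
  let ?A = "set (z @ concat xss)"
  have blk: "\<exists>y\<in>insert z (set xss). (u, v) \<in> block_pairs y" if "(u, v) \<in> split_pairs z xss" "(u, v) \<notin> neg_pairs z" for u v
    using that by (auto simp: split_pairs_def)
  have blkA: "u \<in> ?A \<and> v \<in> ?A" if "(u, v) \<in> block_pairs y" "y \<in> insert z (set xss)" for u v y
    using block_pairs_mem[OF that(1)] that(2) by auto
  have first: "u \<in> ?A" if "(u, v) \<in> split_pairs z xss" for u v
    using blk[OF that] blkA neg_pairs_mem[of u v z] by fastforce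
  have neq: "u \<noteq> v" if p: "(u, v) \<in> split_pairs z xss" for u v
  proof (cases "(u, v) \<in> neg_pairs z")
    case True
    then show ?thesis using neg_pairs_mem[OF True] disj(3)[of u] by auto
  next
    case False
    then obtain y where y: "y \<in> insert z (set xss)" "(u, v) \<in> block_pairs y" using blk p by blast
    then have "distinct y" using disj(4) cycle_lists_block(2)[OF c] by blast
    then show ?thesis using block_pairs_antisym[of y u v] y by auto
  qed
  have key: "(u', v') = (u, v)"
    if p: "(u, v) \<in> split_pairs z xss" and p': "(u', v') \<in> split_pairs z xss"
      and eq: "signed_swap u v = signed_swap u' v'" for u v u' v'
  proof -
    have A: "u \<in> ?A" "u' \<in> ?A" using first p p' by blast+
    consider "(u', v') = (u, v)" | "u' = v" "v' = u" | "u' = - u" | "u' = - v" "v' = - u"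
      using signed_swap_eq_cases[OF eq neq[OF p']] by blast
    then show ?thesis
    proof cases
      case 2
      have "(u, v) \<notin> neg_pairs z" using neg_pairs_mem[of u v z] disj(3)[of v] A 2 by auto
      then obtain y where y: "y \<in> insert z (set xss)" "(u, v) \<in> block_pairs y" using blk p by blast
      have "(v, u) \<notin> neg_pairs z" using neg_pairs_mem[of v u z] disj(3)[of u] A by auto
      then obtain y' where y': "y' \<in> insert z (set xss)" "(v, u) \<in> block_pairs y'" using blk p' 2 by blast
      have "u \<in> set y" "u \<in> set y'" using block_pairs_mem y y' by blast+
      then have "y = y'" using y y' disj(1,2) by blast
      moreover have "distinct y" using y disj(4) cycle_lists_block(2)[OF c] by blast
      ultimately show ?thesis using block_pairs_antisym y y' by blast
    next
      case 3
      then show ?thesis using disj(3) A by blast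
    next
      case 4
      have n1: "(u, v) \<in> neg_pairs z"
      proof (rule ccontr)
        assume "(u, v) \<notin> neg_pairs z"
        then have "v \<in> ?A" using blk[OF p] blkA by blast
        then show False using disj(3)[of v] A 4 by simp
      qed
      have n2: "(- v, - u) \<in> neg_pairs z"
      proof (rule ccontr)
        assume "(- v, - u) \<notin> neg_pairs z"
        then have "- u \<in> ?A" using blk p' blkA 4 by blast
        then show False using disj(3)[of u] A by simp
      qed
      have "- v = u" by (rule neg_pairs_antisym[OF disj(4) n1 n2])
      then show ?thesis using 4 by auto
    qed simp
  qed
  show ?thesis
    by (rule inj_onI) (use key in auto)
qed

text \<open>
Up to a common change of sign, one of the two points of any other reflection lies on a cycle in \<open>xss\<close> that does not contain the other point,
and \<open>odd_fix_merge\<close> applies.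
\<close>
lemma not_split_odd_fix:
  assumes c: "cycle_lists n w z xss" and t: "t \<in> reflections n"
    and ns: "t \<notin> (\<lambda>(u, v). signed_swap u v) ` split_pairs z xss"
  shows "odd_fix n (w \<circ> t) \<subseteq> odd_fix n w"
proof -
  note disj = cycle_lists_disjoint[OF c]
  let ?A = "set (z @ concat xss)"
  have wB: "w \<in> B_group n" using c by (simp add: cycle_lists_def)
  obtain u0 v0 where uv0: "t = signed_swap u0 v0" "u0 \<in> pm_set n" "v0 \<in> pm_set n" "u0 < v0" "u0 \<noteq> 0" "v0 \<noteq> 0"
    using t by (rule reflectionE)
  have listed: "a \<in> ?A \<or> - a \<in> ?A" if "a \<in> pm_set n" for a
  proof -
    have "\<bar>a\<bar> \<in> set (map abs (z @ concat xss))"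
      unfolding cycle_lists_abs(2)[OF c] using that by (auto simp: mem_pm_set)
    then obtain b where "b \<in> ?A" "\<bar>a\<bar> = \<bar>b\<bar>" unfolding set_map by blast
    then show ?thesis by (auto simp: abs_eq_iff)
  qed
  obtain u v where t: "t = signed_swap u v" and u: "u \<in> ?A" and v: "v \<in> pm_set n" "u \<noteq> v" and nz: "u \<noteq> 0" "v \<noteq> 0"
  proof (cases "u0 \<in> ?A")
    case True
    then show ?thesis using that[of u0 v0] uv0 by simp
  next
    case False
    then have "- u0 \<in> ?A" using listed uv0 by blast
    then show ?thesis using that[of "- u0" "- v0"] uv0 by (simp add: signed_swap_uminus)
  qed
  have sym: "signed_swap u v = signed_swap v u" "signed_swap u v = signed_swap (- v) (- u)"
    using nz signed_swap_commute[of u v] signed_swap_uminus[of v u] by simp_all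
  \<comment> \<open>No name of the reflection is a splitting pair.\<close>
  have ns': "(a, b) \<notin> split_pairs z xss" if "signed_swap u v = signed_swap a b" for a b
    using ns that unfolding t by force
  have merge: "odd_fix n (w \<circ> signed_swap a b) \<subseteq> odd_fix n w"
    if "x \<in> set xss" "a \<in> set x" "b \<notin> set x" "b \<noteq> 0" for x a b
  proof (rule odd_fix_merge[OF wB _ _ _ _ that(2-4)])
    show "w ` set x = set x" "\<And>y. y \<in> set x \<Longrightarrow> - y \<notin> set x"
      using cycle_lists_block[OF c that(1)] by blast+
    show "0 \<notin> set x" using cycle_lists_pm(2)[OF c, of 0] that(1) by blast
  qed simp
  show ?thesis
  proof (cases "u \<in> set z")
    case False
    then obtain x where x: "x \<in> set xss" "u \<in> set x" using u by auto
    have "v \<notin> set x"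
    proof
      assume "v \<in> set x"
      then have "(u, v) \<in> split_pairs z xss \<or> (v, u) \<in> split_pairs z xss"
        using block_pairs_total[OF x(2) _ v(2)] x(1) by (auto simp: split_pairs_def)
      then show False using ns'[OF refl] ns'[OF sym(1)] by blast
    qed
    then show ?thesis unfolding t using merge[OF x] nz by blast
  next
    case True
    have "v \<notin> set z"
    proof
      assume "v \<in> set z"
      then have "(u, v) \<in> split_pairs z xss \<or> (v, u) \<in> split_pairs z xss"
        using block_pairs_total[OF True _ v(2)] by (auto simp: split_pairs_def)
      then show False using ns'[OF refl] ns'[OF sym(1)] by blast
    qed
    moreover have "- v \<notin> set z"
    proof
      assume "- v \<in> set z"
      then have "(u, v) \<in> split_pairs z xss \<or> (- v, - u) \<in> split_pairs z xss"
        using neg_pairs_total[OF True] by (auto simp: split_pairs_def)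
      then show False using ns'[OF refl] ns'[OF sym(2)] by blast
    qed
    ultimately obtain x where x: "x \<in> set xss" "v \<in> set x \<or> - v \<in> set x"
      using listed[OF v(1)] by auto
    from x(2) show ?thesis
    proof
      assume "v \<in> set x"
      then show ?thesis unfolding t sym(1) using merge[OF x(1)] disj(1)[OF True x(1)] nz by blast
    next
      assume "- v \<in> set x"
      then show ?thesis unfolding t sym(2) using merge[OF x(1), of "- v" "- u"] disj(1)[OF True x(1)] nz by simp
    qed
  qed
qed

section \<open>Sums over the cutting positions of a cycle\<close>

lemma sum_diff_reindex: "(\<Sum>i<j. F (j - i)) = (\<Sum>s = 1..j. F s)" for F :: "nat \<Rightarrow> real"
  by (rule sum.reindex_bij_witness[of _ "\<lambda>s. j - s" "\<lambda>i. j - i"]) auto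

lemma sum_pairs:
  "(\<Sum>(i, j)\<in>{(i, j). i < j \<and> j < M}. f i j) = (\<Sum>j<M. \<Sum>i<j. f i j)" for f :: "nat \<Rightarrow> nat \<Rightarrow> real"
proof -
  have "(\<Sum>j<M. \<Sum>i<j. f i j) = (\<Sum>(j, i)\<in>(SIGMA j:{..<M}. {..<j}). f i j)"
    by (rule sum.Sigma) auto
  also have "\<dots> = (\<Sum>(i, j)\<in>{(i, j). i < j \<and> j < M}. f i j)"
    by (rule sum.reindex_bij_witness[of _ "\<lambda>(i, j). (j, i)" "\<lambda>(j, i). (i, j)"]) auto
  finally show ?thesis by simp
qed

lemma sum_neg_pairs:
  "(\<Sum>(i, j)\<in>{(i, j). j \<le> i \<and> i < M}. f i j) = (\<Sum>i<M. \<Sum>j\<le>i. f i j)" for f :: "nat \<Rightarrow> nat \<Rightarrow> real"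
proof -
  have "(\<Sum>i<M. \<Sum>j\<le>i. f i j) = (\<Sum>(i, j)\<in>(SIGMA i:{..<M}. {..i}). f i j)"
    by (rule sum.Sigma) auto
  also have "(SIGMA i:{..<M}. {..i}) = {(i, j). j \<le> i \<and> i < M}" by auto
  finally show ?thesis by simp
qed

lemma sum_over_gaps:
  "(\<Sum>j<M. \<Sum>i<j. F (j - i)) = (\<Sum>s = 1..<M. (real M - real s) * F s)" for F :: "nat \<Rightarrow> real"
proof (induction M)
  case (Suc M)
  have "(\<Sum>s = 1..<Suc M. (real (Suc M) - real s) * F s)
      = (\<Sum>s = 1..<Suc M. (real M - real s) * F s) + (\<Sum>s = 1..<Suc M. F s)"
    by (simp add: sum.distrib[symmetric] algebra_simps del: sum.op_ivl_Suc)
  also have "(\<Sum>s = 1..<Suc M. (real M - real s) * F s) = (\<Sum>s = 1..<M. (real M - real s) * F s)"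
    by (cases M) simp_all
  also have "(\<Sum>s = 1..<Suc M. F s) = (\<Sum>i<M. F (M - i))"
    by (simp add: sum_diff_reindex atLeastLessThanSuc_atLeastAtMost)
  finally show ?case using Suc by simp
qed simp

lemma sum_over_wraps:
  "(\<Sum>i<M. \<Sum>j\<le>i. G (M - i + j)) = (\<Sum>s = 1..M. real s * G s)" for G :: "nat \<Rightarrow> real"
proof -
  have "(\<Sum>i<M. \<Sum>j\<le>i. G (M - i + j)) = (\<Sum>i<M. \<Sum>d\<le>i. G (M - d))"
  proof (rule sum.cong)
    fix i assume i: "i \<in> {..<M}"
    show "(\<Sum>j\<le>i. G (M - i + j)) = (\<Sum>d\<le>i. G (M - d))"
      by (rule sum.reindex_bij_witness[of _ "\<lambda>d. i - d" "\<lambda>j. i - j"]) (use i in auto)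
  qed simp
  also have "(\<Sum>i<K. \<Sum>d\<le>i. H d) = (\<Sum>d<K. (real K - real d) * H d)" for H :: "nat \<Rightarrow> real" and K
    by (induction K) (simp_all add: lessThan_Suc_atMost[symmetric] sum.distrib[symmetric] algebra_simps)
  also have "(\<Sum>d<M. (real M - real d) * G (M - d)) = (\<Sum>s = 1..M. real s * G s)"
    by (rule sum.reindex_bij_witness[of _ "\<lambda>s. M - s" "\<lambda>d. M - d"]) (auto simp: of_nat_diff)
  finally show ?thesis .
qed

text \<open>
There are \<open>M - s\<close> positions for the gap \<open>s\<close> and \<open>s\<close> positions for the complementary gap \<open>M - s\<close>.
\<close>
lemma sum_over_gaps_symmetric:
  fixes F :: "nat \<Rightarrow> real"
  assumes sym: "\<And>s. 1 \<le> s \<Longrightarrow> s < M \<Longrightarrow> F (M - s) = F s"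
  shows "(\<Sum>j<M. \<Sum>i<j. F (j - i)) = real M / 2 * (\<Sum>s = 1..<M. F s)"
proof -
  have "(\<Sum>s = 1..<M. (real M - real s) * F s) = (\<Sum>s = 1..<M. real s * F s)"
    by (rule sum.reindex_bij_witness[of _ "\<lambda>s. M - s" "\<lambda>s. M - s"]) (auto simp: sym of_nat_diff)
  moreover have "(\<Sum>s = 1..<M. (real M - real s) * F s) + (\<Sum>s = 1..<M. real s * F s) = real M * (\<Sum>s = 1..<M. F s)"
    by (simp add: sum.distrib[symmetric] sum_distrib_left algebra_simps)
  ultimately show ?thesis unfolding sum_over_gaps by simp
qed

text \<open>
Describes which cuts of a cycle of length \<open>M\<close>, at the positions \<open>i < j\<close>, are inversions, where \<open>p\<close> is the number of positive entries of the cycle.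
\<close>
definition good_gap :: "nat \<Rightarrow> nat \<Rightarrow> nat \<Rightarrow> nat \<Rightarrow> bool" where
  "good_gap p M i j \<longleftrightarrow> (if Suc j < M then Suc j = p else p = M \<or> p \<le> Suc i)"

text \<open>
The cuts with gap \<open>s\<close> and those with gap \<open>M - s\<close> together contain exactly two good ones.  By symmetry it does not matter to
which of the two gaps they belong, so each gap may be counted once.
\<close>
lemma sum_good_gaps:
  fixes F :: "nat \<Rightarrow> real"
  assumes sym: "\<And>s. 1 \<le> s \<Longrightarrow> s < M \<Longrightarrow> F (M - s) = F s" and "p \<le> M" "1 \<le> M"
  shows "(\<Sum>j<M. \<Sum>i<j. if good_gap p M i j then F (j - i) else 0) = (\<Sum>s = 1..<M. F s)"
proof -
  obtain m where M: "M = Suc m" using assms(3) by (cases M) auto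
  have low: "(\<Sum>j<m. \<Sum>i<j. if good_gap p M i j then F (j - i) else 0)
      = (\<Sum>j<m. if Suc j = p then (\<Sum>s = 1..j. F s) else 0)"
  proof (rule sum.cong)
    fix j assume "j \<in> {..<m}"
    then show "(\<Sum>i<j. if good_gap p M i j then F (j - i) else 0) = (if Suc j = p then (\<Sum>s = 1..j. F s) else 0)"
      by (auto simp: good_gap_def M sum_diff_reindex)
  qed simp
  have top: "(\<Sum>i<m. if good_gap p M i m then F (m - i) else 0)
      = (\<Sum>i<m. if p = M \<or> p \<le> Suc i then F (m - i) else 0)"
    by (simp add: good_gap_def M)
  have all: "(\<Sum>s = 1..<M. F s) = (\<Sum>s = 1..m. F s)"
    by (simp add: M atLeastLessThanSuc_atLeastAtMost)
  consider "p = 0 \<or> p = M" | "1 \<le> p" "p \<le> m" using assms(2) M by linarith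
  then show ?thesis
  proof cases
    case 1
    then have "(\<Sum>j<m. if Suc j = p then (\<Sum>s = 1..j. F s) else 0) = 0" using M by (intro sum.neutral) auto
    moreover have "(\<Sum>i<m. if p = M \<or> p \<le> Suc i then F (m - i) else 0) = (\<Sum>i<m. F (m - i))" using 1 by auto
    moreover have "(\<Sum>j<M. \<Sum>i<j. if good_gap p M i j then F (j - i) else 0)
      = (\<Sum>j<m. \<Sum>i<j. if good_gap p M i j then F (j - i) else 0) + (\<Sum>i<m. if good_gap p M i m then F (m - i) else 0)"
      by (simp add: M)
    ultimately show ?thesis unfolding low top all by (simp add: sum_diff_reindex)
  next
    case 2
    then obtain r where p: "p = Suc r" "r < m" by (cases p) auto
    have "(\<Sum>j<m. if Suc j = p then (\<Sum>s = 1..j. F s) else 0) = (\<Sum>j<m. if j = r then (\<Sum>s = 1..j. F s) else 0)"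
      by (simp add: p)
    also have "\<dots> = (\<Sum>s = 1..r. F s)" using p by (simp add: sum.delta')
    finally have l: "(\<Sum>j<m. if Suc j = p then (\<Sum>s = 1..j. F s) else 0) = (\<Sum>s = 1..r. F s)" .
    have "(\<Sum>i<m. if p = M \<or> p \<le> Suc i then F (m - i) else 0) = (\<Sum>i\<in>{r..<m}. F (m - i))"
    proof (rule sum.mono_neutral_cong_right)
      show "\<forall>i\<in>{..<m} - {r..<m}. (if p = M \<or> p \<le> Suc i then F (m - i) else 0) = 0" using 2 p M by auto
    qed (use p M 2 in auto)
    also have "\<dots> = (\<Sum>s\<in>{Suc r..m}. F s)"
    proof (rule sum.reindex_bij_witness[of _ "\<lambda>s. s - 1" "\<lambda>i. Suc i"])
      fix i assume "i \<in> {r..<m}"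
      then have "F (M - Suc i) = F (Suc i)" by (intro sym) (auto simp: M)
      then show "F (Suc i) = F (m - i)" by (simp add: M)
    qed auto
    finally have t: "(\<Sum>i<m. if p = M \<or> p \<le> Suc i then F (m - i) else 0) = (\<Sum>s\<in>{Suc r..m}. F s)" .
    have "(\<Sum>s = 1..m. F s) = (\<Sum>s = 1..r. F s) + (\<Sum>s = Suc r..m. F s)"
      using p sum.ub_add_nat[of 1 r F "m - r"] by simp
    moreover have "(\<Sum>j<M. \<Sum>i<j. if good_gap p M i j then F (j - i) else 0)
      = (\<Sum>j<m. \<Sum>i<j. if good_gap p M i j then F (j - i) else 0) + (\<Sum>i<m. if good_gap p M i m then F (m - i) else 0)"
      by (simp add: M)
    ultimately show ?thesis unfolding low top all l t by simp
  qed
qed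

lemma block_sum:
  fixes F :: "nat \<Rightarrow> real"
  assumes "\<And>s. 1 \<le> s \<Longrightarrow> s < M \<Longrightarrow> F (M - s) = F s" "p \<le> M" "1 \<le> M"
  shows "(\<Sum>j<M. \<Sum>i<j. if good_gap p M i j \<noteq> b then F (j - i) else 0)
    = (\<Sum>s = 1..<M. (if b then real M - 2 else 2) / 2 * F s)"
proof -
  have good: "(\<Sum>j<M. \<Sum>i<j. if good_gap p M i j then F (j - i) else 0) = (\<Sum>s = 1..<M. F s)"
    by (rule sum_good_gaps[OF _ assms(2,3)]) (rule assms(1))
  have all: "(\<Sum>j<M. \<Sum>i<j. F (j - i)) = real M / 2 * (\<Sum>s = 1..<M. F s)"
    by (rule sum_over_gaps_symmetric) (rule assms(1))
  show ?thesis
  proof (cases b)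
    case False
    then show ?thesis using good by simp
  next
    case True
    have "(\<Sum>j<M. \<Sum>i<j. if good_gap p M i j \<noteq> b then F (j - i) else 0)
        = (\<Sum>j<M. \<Sum>i<j. F (j - i) - (if good_gap p M i j then F (j - i) else 0))"
      using True by (intro sum.cong) auto
    also have "\<dots> = real M / 2 * (\<Sum>s = 1..<M. F s) - (\<Sum>s = 1..<M. F s)"
      unfolding sum_subtractf good all ..
    also have "\<dots> = (real M - 2) / 2 * (\<Sum>s = 1..<M. F s)" by (simp add: field_simps)
    also have "\<dots> = (\<Sum>s = 1..<M. (if b then real M - 2 else 2) / 2 * F s)"
      using True by (simp only: if_True sum_distrib_left)
    finally show ?thesis .
  qed
qed

lemma zero_sum:
  fixes G :: "nat \<Rightarrow> real"
  shows "(\<Sum>j<m. \<Sum>i<j. if (Suc j = m) \<noteq> b then G (j - i) else 0)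
    + (\<Sum>i<m. \<Sum>j\<le>i. if (Suc j = m) \<noteq> b then G (m - i + j) else 0)
    = (\<Sum>s = 1..m. (if b then real m - 1 else 1) * G s)"
proof (cases m)
  case (Suc k)
  let ?S = "\<Sum>s = 1..m. G s"
  have "(\<Sum>j<m. \<Sum>i<j. if Suc j = m then G (j - i) else 0) = (\<Sum>j<m. if j = k then (\<Sum>s = 1..j. G s) else 0)"
    by (intro sum.cong) (auto simp: Suc sum_diff_reindex)
  also have "\<dots> = (\<Sum>s = 1..k. G s)" using Suc by (simp add: sum.delta')
  finally have g1: "(\<Sum>j<m. \<Sum>i<j. if Suc j = m then G (j - i) else 0) = (\<Sum>s = 1..k. G s)" .
  have "(\<Sum>i<m. \<Sum>j\<le>i. if Suc j = m then G (m - i + j) else 0) = (\<Sum>i<m. if i = k then G m else 0)"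
  proof (rule sum.cong)
    fix i assume i: "i \<in> {..<m}"
    have "(\<Sum>j\<le>i. if Suc j = m then G (m - i + j) else 0) = (\<Sum>j\<le>i. if j = k then G (m - i + k) else 0)"
      by (intro sum.cong) (auto simp: Suc)
    also have "\<dots> = (if k \<le> i then G (m - i + k) else 0)" by (simp add: sum.delta')
    also have "\<dots> = (if i = k then G m else 0)" using i Suc by auto
    finally show "(\<Sum>j\<le>i. if Suc j = m then G (m - i + j) else 0) = (if i = k then G m else 0)" .
  qed simp
  also have "\<dots> = G m" using Suc by (simp add: sum.delta')
  finally have g2: "(\<Sum>i<m. \<Sum>j\<le>i. if Suc j = m then G (m - i + j) else 0) = G m" .
  have S: "?S = (\<Sum>s = 1..k. G s) + G m" by (simp add: Suc)
  have total: "(\<Sum>j<m. \<Sum>i<j. G (j - i)) + (\<Sum>i<m. \<Sum>j\<le>i. G (m - i + j)) = real m * ?S"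
  proof -
    have "(\<Sum>s = 1..<m. (real m - real s) * G s) = (\<Sum>s = 1..m. (real m - real s) * G s)"
      by (simp add: Suc atLeastLessThanSuc_atLeastAtMost)
    then show ?thesis unfolding sum_over_gaps sum_over_wraps
      by (simp add: sum.distrib[symmetric] sum_distrib_left algebra_simps)
  qed
  show ?thesis
  proof (cases b)
    case False
    then show ?thesis using g1 g2 S by simp
  next
    case True
    have "(\<Sum>j<m. \<Sum>i<j. if (Suc j = m) \<noteq> b then G (j - i) else 0)
        = (\<Sum>j<m. \<Sum>i<j. G (j - i) - (if Suc j = m then G (j - i) else 0))"
      using True by (intro sum.cong) auto
    moreover have "(\<Sum>i<m. \<Sum>j\<le>i. if (Suc j = m) \<noteq> b then G (m - i + j) else 0)
        = (\<Sum>i<m. \<Sum>j\<le>i. G (m - i + j) - (if Suc j = m then G (m - i + j) else 0))"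
      using True by (intro sum.cong) auto
    moreover have "(\<Sum>s = 1..m. (if b then real m - 1 else 1) * G s) = (real m - 1) * ?S"
      using True by (simp only: if_True sum_distrib_left)
    then have "(\<Sum>s = 1..m. (if b then real m - 1 else 1) * G s) = real m * ?S - ?S"
      by (simp only: left_diff_distrib mult_1)
    ultimately show ?thesis
      unfolding sum_subtractf g1 g2 using total S by linarith
  qed
qed simp

section \<open>Counting downward paths by their bad steps\<close>

text \<open>
The common number of parking functions whose reluctant cars are those in \<open>I\<close> and of maximal chains whose bad edges are those in \<open>I\<close>.
\<close>
definition pattern_number :: "nat \<Rightarrow> nat set \<Rightarrow> nat" where
  "pattern_number n I = (\<Prod>i\<in>{1..n}. if i \<in> I then i - 1 else n - i + 1)"

text \<open>
The number of downward paths from an element whose self-opposite cycle consists of \<open>m\<close> pairs of points and whose other cycles have the lengths in \<open>N\<close>;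
the list prescribes, from the top, which steps are bad.  In the first sum a cycle of length \<open>s\<close> is detached from the self-opposite cycle, in
one good and \<open>m - 1\<close> bad ways.  In the second one a cycle of length \<open>M\<close> is cut, in two good and \<open>M - 2\<close> bad ways; the sum meets every pair of
lengths twice, whence the division by 2.
\<close>
primrec split_count :: "nat \<Rightarrow> nat multiset \<Rightarrow> bool list \<Rightarrow> real" where
  "split_count m N [] = (if m = 0 \<and> (\<forall>x\<in>#N. x = 1) then 1 else 0)"
| "split_count m N (b # R) =
     (\<Sum>s = 1..m. (if b then real m - 1 else 1) * split_count (m - s) (add_mset s N) R)
   + (\<Sum>M\<in>#N. \<Sum>s = 1..<M. (if b then real M - 2 else 2) / 2
        * split_count m (add_mset (M - s) (add_mset s (N - {#M#}))) R)"

text \<open>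
Counts the ways to reach the identity from \<open>w\<close> by multiplying with one reflection for each entry of the list.
The entry is \<open>True\<close> if the step increases the length, that is, if the corresponding edge, read upwards, is bad.
\<close>
fun path_count :: "nat \<Rightarrow> (int \<Rightarrow> int) \<Rightarrow> bool list \<Rightarrow> nat" where
  "path_count n w [] = (if w = id then 1 else 0)"
| "path_count n w (b # R) =
     (\<Sum>t\<in>{t \<in> reflections n. (len_S n w < len_S n (w \<circ> t)) = b}. path_count n (w \<circ> t) R)"

lemma finite_reflections [simp]: "finite (reflections n)"
proof -
  have "reflections n \<subseteq> (\<lambda>(u, v). signed_swap u v) ` (pm_set n \<times> pm_set n)"
    unfolding reflections_eq by auto
  then show ?thesis by (rule finite_subset) simp
qed

lemma path_count_word:
  assumes "path_count n w R \<noteq> 0"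
  shows "\<exists>xs. set xs \<subseteq> reflections n \<and> length xs = length R \<and> w = word_prod xs"
  using assms
proof (induction R arbitrary: w)
  case Nil
  then have "w = id" by (simp only: path_count.simps split: if_splits)
  then have "w = word_prod []" unfolding word_prod_Nil .
  moreover have "set [] \<subseteq> reflections n" "length [] = length []" by simp_all
  ultimately show ?case by blast
next
  case (Cons b R)
  from Cons.prems have "(\<Sum>t\<in>{t \<in> reflections n. (len_S n w < len_S n (w \<circ> t)) = b}. path_count n (w \<circ> t) R) \<noteq> 0"
    unfolding path_count.simps .
  then have "\<exists>t\<in>{t \<in> reflections n. (len_S n w < len_S n (w \<circ> t)) = b}. path_count n (w \<circ> t) R \<noteq> 0"
    by (rule contrapos_np) (intro sum.neutral, blast)
  then obtain t where t: "t \<in> reflections n" "path_count n (w \<circ> t) R \<noteq> 0" by blast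
  then obtain xs where xs: "set xs \<subseteq> reflections n" "length xs = length R" "w \<circ> t = word_prod xs"
    using Cons.IH by blast
  have "w = w \<circ> t \<circ> t" unfolding comp_assoc reflection_comp_self[OF t(1)] comp_id ..
  also have "\<dots> = word_prod (xs @ [t])" unfolding xs(3) word_prod_append word_prod_Cons word_prod_Nil comp_id ..
  finally have "w = word_prod (xs @ [t])" .
  moreover have "set (xs @ [t]) \<subseteq> reflections n" "length (xs @ [t]) = length (b # R)"
    using xs t by simp_all
  ultimately show ?case by blast
qed

text \<open>
In the order of the Coxeter element, the positive entries come first.
\<close>
lemma cox_sorted_sign_change:
  assumes "sorted_wrt cox_less x" "0 \<notin> set x"
  shows "\<exists>p \<le> length x. \<forall>i < length x. 0 < x ! i \<longleftrightarrow> i < p"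
proof (intro exI conjI allI impI)
  let ?p = "length (takeWhile (\<lambda>a. 0 < a) x)"
  show "?p \<le> length x" by (rule length_takeWhile_le)
  fix i assume i: "i < length x"
  show "0 < x ! i \<longleftrightarrow> i < ?p"
  proof
    assume "i < ?p"
    then show "0 < x ! i" using nth_mem set_takeWhileD takeWhile_nth by metis
  next
    assume pos: "0 < x ! i"
    show "i < ?p"
    proof (rule ccontr)
      assume "\<not> i < ?p"
      then have p: "?p \<le> i" by simp
      then have "\<not> 0 < x ! ?p" using nth_length_takeWhile[of "\<lambda>a. 0 < a" x] i by simp
      moreover have "cox_less (x ! ?p) (x ! i)" if "?p \<noteq> i"
        using assms(1) i p that by (simp add: sorted_wrt_iff_nth_less)
      ultimately show False using pos by (cases "?p = i") (auto simp: cox_less_def)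
    qed
  qed
qed

lemma len_S_swap_status:
  assumes "1 \<le> n" "w \<in> B_group n" "u \<in> pm_set n" "v \<in> pm_set n" "u \<noteq> v"
  shows "\<not> len_S n w < len_S n (w \<circ> signed_swap u v) \<longleftrightarrow> (u < v \<longleftrightarrow> w v < w u)"
  using len_S_swap_iff[OF assms] by linarith

text \<open>
A reflection is an inversion of \<open>w\<close> exactly if its two points and their images under \<open>w\<close> are ordered differently.  Within a cycle
the images are the next entries, so this is a comparison of two pairs of neighbours in a list that first increases through
positive and then decreases through negative numbers.
\<close>
lemma block_good_gap:
  assumes n: "1 \<le> n" and c: "cycle_lists n w z xss" and x: "x \<in> set xss"
  obtains p where "p \<le> length x" "\<And>i j. i < j \<Longrightarrow> j < length x \<Longrightarrow>
    \<not> len_S n w < len_S n (w \<circ> signed_swap (x ! i) (x ! j)) \<longleftrightarrow> good_gap p (length x) i j"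
proof -
  note bl = cycle_lists_block[OF c x]
  have mem: "x ! i \<in> set z \<or> (\<exists>y\<in>set xss. x ! i \<in> set y)" if "i < length x" for i
    using x nth_mem[OF that] by blast
  have pm: "x ! i \<in> pm_set n" if "i < length x" for i
    using cycle_lists_pm(1)[OF c mem[OF that]] .
  have nz: "x ! i \<noteq> 0" if "i < length x" for i
    using cycle_lists_pm(2)[OF c mem[OF that]] .
  have z0: "0 \<notin> set x" using cycle_lists_pm(2)[OF c, of 0] x by blast
  obtain p where p1: "p \<le> length x" "\<forall>i < length x. 0 < x ! i \<longleftrightarrow> i < p"
    using cox_sorted_sign_change[OF bl(7) z0] by blast
  have p: "p \<le> length x" "\<And>i. i < length x \<Longrightarrow> 0 < x ! i \<longleftrightarrow> i < p" using p1 by blast+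
  have less: "x ! i < x ! j \<longleftrightarrow> j < p" if "i < j" "j < length x" for i j
  proof -
    have "cox_less (x ! i) (x ! j)" using bl(7) that by (simp add: sorted_wrt_iff_nth_less)
    then show ?thesis using p(2)[of j] nz[of j] that by (auto simp: cox_less_def)
  qed
  have wx: "w (x ! i) = (x @ [hd x]) ! Suc i" if "i < length x" for i
    using walk_nth[OF bl(6)] that by simp
  have hd: "hd x = x ! 0" using bl(5) by (simp add: hd_conv_nth)
  have wB: "w \<in> B_group n" using c by (simp add: cycle_lists_def)
  show ?thesis
  proof (rule that[OF p(1)])
    fix i j assume ij: "i < j" "j < length x"
    have "x ! i \<noteq> x ! j" using bl(2) ij by (simp add: nth_eq_iff_index_eq)
    then have st: "\<not> len_S n w < len_S n (w \<circ> signed_swap (x ! i) (x ! j))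
      \<longleftrightarrow> (x ! i < x ! j \<longleftrightarrow> w (x ! j) < w (x ! i))"
      using ij by (intro len_S_swap_status[OF n wB] pm) auto
    have wi: "w (x ! i) = x ! Suc i" using wx[of i] ij by (simp add: nth_append)
    show "\<not> len_S n w < len_S n (w \<circ> signed_swap (x ! i) (x ! j)) \<longleftrightarrow> good_gap p (length x) i j"
    proof (cases "Suc j < length x")
      case True
      have "w (x ! j) = x ! Suc j" using wx[of j] True by (simp add: nth_append)
      moreover have "x ! Suc i \<noteq> x ! Suc j" using bl(2) ij True by (simp add: nth_eq_iff_index_eq)
      ultimately have "w (x ! j) < w (x ! i) \<longleftrightarrow> \<not> Suc j < p"
        using less[of "Suc i" "Suc j"] ij True wi by auto
      then show ?thesis unfolding st less[OF ij] good_gap_def using True by auto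
    next
      case False
      then have j: "Suc j = length x" using ij by simp
      have "w (x ! j) = x ! 0" using wx[of j] ij j hd by (simp add: nth_append)
      then have "w (x ! j) < w (x ! i) \<longleftrightarrow> Suc i < p"
        using less[of 0 "Suc i"] ij j wi by simp
      then show ?thesis unfolding st less[OF ij] good_gap_def using j p(1) ij by auto
    qed
  qed
qed

text \<open>
The same comparison as for \<open>block_good_gap\<close>, for the self-opposite cycle: only the cuts at the last entry of \<open>z\<close> are inversions.
\<close>
lemma zero_good:
  assumes n: "1 \<le> n" and c: "cycle_lists n w z xss"
  shows "\<And>i j. i < j \<Longrightarrow> j < length z \<Longrightarrow>
      \<not> len_S n w < len_S n (w \<circ> signed_swap (z ! i) (z ! j)) \<longleftrightarrow> Suc j = length z"
    and "\<And>i j. j \<le> i \<Longrightarrow> i < length z \<Longrightarrow>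
      \<not> len_S n w < len_S n (w \<circ> signed_swap (z ! i) (- z ! j)) \<longleftrightarrow> Suc j = length z"
proof -
  have wB: "w \<in> B_group n" and sorted: "sorted_wrt (<) z" using c by (simp_all add: cycle_lists_def)
  have pos: "0 < z ! i" if "i < length z" for i using c that by (simp add: cycle_lists_def)
  have pm: "z ! i \<in> pm_set n" if "i < length z" for i
    using cycle_lists_pm(1)[OF c, of "z ! i"] that by simp
  have less: "z ! i < z ! j" if "i < j" "j < length z" for i j
    using sorted that by (simp add: sorted_wrt_iff_nth_less)
  have wz: "w (z ! i) = (if Suc i < length z then z ! Suc i else - z ! 0)" if "i < length z" for i
  proof -
    have "z \<noteq> []" using that by auto
    then have "walk w z (- hd z)" using c by (simp add: cycle_lists_def)
    from walk_nth[OF this that] show ?thesis using that \<open>z \<noteq> []\<close> by (auto simp: nth_append hd_conv_nth)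
  qed
  show "\<not> len_S n w < len_S n (w \<circ> signed_swap (z ! i) (z ! j)) \<longleftrightarrow> Suc j = length z"
    if ij: "i < j" "j < length z" for i j
  proof -
    have "z ! i < z ! j" using less ij by simp
    then have "\<not> len_S n w < len_S n (w \<circ> signed_swap (z ! i) (z ! j)) \<longleftrightarrow> w (z ! j) < w (z ! i)"
      using ij len_S_swap_status[OF n wB pm[of i] pm[of j]] by simp
    also have "\<dots> \<longleftrightarrow> Suc j = length z"
    proof -
      have "0 < z ! 0" "0 < z ! Suc i" using ij by (intro pos; linarith)+
      then have "- z ! 0 < z ! Suc i" by linarith
      then show ?thesis using wz[of i] wz[of j] ij less[of "Suc i" "Suc j"] by auto
    qed
    finally show ?thesis .
  qed
  show "\<not> len_S n w < len_S n (w \<circ> signed_swap (z ! i) (- z ! j)) \<longleftrightarrow> Suc j = length z"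
    if ij: "j \<le> i" "i < length z" for i j
  proof -
    have gt: "- z ! j < z ! i" using pos[of i] pos[of j] ij by simp
    then have "\<not> len_S n w < len_S n (w \<circ> signed_swap (z ! i) (- z ! j)) \<longleftrightarrow> \<not> w (- z ! j) < w (z ! i)"
      using ij len_S_swap_status[OF n wB pm[of i], of "- z ! j"] pm[of j] by simp
    also have "w (- z ! j) = - w (z ! j)" by (rule B_odd[OF wB])
    also have "\<not> - w (z ! j) < w (z ! i) \<longleftrightarrow> Suc j = length z"
    proof (cases "Suc i < length z")
      case True
      then have "0 < z ! Suc i" "0 < z ! Suc j" using ij by (intro pos; linarith)+
      then have "- z ! Suc j < z ! Suc i" by linarith
      then show ?thesis using wz[of i] wz[of j] ij True by simp
    next
      case False
      then have i: "Suc i = length z" using ij by simp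
      have z0: "0 < z ! 0" using ij by (intro pos) linarith
      show ?thesis
      proof (cases "j = i")
        case True
        then show ?thesis using wz[of i] i ij z0 by simp
      next
        case False
        then have "z ! 0 < z ! Suc j" using less[of 0 "Suc j"] ij by simp
        then show ?thesis using wz[of i] wz[of j] i ij False by simp
      qed
    qed
    finally show ?thesis .
  qed
qed
lemma cycle_lists_sizes:
  assumes "cycle_lists n w z xss"
  shows "length z + sum_list (map length xss) = n"
proof -
  have "mset (map abs (z @ concat xss)) = mset [1..int n]" using assms by (simp add: cycle_lists_def)
  then have "length (map abs (z @ concat xss)) = length [1..int n]" by (rule mset_eq_length)
  then show ?thesis by (simp add: length_concat)
qed

lemma cycle_lists_all_singleton:
  assumes c: "cycle_lists n w z xss" and l: "length xss = n"
  shows "z = []" "\<And>x. x \<in> set xss \<Longrightarrow> length x = 1" "w = id"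
proof -
  have ne: "x \<noteq> []" if "x \<in> set xss" for x using c that by (simp add: cycle_lists_def)
  have ge: "length ys \<le> sum_list (map length ys)" if "\<And>x. x \<in> set ys \<Longrightarrow> x \<noteq> []" for ys :: "int list list"
    using that
  proof (induction ys)
    case (Cons a ys)
    then have "a \<noteq> []" "length ys \<le> sum_list (map length ys)" by simp_all
    then show ?case by (cases a) simp_all
  qed simp
  have tot: "length z + sum_list (map length xss) = length xss" using cycle_lists_sizes[OF c] l by simp
  moreover have "length xss \<le> sum_list (map length xss)" using ne by (rule ge)
  ultimately have "length z = 0" by linarith
  then show z: "z = []" by simp
  show one: "length x = 1" if x: "x \<in> set xss" for x
  proof -
    obtain L R where LR: "xss = L @ x # R" using x by (meson split_list)
    have "length L \<le> sum_list (map length L)" "length R \<le> sum_list (map length R)"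
      using ne LR by (intro ge; simp)+
    moreover have "1 \<le> length x" using ne[OF x] by (cases x) simp_all
    moreover have "sum_list (map length xss) = sum_list (map length L) + length x + sum_list (map length R)"
      "length xss = length L + 1 + length R" by (simp_all add: LR)
    ultimately show ?thesis using tot by linarith
  qed
  have wB: "w \<in> B_group n" using c by (simp add: cycle_lists_def)
  have fix_listed: "w a = a" if a: "a \<in> set (z @ concat xss)" for a
  proof -
    obtain x where x: "x \<in> set xss" "a \<in> set x" using a z by auto
    have "length x = Suc 0" using one[OF x(1)] by simp
    then obtain y where "x = [y]" unfolding length_Suc_conv by auto
    then have xa: "x = [a]" using x(2) by simp
    have "walk w [a] (hd [a])" using cycle_lists_block(6)[OF c x(1)] unfolding xa .
    then show ?thesis by simp
  qed
  have "w a = id a" for a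
  proof (cases "a \<in> pm_set n")
    case True
    then have "\<bar>a\<bar> \<in> set (map abs (z @ concat xss))"
      unfolding cycle_lists_abs(2)[OF c] by (auto simp: mem_pm_set)
    then obtain b where b: "b \<in> set (z @ concat xss)" "\<bar>a\<bar> = \<bar>b\<bar>" unfolding set_map by blast
    then have "a = b \<or> a = - b" by (auto simp: abs_eq_iff)
    then show ?thesis using fix_listed[OF b(1)] B_odd[OF wB, of b] by auto
  next
    case False
    then show ?thesis using B_permutes[OF wB] by (simp add: permutes_not_in)
  qed
  then show "w = id" by (rule ext)
qed

lemma sum_block_pairs:
  fixes g :: "int \<times> int \<Rightarrow> real"
  assumes "distinct x"
  shows "(\<Sum>p\<in>block_pairs x. g p) = (\<Sum>j<length x. \<Sum>i<j. g (x ! i, x ! j))"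
proof -
  have "inj_on (\<lambda>(i, j). (x ! i, x ! j)) {(i, j). i < j \<and> j < length x}"
    using assms by (auto simp: inj_on_def nth_eq_iff_index_eq)
  then have "(\<Sum>p\<in>block_pairs x. g p) = (\<Sum>p\<in>{(i, j). i < j \<and> j < length x}. g (case p of (i, j) \<Rightarrow> (x ! i, x ! j)))"
    unfolding block_pairs_def by (subst sum.reindex) (simp_all add: comp_def)
  also have "\<dots> = (\<Sum>(i, j)\<in>{(i, j). i < j \<and> j < length x}. g (x ! i, x ! j))"
    by (intro sum.cong) auto
  finally show ?thesis unfolding sum_pairs .
qed

lemma sum_neg_pairs_set:
  fixes g :: "int \<times> int \<Rightarrow> real"
  assumes "distinct z"
  shows "(\<Sum>p\<in>neg_pairs z. g p) = (\<Sum>i<length z. \<Sum>j\<le>i. g (z ! i, - z ! j))"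
proof -
  have "inj_on (\<lambda>(i, j). (z ! i, - z ! j)) {(i, j). j \<le> i \<and> i < length z}"
    using assms by (auto simp: inj_on_def nth_eq_iff_index_eq)
  then have "(\<Sum>p\<in>neg_pairs z. g p) = (\<Sum>p\<in>{(i, j). j \<le> i \<and> i < length z}. g (case p of (i, j) \<Rightarrow> (z ! i, - z ! j)))"
    unfolding neg_pairs_def by (subst sum.reindex) (simp_all add: comp_def)
  also have "\<dots> = (\<Sum>(i, j)\<in>{(i, j). j \<le> i \<and> i < length z}. g (z ! i, - z ! j))"
    by (intro sum.cong) auto
  finally show ?thesis unfolding sum_neg_pairs .
qed

lemma finite_block_pairs [simp]: "finite (block_pairs x)" and finite_neg_pairs [simp]: "finite (neg_pairs x)"
proof -
  have "block_pairs x \<subseteq> set x \<times> set x" using block_pairs_mem by auto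
  then show "finite (block_pairs x)" by (rule finite_subset) simp
  have "neg_pairs x \<subseteq> set x \<times> uminus ` set x"
  proof
    fix p assume "p \<in> neg_pairs x"
    then show "p \<in> set x \<times> uminus ` set x" using neg_pairs_mem[of "fst p" "snd p" x]
      by (cases p) force
  qed
  then show "finite (neg_pairs x)" by (rule finite_subset) simp
qed

lemma sum_split_pairs:
  fixes g :: "int \<times> int \<Rightarrow> real"
  assumes c: "cycle_lists n w z xss"
  shows "(\<Sum>p\<in>split_pairs z xss. g p)
    = (\<Sum>p\<in>block_pairs z. g p) + (\<Sum>p\<in>neg_pairs z. g p) + (\<Sum>x\<in>set xss. \<Sum>p\<in>block_pairs x. g p)"
proof -
  note disj = cycle_lists_disjoint[OF c]
  have 1: "block_pairs z \<inter> neg_pairs z = {}"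
  proof -
    have False if p: "(u, v) \<in> block_pairs z" "(u, v) \<in> neg_pairs z" for u v
      using block_pairs_mem[OF p(1)] neg_pairs_mem[OF p(2)] disj(3)[of v] by simp
    then show ?thesis by auto
  qed
  have 2: "(block_pairs z \<union> neg_pairs z) \<inter> (\<Union>x\<in>set xss. block_pairs x) = {}"
  proof -
    have False if p: "(u, v) \<in> block_pairs z \<or> (u, v) \<in> neg_pairs z" "x \<in> set xss" "(u, v) \<in> block_pairs x" for u v x
    proof -
      have "u \<in> set z" using p(1) block_pairs_mem neg_pairs_mem by blast
      then show False using block_pairs_mem[OF p(3)] disj(1)[of u x] p(2) by blast
    qed
    then show ?thesis by auto
  qed
  have 3: "(\<Sum>p\<in>(\<Union>x\<in>set xss. block_pairs x). g p) = (\<Sum>x\<in>set xss. \<Sum>p\<in>block_pairs x. g p)"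
  proof (rule sum.UNION_disjoint)
    have False if "x \<in> set xss" "y \<in> set xss" "x \<noteq> y" "(u, v) \<in> block_pairs x" "(u, v) \<in> block_pairs y" for x y u v
      using block_pairs_mem[OF that(4)] block_pairs_mem[OF that(5)] disj(2)[OF that(1,2), of u] that(3) by blast
    then show "\<forall>x\<in>set xss. \<forall>y\<in>set xss. x \<noteq> y \<longrightarrow> block_pairs x \<inter> block_pairs y = {}" by auto
  qed simp_all
  show ?thesis unfolding split_pairs_def
    by (simp add: sum.union_disjoint[OF _ _ 2] sum.union_disjoint[OF _ _ 1] 3)
qed

text \<open>
The next reflection has to split a cycle.  Otherwise the invariant functions would not become more numerous, and by
\<open>card_odd_fix_word\<close> the remaining reflections would be too few to reach the identity.  The splitting reflections are summed cycle by cycle.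
\<close>
lemma path_count_eq_split_count:
  assumes n: "1 \<le> n" and "cycle_lists n w z xss" "length xss + length R = n"
  shows "real (path_count n w R) = split_count (length z) (mset (map length xss)) R"
  using assms(2,3)
proof (induction R arbitrary: w z xss)
  case Nil
  then have "length xss = n" by simp
  note triv = cycle_lists_all_singleton[OF Nil.prems(1) this]
  have "real (path_count n w []) = 1"
    unfolding triv(3) path_count.simps if_P[OF refl] of_nat_1 ..
  moreover have "split_count (length z) (mset (map length xss)) [] = 1"
    using triv(1,2) by simp
  ultimately show ?case by (rule trans[OF _ sym])
next
  case (Cons b R)
  note c = Cons.prems(1)
  note disj = cycle_lists_disjoint[OF c]
  define N where "N = mset (map length xss)"
  let ?sw = "\<lambda>(u, v). signed_swap u v"
  define h where "h t = (if (len_S n w < len_S n (w \<circ> t)) = b then real (path_count n (w \<circ> t) R) else 0)" for t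
  have "real (path_count n w (b # R)) = (\<Sum>t\<in>reflections n. h t)"
    unfolding path_count.simps h_def of_nat_sum by (rule sum.inter_filter) simp
  also have "\<dots> = (\<Sum>t\<in>?sw ` split_pairs z xss. h t)"
  proof (rule sum.mono_neutral_right)
    show "?sw ` split_pairs z xss \<subseteq> reflections n"
    proof
      fix t assume "t \<in> ?sw ` split_pairs z xss"
      then obtain u v where t: "t = signed_swap u v" "(u, v) \<in> split_pairs z xss" by auto
      have sub: "set y \<subseteq> set (z @ concat xss)" if "y \<in> insert z (set xss)" for y using that by auto
      have A: "u \<in> set (z @ concat xss) \<and> (v \<in> set (z @ concat xss) \<or> - v \<in> set (z @ concat xss))"
      proof (cases "(u, v) \<in> neg_pairs z")
        case True
        then show ?thesis using neg_pairs_mem[OF True] by simp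
      next
        case False
        then obtain y where y: "y \<in> insert z (set xss)" "(u, v) \<in> block_pairs y"
          using t(2) unfolding split_pairs_def by blast
        then show ?thesis using block_pairs_mem[OF y(2)] sub[OF y(1)] by blast
      qed
      have pm: "a \<in> pm_set n" if "a \<in> set (z @ concat xss)" for a
        using that by (intro cycle_lists_pm(1)[OF c]) auto
      have "v \<in> pm_set n" using A pm[of v] pm[of "- v"] uminus_pm_set[of v n] by blast
      moreover have "u \<noteq> v"
      proof
        assume eq: "u = v"
        then have "(u, u) \<notin> neg_pairs z" using neg_pairs_mem[of u u z] disj(3)[of u] by auto
        then obtain y where y: "y \<in> insert z (set xss)" "(u, u) \<in> block_pairs y"
          using t(2) eq by (auto simp: split_pairs_def)
        then have "distinct y" using disj(4) cycle_lists_block(2)[OF c] by blast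
        then show False using block_pairs_antisym[of y u u] y by blast
      qed
      ultimately show "t \<in> reflections n"
        unfolding t(1) using pm[OF conjunct1[OF A]] by (intro signed_swap_reflection)
    qed
    show "\<forall>t\<in>reflections n - ?sw ` split_pairs z xss. h t = 0"
    proof
      fix t assume t: "t \<in> reflections n - ?sw ` split_pairs z xss"
      have "path_count n (w \<circ> t) R = 0"
      proof (rule ccontr)
        assume "path_count n (w \<circ> t) R \<noteq> 0"
        then obtain xs where xs: "set xs \<subseteq> reflections n" "length xs = length R" "w \<circ> t = word_prod xs"
          using path_count_word by blast
        \<comment> \<open>Too few reflections are left to make the group of invariant functions as large as for the identity.\<close>
        have "(3::nat) ^ n \<le> card (odd_fix n (w \<circ> t)) * 3 ^ length R"
          using card_odd_fix_word[OF xs(1)] xs(2,3) by simp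
        also have "card (odd_fix n (w \<circ> t)) \<le> card (odd_fix n w)"
          using not_split_odd_fix[OF c, of t] t by (intro card_mono) auto
        also have "\<dots> \<le> 3 ^ length xss" by (rule cycle_lists_card_odd_fix[OF c])
        finally have "(3::nat) ^ n \<le> 3 ^ (length xss + length R)" by (simp add: power_add)
        then show False using Cons.prems(2) by (simp add: power_increasing_iff)
      qed
      then show "h t = 0" by (simp add: h_def)
    qed
  qed simp
  also have "\<dots> = (\<Sum>p\<in>split_pairs z xss. h (?sw p))"
    using sum.reindex[OF inj_on_split_pairs[OF c], of h] by (simp add: comp_def)
  also have "\<dots> = (\<Sum>p\<in>block_pairs z. h (?sw p)) + (\<Sum>p\<in>neg_pairs z. h (?sw p))
      + (\<Sum>x\<in>set xss. \<Sum>p\<in>block_pairs x. h (?sw p))"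
    by (rule sum_split_pairs[OF c])
  also have "(\<Sum>p\<in>block_pairs z. h (?sw p)) + (\<Sum>p\<in>neg_pairs z. h (?sw p))
      = (\<Sum>s = 1..length z. (if b then real (length z) - 1 else 1) * split_count (length z - s) (add_mset s N) R)"
  proof -
    let ?m = "length z"
    let ?G = "\<lambda>s. split_count (?m - s) (add_mset s N) R"
    have A: "h (signed_swap (z ! i) (z ! j)) = (if (Suc j = ?m) \<noteq> b then ?G (j - i) else 0)"
      if ij: "i < j" "j < ?m" for i j
    proof -
      obtain P Q C where PQ: "z = P @ Q @ C" "P \<noteq> []" "Q \<noteq> []" "last P = z ! i" "last Q = z ! j"
        "length P = Suc i" "length Q = j - i"
        using list_split_at[OF ij] .
      have cc: "cycle_lists n (w \<circ> signed_swap (last P) (last Q)) (P @ C) (Q # xss)"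
        using cycle_lists_split_zero[OF c[unfolded PQ(1)] PQ(2,3)] .
      have len: "length (Q # xss) + length R = n" using Cons.prems(2) by simp
      have "real (path_count n (w \<circ> signed_swap (z ! i) (z ! j)) R)
          = split_count (length (P @ C)) (mset (map length (Q # xss))) R"
        using Cons.IH[OF cc len] unfolding PQ(4,5) .
      also have "\<dots> = ?G (j - i)"
      proof -
        have "length (P @ C) = ?m - (j - i)" using PQ(7) by (simp add: PQ(1))
        then show ?thesis by (simp add: N_def PQ(7))
      qed
      finally show ?thesis
        using zero_good(1)[OF n c ij] unfolding h_def by auto
    qed
    have B: "h (signed_swap (z ! i) (- z ! j)) = (if (Suc j = ?m) \<noteq> b then ?G (?m - i + j) else 0)"
      if ij: "j \<le> i" "i < ?m" for i j
    proof -
      define P Q C where "P = take (Suc j) z" and "Q = take (i - j) (drop (Suc j) z)" and "C = drop (Suc i) z"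
      have "i - j + Suc j = Suc i" using ij by simp
      then have dr: "drop (Suc j) z = Q @ C"
        using append_take_drop_id[of "i - j" "drop (Suc j) z"] unfolding Q_def C_def by (simp only: drop_drop)
      then have z: "z = P @ Q @ C" unfolding P_def by (metis append_take_drop_id)
      have P: "P \<noteq> []" "last P = z ! j" using ij by (auto simp: P_def take_Suc_conv_app_nth)
      have PQ: "P @ Q = take (Suc i) z"
      proof -
        have "take (Suc j + (i - j)) z = P @ Q" unfolding P_def Q_def by (rule take_add)
        then show ?thesis using ij by simp
      qed
      then have last: "last (P @ Q) = z ! i" using ij by (simp add: take_Suc_conv_app_nth)
      have cc: "cycle_lists n (w \<circ> signed_swap (last (P @ Q)) (- last P)) Q ((C @ map uminus P) # xss)"
        using cycle_lists_split_zero_neg[OF c[unfolded z] P(1)] .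
      have len: "length ((C @ map uminus P) # xss) + length R = n" using Cons.prems(2) by simp
      have "real (path_count n (w \<circ> signed_swap (z ! i) (- z ! j)) R)
          = split_count (length Q) (mset (map length ((C @ map uminus P) # xss))) R"
        using Cons.IH[OF cc len] unfolding last P(2) .
      also have "\<dots> = ?G (?m - i + j)"
      proof -
        have "length Q = i - j" "length C = ?m - Suc i" "length P = Suc j" using ij by (auto simp: Q_def C_def P_def)
        then have "length Q = ?m - (?m - i + j)" "length (C @ map uminus P) = ?m - i + j" using ij by auto
        then show ?thesis by (simp add: N_def)
      qed
      finally show ?thesis
        using zero_good(2)[OF n c ij] unfolding h_def by auto
    qed
    have "(\<Sum>p\<in>block_pairs z. h (?sw p)) = (\<Sum>j<?m. \<Sum>i<j. if (Suc j = ?m) \<noteq> b then ?G (j - i) else 0)"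
      unfolding sum_block_pairs[OF disj(4)] by (intro sum.cong refl) (simp only: A lessThan_iff split_conv)
    moreover have "(\<Sum>p\<in>neg_pairs z. h (?sw p)) = (\<Sum>i<?m. \<Sum>j\<le>i. if (Suc j = ?m) \<noteq> b then ?G (?m - i + j) else 0)"
      unfolding sum_neg_pairs_set[OF disj(4)] by (intro sum.cong refl) (simp only: B lessThan_iff atMost_iff split_conv)
    ultimately show ?thesis using zero_sum[of ?m b ?G] by simp
  qed
  also have "(\<Sum>x\<in>set xss. \<Sum>p\<in>block_pairs x. h (?sw p))
    = (\<Sum>M\<in>#N. \<Sum>s = 1..<M. (if b then real M - 2 else 2) / 2
        * split_count (length z) (add_mset (M - s) (add_mset s (N - {#M#}))) R)"
  proof -
    let ?H = "\<lambda>M. \<Sum>s = 1..<M. (if b then real M - 2 else 2) / 2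
        * split_count (length z) (add_mset (M - s) (add_mset s (N - {#M#}))) R"
    have blk: "(\<Sum>p\<in>block_pairs x. h (?sw p)) = ?H (length x)" if x: "x \<in> set xss" for x
    proof -
      let ?M = "length x"
      let ?F = "\<lambda>s. split_count (length z) (add_mset (?M - s) (add_mset s (N - {#?M#}))) R"
      obtain p where p: "p \<le> ?M" "\<And>i j. i < j \<Longrightarrow> j < ?M \<Longrightarrow>
          \<not> len_S n w < len_S n (w \<circ> signed_swap (x ! i) (x ! j)) \<longleftrightarrow> good_gap p ?M i j"
        using block_good_gap[OF n c x] by blast
      obtain L R' where LR: "xss = L @ x # R'" using x by (meson split_list)
      have A: "h (signed_swap (x ! i) (x ! j)) = (if good_gap p ?M i j \<noteq> b then ?F (j - i) else 0)"
        if ij: "i < j" "j < ?M" for i j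
      proof -
        obtain P Q C where PQ: "x = P @ Q @ C" "P \<noteq> []" "Q \<noteq> []" "last P = x ! i" "last Q = x ! j"
          "length P = Suc i" "length Q = j - i"
          using list_split_at[OF ij] .
        have cc: "cycle_lists n (w \<circ> signed_swap (last P) (last Q)) z (Q # (P @ C) # L @ R')"
          using cycle_lists_split_block[OF c[unfolded LR PQ(1)] PQ(2,3)] .
        have len: "length (Q # (P @ C) # L @ R') + length R = n" using Cons.prems(2) LR by simp
        have "real (path_count n (w \<circ> signed_swap (x ! i) (x ! j)) R)
            = split_count (length z) (mset (map length (Q # (P @ C) # L @ R'))) R"
          using Cons.IH[OF cc len] unfolding PQ(4,5) .
        also have "\<dots> = ?F (j - i)"
        proof -
          have "length (P @ C) = ?M - (j - i)" using PQ(7) by (simp add: PQ(1))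
          then show ?thesis by (simp add: N_def LR PQ(7) add_mset_commute)
        qed
        finally show ?thesis
          using p(2)[OF ij] unfolding h_def by auto
      qed
      have "(\<Sum>p\<in>block_pairs x. h (?sw p)) = (\<Sum>j<?M. \<Sum>i<j. if good_gap p ?M i j \<noteq> b then ?F (j - i) else 0)"
        unfolding sum_block_pairs[OF cycle_lists_block(2)[OF c x]]
        by (intro sum.cong refl) (simp only: A lessThan_iff split_conv)
      also have "\<dots> = ?H ?M"
      proof (rule block_sum[OF _ p(1)])
        show "1 \<le> ?M" using cycle_lists_block(5)[OF c x] by (cases x) auto
        show "?F (?M - s) = ?F s" if "1 \<le> s" "s < ?M" for s
          using that by (simp add: add_mset_commute)
      qed
      finally show ?thesis .
    qed
    have "(\<Sum>M\<in>#N. ?H M) = sum_list (map (\<lambda>x. ?H (length x)) xss)"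
      unfolding N_def mset_map[symmetric] sum_mset_sum_list map_map comp_def ..
    also have "\<dots> = (\<Sum>x\<in>set xss. ?H (length x))"
      by (rule sum_list_distinct_conv_sum_set[OF disj(5)])
    finally show ?thesis using blk by simp
  qed
  finally show ?case by (simp add: N_def)
qed

section \<open>Summing over all lists of cycle sizes\<close>

text \<open>
The possible lists of lengths of \<open>k\<close> cycles, in any order; the rest of the \<open>n\<close> pairs of points belongs to the self-opposite cycle.
\<close>
definition size_lists :: "nat \<Rightarrow> nat \<Rightarrow> nat list set" where
  "size_lists n k = {ms. length ms = k \<and> (\<forall>x\<in>set ms. 1 \<le> x) \<and> sum_list ms \<le> n}"

lemma finite_size_lists [simp]: "finite (size_lists n k)"
proof (rule finite_subset)
  show "size_lists n k \<subseteq> {ms. set ms \<subseteq> {..n} \<and> length ms = k}"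
    by (auto simp: size_lists_def dest: member_le_sum_list)
qed (simp add: finite_lists_length_eq)

text \<open>
Exchanging two entries of the list permutes the summands.
\<close>
lemma sum_size_lists_symmetric:
  fixes g :: "nat multiset \<Rightarrow> real"
  assumes "i < k" "j < k"
  shows "(\<Sum>ms\<in>size_lists n k. real (ms ! i) * g (mset ms)) = (\<Sum>ms\<in>size_lists n k. real (ms ! j) * g (mset ms))"
proof -
  define sw where "sw ms = ms[j := ms ! i, i := ms ! j]" for ms :: "nat list"
  have m: "mset (sw ms) = mset ms" if "length ms = k" for ms
    using assms that unfolding sw_def by (intro mset_swap) auto
  have mem: "sw ms \<in> size_lists n k" if "ms \<in> size_lists n k" for ms
  proof -
    have l: "length ms = k" using that by (simp add: size_lists_def)
    have "set (sw ms) = set ms" "sum_list (sw ms) = sum_list ms"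
      using m[OF l] mset_eq_setD by (blast, metis sum_mset_sum_list)
    then show ?thesis using that by (simp add: size_lists_def sw_def)
  qed
  have len: "length ms = k" if "ms \<in> size_lists n k" for ms
    using that by (simp add: size_lists_def)
  have inv: "sw (sw ms) = ms" if "ms \<in> size_lists n k" for ms
    using len[OF that] assms by (intro nth_equalityI) (simp_all add: sw_def nth_list_update)
  have val: "real (sw ms ! j) * g (mset (sw ms)) = real (ms ! i) * g (mset ms)" if "ms \<in> size_lists n k" for ms
    using m[OF len[OF that]] len[OF that] assms by (simp add: sw_def nth_list_update)
  show ?thesis
    by (rule sum.reindex_bij_witness[of _ sw sw]) (simp_all add: mem inv val)
qed

text \<open>
Detaching a cycle from the self-opposite cycle, read backwards.
\<close>
lemma size_lists_append:
  "(\<Sum>ms\<in>size_lists n k. \<Sum>s = 1..n - sum_list ms. f ms s)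
   = (\<Sum>ms\<in>size_lists n (Suc k). f (butlast ms) (last ms))"
proof -
  have "(\<Sum>ms\<in>size_lists n k. \<Sum>s = 1..n - sum_list ms. f ms s)
      = (\<Sum>(ms, s)\<in>(SIGMA ms:size_lists n k. {1..n - sum_list ms}). f ms s)"
    by (rule sum.Sigma) auto
  also have "\<dots> = (\<Sum>ms\<in>size_lists n (Suc k). f (butlast ms) (last ms))"
  proof (rule sum.reindex_bij_witness[of _ "\<lambda>ms. (butlast ms, last ms)" "\<lambda>(ms, s). ms @ [s]"])
    fix ms assume ms: "ms \<in> size_lists n (Suc k)"
    then have "ms \<noteq> []" by (auto simp: size_lists_def)
    then obtain xs x where "ms = xs @ [x]" by (metis append_butlast_last_id)
    then show "(butlast ms, last ms) \<in> (SIGMA ms:size_lists n k. {1..n - sum_list ms})"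
      "(case (butlast ms, last ms) of (ms, s) \<Rightarrow> ms @ [s]) = ms"
      using ms by (auto simp: size_lists_def)
  qed (auto simp: size_lists_def)
  finally show ?thesis .
qed

lemma sum_list_update_nat:
  "i < length ms \<Longrightarrow> sum_list (ms[i := v]) + ms ! i = sum_list ms + (v :: nat)"
  by (induction ms arbitrary: i) (auto split: nat.splits)

text \<open>
Cutting the \<open>i\<close>-th cycle in two, where the second piece becomes the last entry of the list, read backwards.
\<close>
lemma size_lists_split:
  assumes "i < k"
  shows "(\<Sum>ms\<in>size_lists n k. \<Sum>s = 1..<ms ! i. f (ms ! i) (ms[i := s] @ [ms ! i - s]))
   = (\<Sum>ms\<in>size_lists n (Suc k). f (ms ! i + ms ! k) ms)"
proof -
  let ?A = "SIGMA ms:size_lists n k. {1..<ms ! i}"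
  define to where "to = (\<lambda>(ms, s). ms[i := s] @ [ms ! i - s] :: nat list)"
  define fro where "fro ms = ((butlast ms)[i := ms ! i + ms ! k], ms ! i)" for ms :: "nat list"
  have "(\<Sum>ms\<in>size_lists n k. \<Sum>s = 1..<ms ! i. f (ms ! i) (ms[i := s] @ [ms ! i - s]))
      = (\<Sum>(ms, s)\<in>?A. f (ms ! i) (ms[i := s] @ [ms ! i - s]))"
    by (rule sum.Sigma) auto
  also have "\<dots> = (\<Sum>ms\<in>size_lists n (Suc k). f (ms ! i + ms ! k) ms)"
  proof (rule sum.reindex_bij_witness[of _ fro to])
    fix p assume p: "p \<in> ?A"
    then obtain ms s where ps: "p = (ms, s)" and ms: "length ms = k" "\<forall>x\<in>set ms. 1 \<le> x" "sum_list ms \<le> n"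
      and s: "1 \<le> s" "s < ms ! i" by (auto simp: size_lists_def)
    show "fro (to p) = p"
      using ms s assms by (auto simp: ps to_def fro_def nth_append butlast_append)
    have "set (ms[i := s]) \<subseteq> insert s (set ms)" by (rule set_update_subset_insert)
    moreover have "sum_list (ms[i := s]) + ms ! i = sum_list ms + s"
      using sum_list_update_nat ms assms by blast
    ultimately show "to p \<in> size_lists n (Suc k)"
      using ms s by (auto simp: ps to_def size_lists_def)
    show "f (to p ! i + to p ! k) (to p) = (case p of (ms, s) \<Rightarrow> f (ms ! i) (ms[i := s] @ [ms ! i - s]))"
      using ms s assms by (auto simp: ps to_def nth_append)
  next
    fix ms assume mem: "ms \<in> size_lists n (Suc k)"
    then obtain xs x where ms: "ms = xs @ [x]" and l: "length xs = k"
      and ge: "\<forall>x\<in>set xs. 1 \<le> x" "1 \<le> x" "sum_list xs + x \<le> n"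
      by (auto simp: size_lists_def length_Suc_conv_rev)
    have i: "1 \<le> xs ! i" using ge l assms by simp
    have "set (xs[i := xs ! i + x]) \<subseteq> insert (xs ! i + x) (set xs)" by (rule set_update_subset_insert)
    moreover have "sum_list (xs[i := xs ! i + x]) + xs ! i = sum_list xs + (xs ! i + x)"
      using sum_list_update_nat l assms by blast
    ultimately show "fro ms \<in> ?A"
      using ge i l assms by (auto simp: fro_def size_lists_def ms nth_append)
    show "to (fro ms) = ms"
      using l assms by (auto simp: fro_def to_def ms nth_append)
  qed
  finally show ?thesis .
qed

definition total_count :: "nat \<Rightarrow> nat \<Rightarrow> bool list \<Rightarrow> real" where
  "total_count n k R = (\<Sum>ms\<in>size_lists n k. split_count (n - sum_list ms) (mset ms) R)"

text \<open>
Reversing the splits, the contributions to a list of \<open>k + 1\<close> lengths come from merging its last entry with one of the \<open>k\<close> other entries or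
with the self-opposite cycle.  For a good step the merges have the weights 1, which gives \<open>k + 1\<close> in total.
For a bad step the weights are affine in the lengths.  By symmetry each entry has the same average, and the average of all entries
together with the self-opposite cycle is determined by \<open>n\<close>.
\<close>
lemma total_count_Cons:
  "total_count n k (b # R) = (if b then real n - real k - 1 else real k + 1) * total_count n (Suc k) R"
proof -
  define D where "D ms = split_count (n - sum_list ms) (mset ms) R" for ms
  let ?L = "size_lists n (Suc k)"
  have Dm: "D ms = split_count (n - sum_mset (mset ms)) (mset ms) R" for ms
    by (simp add: D_def sum_mset_sum_list)
  define S where "S = (\<Sum>ms\<in>?L. D ms)"
  define A where "A = (\<Sum>ms\<in>?L. real (ms ! k) * D ms)"
  have S: "total_count n (Suc k) R = S" by (simp add: total_count_def S_def D_def)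
  have A: "(\<Sum>ms\<in>?L. real (ms ! i) * D ms) = A" if "i \<le> k" for i
    unfolding A_def Dm using that by (intro sum_size_lists_symmetric) auto
  \<comment> \<open>All entries of the list have the same weighted sum \<open>A\<close>.\<close>
  have total: "(\<Sum>ms\<in>?L. real (sum_list ms) * D ms) = (real k + 1) * A"
  proof -
    have "(\<Sum>ms\<in>?L. real (sum_list ms) * D ms) = (\<Sum>ms\<in>?L. \<Sum>i\<le>k. real (ms ! i) * D ms)"
    proof (rule sum.cong)
      fix ms assume "ms \<in> ?L"
      then have "sum_list ms = (\<Sum>i\<le>k. ms ! i)"
        by (simp add: size_lists_def sum_list_sum_nth atLeast0LessThan lessThan_Suc_atMost)
      then show "real (sum_list ms) * D ms = (\<Sum>i\<le>k. real (ms ! i) * D ms)"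
        by (simp add: sum_distrib_right)
    qed simp
    also have "\<dots> = (\<Sum>i\<le>k. \<Sum>ms\<in>?L. real (ms ! i) * D ms)" by (rule sum.swap)
    also have "\<dots> = (\<Sum>i\<le>k. A)" using A by simp
    finally show ?thesis by simp
  qed
  define c where "c m = (if b then real m - 1 else 1)" for m :: nat
  define h where "h m = (if b then real m - 2 else 2) / 2" for m :: nat
  have "(\<Sum>ms\<in>size_lists n k. \<Sum>s = 1..n - sum_list ms. c (n - sum_list ms)
        * split_count (n - sum_list ms - s) (add_mset s (mset ms)) R)
     = (\<Sum>ms\<in>?L. c (n - sum_list (butlast ms))
        * split_count (n - sum_list (butlast ms) - last ms) (add_mset (last ms) (mset (butlast ms))) R)"
    by (rule size_lists_append)
  also have "\<dots> = (\<Sum>ms\<in>?L. c (n - sum_list ms + ms ! k) * D ms)"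
  proof (rule sum.cong)
    fix ms assume "ms \<in> ?L"
    then obtain xs x where "ms = xs @ [x]" "length xs = k" "sum_list xs + x \<le> n"
      by (auto simp: size_lists_def length_Suc_conv_rev)
    moreover from this have "n - (sum_list xs + x) + x = n - sum_list xs" by simp
    ultimately show "c (n - sum_list (butlast ms)) * split_count (n - sum_list (butlast ms) - last ms)
        (add_mset (last ms) (mset (butlast ms))) R = c (n - sum_list ms + ms ! k) * D ms"
      by (simp add: D_def diff_diff_left nth_append)
  qed simp
  finally have first: "(\<Sum>ms\<in>size_lists n k. \<Sum>s = 1..n - sum_list ms. c (n - sum_list ms)
        * split_count (n - sum_list ms - s) (add_mset s (mset ms)) R)
     = (\<Sum>ms\<in>?L. c (n - sum_list ms + ms ! k) * D ms)" .
  have "(\<Sum>ms\<in>size_lists n k. \<Sum>M\<in>#mset ms. \<Sum>s = 1..<M. h M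
        * split_count (n - sum_list ms) (add_mset (M - s) (add_mset s (mset ms - {#M#}))) R)
     = (\<Sum>ms\<in>size_lists n k. \<Sum>i<k. \<Sum>s = 1..<ms ! i. h (ms ! i) * D (ms[i := s] @ [ms ! i - s]))"
  proof (rule sum.cong)
    fix ms assume ms: "ms \<in> size_lists n k"
    then have l: "length ms = k" by (simp add: size_lists_def)
    let ?g = "\<lambda>M. \<Sum>s = 1..<M. h M
        * split_count (n - sum_list ms) (add_mset (M - s) (add_mset s (mset ms - {#M#}))) R"
    have "(\<Sum>M\<in>#mset ms. ?g M) = sum_list (map ?g ms)"
      by (simp flip: mset_map sum_mset_sum_list)
    also have "\<dots> = (\<Sum>i<k. ?g (ms ! i))"
      by (simp add: sum_list_sum_nth l atLeast0LessThan)
    also have "\<dots> = (\<Sum>i<k. \<Sum>s = 1..<ms ! i. h (ms ! i) * D (ms[i := s] @ [ms ! i - s]))"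
    proof (intro sum.cong refl)
      fix i s assume i: "i \<in> {..<k}" and s: "s \<in> {1..<ms ! i}"
      have "sum_list (ms[i := s]) + ms ! i = sum_list ms + s"
        using sum_list_update_nat[of i ms s] l i by simp
      then have "sum_list (ms[i := s]) + (ms ! i - s) = sum_list ms" using s by simp
      moreover have "mset (ms[i := s]) = add_mset s (mset ms - {#ms ! i#})"
        using l i by (simp add: mset_update)
      ultimately show "h (ms ! i) * split_count (n - sum_list ms)
          (add_mset (ms ! i - s) (add_mset s (mset ms - {#ms ! i#}))) R
        = h (ms ! i) * D (ms[i := s] @ [ms ! i - s])"
        by (simp add: D_def)
    qed
    finally show "(\<Sum>M\<in>#mset ms. ?g M)
      = (\<Sum>i<k. \<Sum>s = 1..<ms ! i. h (ms ! i) * D (ms[i := s] @ [ms ! i - s]))" .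
  qed simp
  also have "\<dots> = (\<Sum>i<k. \<Sum>ms\<in>size_lists n k. \<Sum>s = 1..<ms ! i. h (ms ! i) * D (ms[i := s] @ [ms ! i - s]))"
    by (rule sum.swap)
  also have "\<dots> = (\<Sum>i<k. \<Sum>ms\<in>?L. h (ms ! i + ms ! k) * D ms)"
    by (intro sum.cong refl size_lists_split) simp
  finally have second: "(\<Sum>ms\<in>size_lists n k. \<Sum>M\<in>#mset ms. \<Sum>s = 1..<M. h M
        * split_count (n - sum_list ms) (add_mset (M - s) (add_mset s (mset ms - {#M#}))) R)
     = (\<Sum>i<k. \<Sum>ms\<in>?L. h (ms ! i + ms ! k) * D ms)" .
  have main: "total_count n k (b # R)
     = (\<Sum>ms\<in>?L. c (n - sum_list ms + ms ! k) * D ms) + (\<Sum>i<k. \<Sum>ms\<in>?L. h (ms ! i + ms ! k) * D ms)"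
    unfolding first[symmetric] second[symmetric]
    by (simp only: total_count_def split_count.simps sum.distrib c_def h_def)
  show ?thesis
  proof (cases b)
    case False
    then have "c m = 1" "h m = 1" for m by (simp_all add: c_def h_def)
    then show ?thesis unfolding main S using False by (simp add: S_def[symmetric] algebra_simps)
  next
    case True
    have "(\<Sum>ms\<in>?L. c (n - sum_list ms + ms ! k) * D ms)
        = (\<Sum>ms\<in>?L. real n * D ms - real (sum_list ms) * D ms + real (ms ! k) * D ms - D ms)"
      using True by (intro sum.cong) (auto simp: c_def size_lists_def of_nat_diff algebra_simps)
    also have "\<dots> = real n * S - (real k + 1) * A + A - S"
      by (simp add: sum.distrib sum_subtractf S_def A_def total sum_distrib_left)
    finally have c: "(\<Sum>ms\<in>?L. c (n - sum_list ms + ms ! k) * D ms) = real n * S - (real k + 1) * A + A - S" .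
    have h: "(\<Sum>ms\<in>?L. h (ms ! i + ms ! k) * D ms) = A - S" if "i < k" for i
    proof -
      have "(\<Sum>ms\<in>?L. h (ms ! i + ms ! k) * D ms)
          = (\<Sum>ms\<in>?L. (real (ms ! i) * D ms + real (ms ! k) * D ms) / 2 - D ms)"
        using True by (intro sum.cong) (auto simp: h_def field_simps)
      also have "\<dots> = (A + A) / 2 - S"
        using A[of i] A[of k] that
        by (simp add: sum_subtractf sum.distrib S_def flip: sum_divide_distrib)
      finally show ?thesis by simp
    qed
    have "(\<Sum>i<k. \<Sum>ms\<in>?L. h (ms ! i + ms ! k) * D ms) = real k * (A - S)"
      by (simp add: h)
    then show ?thesis unfolding main S c using True by (simp add: algebra_simps)
  qed
qed

text \<open>
With \<open>n\<close> cycles, all of them are fixed points.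
\<close>
lemma total_count_Nil: "total_count n n [] = 1"
proof -
  have ge: "length ms \<le> sum_list ms" if "\<forall>x\<in>set ms. 1 \<le> x" for ms :: "nat list"
    using that by (induction ms) auto
  have ones: "ms = replicate (length ms) 1" if "\<forall>x\<in>set ms. 1 \<le> x" "sum_list ms \<le> length ms" for ms :: "nat list"
    using that
  proof (induction ms)
    case (Cons a ms)
    then have "a = 1" using ge[of ms] by auto
    then show ?case using Cons by auto
  qed simp
  have 1: "ms \<in> {replicate n 1}" if "ms \<in> size_lists n n" for ms
    using ones[of ms] that unfolding size_lists_def by simp
  have 2: "replicate n 1 \<in> size_lists n n"
    unfolding size_lists_def by (simp add: sum_list_replicate)
  have "size_lists n n = {replicate n 1}"
  proof (rule antisym)
    show "size_lists n n \<subseteq> {replicate n 1}" using 1 by (rule subsetI)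
    show "{replicate n 1} \<subseteq> size_lists n n" by (rule insert_subsetI[OF 2 empty_subsetI])
  qed
  then show ?thesis by (simp add: total_count_def sum_list_replicate)
qed

lemma split_count_full: "split_count n {#} (map (\<lambda>i. i \<in> I) (rev [1..<Suc n])) = real (pattern_number n I)"
proof -
  have "total_count n (n - m) (map (\<lambda>i. i \<in> I) (rev [1..<Suc m]))
      = real (\<Prod>i\<in>{1..m}. if i \<in> I then i - 1 else n - i + 1)" if "m \<le> n" for m
    using that
  proof (induction m)
    case 0
    have "map (\<lambda>i. i \<in> I) (rev [1..<Suc 0]) = []" by (rule ccontr) force
    moreover have "{1..0::nat} = {}" by (rule atLeastatMost_empty) (rule zero_less_one)
    ultimately show ?case by (simp only: total_count_Nil minus_nat.diff_0 prod.empty of_nat_1)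
  next
    case (Suc m)
    define k where "k = n - Suc m"
    have k: "n - m = Suc k" "n = Suc (k + m)" using Suc.prems by (simp_all add: k_def)
    have ins: "{1..Suc m} = insert (Suc m) {1..m}" by auto
    have IH: "total_count n (Suc k) (map (\<lambda>i. i \<in> I) (rev [1..<Suc m]))
      = real (\<Prod>i\<in>{1..m}. if i \<in> I then i - 1 else n - i + 1)"
      using Suc k by simp
    have "total_count n k (map (\<lambda>i. i \<in> I) (rev [1..<Suc (Suc m)]))
      = real (if Suc m \<in> I then Suc m - 1 else n - Suc m + 1)
        * total_count n (Suc k) (map (\<lambda>i. i \<in> I) (rev [1..<Suc m]))"
      using k(2) by (simp add: total_count_Cons)
    also have "\<dots> = real (\<Prod>i\<in>{1..Suc m}. if i \<in> I then i - 1 else n - i + 1)"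
      unfolding IH ins by simp
    finally show ?case unfolding k_def .
  qed
  from this[of n] have "total_count n 0 (map (\<lambda>i. i \<in> I) (rev [1..<Suc n])) = real (pattern_number n I)"
    unfolding pattern_number_def by simp
  moreover have "size_lists n 0 = {[]}" by (auto simp: size_lists_def)
  ultimately show ?thesis by (simp add: total_count_def)
qed

section \<open>The Coxeter element and its maximal chains\<close>

lemma walk_iff_map: "walk w xs e \<longleftrightarrow> map w xs = tl (xs @ [e])"
proof (induction xs)
  case (Cons a xs)
  have "xs @ [e] = hd (xs @ [e]) # tl (xs @ [e])" by simp
  then show ?case using Cons by (metis append_Cons list.inject list.map(2) list.sel(3) walk.simps(2))
qed simp

text \<open>
On the list \<open>1, \<dots>, n, - 1, \<dots>, - n\<close> the Coxeter element acts as a rotation by one place.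
\<close>
lemma cox_rotates:
  assumes "1 \<le> n"
  shows "map (cox n) [1..int n] = tl ([1..int n] @ [- 1])"
    and "map (cox n) (map uminus [1..int n]) = map uminus (map (cox n) [1..int n])"
proof -
  define l where "l = [1..int n]"
  have l: "l = 1 # [2..int n]" using assms by (simp add: l_def upto_rec1)
  have "distinct (l @ map uminus l)"
    by (auto simp: l_def distinct_map inj_on_def)
  then have "map (cox n) (l @ map uminus l) = rotate1 (l @ map uminus l)"
    using cyclic_rotation[of "l @ map uminus l" 1] by (simp add: cox_def l_def)
  also have "\<dots> = tl (l @ [- 1]) @ (map uminus (tl (l @ [- 1])))"
    by (simp add: l)
  finally have "map (cox n) l @ map (cox n) (map uminus l) = tl (l @ [- 1]) @ map uminus (tl (l @ [- 1]))"
    by simp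
  then have "map (cox n) l = tl (l @ [- 1]) \<and> map (cox n) (map uminus l) = map uminus (tl (l @ [- 1]))"
    by (subst (asm) append_eq_append_conv) (simp_all del: map_map)
  then show "map (cox n) [1..int n] = tl ([1..int n] @ [- 1])"
    and "map (cox n) (map uminus [1..int n]) = map uminus (map (cox n) [1..int n])"
    unfolding l_def by (blast, metis)
qed

lemma cox_B:
  assumes n: "1 \<le> n"
  shows "cox n \<in> B_group n"
proof -
  have "set ([1..int n] @ map uminus [1..int n]) = pm_set n"
    by (auto simp: pm_set_def)
  then have perm: "cox n permutes pm_set n"
    using cycle_permutes[of "[1..int n] @ map uminus [1..int n]"] unfolding cox_def by simp
  have pos: "cox n (- x) = - cox n x" if "x \<in> {1..int n}" for x
  proof -
    have "x \<in> set [1..int n]" using that by simp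
    moreover have "\<forall>y\<in>set [1..int n]. cox n (- y) = - cox n y"
      using cox_rotates(2)[OF n] unfolding map_map by (simp only: map_eq_conv comp_apply)
    ultimately show ?thesis by blast
  qed
  have "cox n (- x) = - cox n x" if "x \<in> pm_set n" for x
  proof (cases "0 < x")
    case True
    then show ?thesis using pos[of x] that by (simp add: mem_pm_set)
  next
    case False
    then show ?thesis using pos[of "- x"] that by (simp add: mem_pm_set)
  qed
  then show ?thesis using perm by (simp add: B_group_def)
qed

lemma cycle_lists_cox:
  assumes n: "1 \<le> n"
  shows "cycle_lists n (cox n) [1..int n] []"
proof -
  have "hd [1..int n] = 1" using n by (simp add: upto_rec1)
  then have "walk (cox n) [1..int n] (- hd [1..int n])"
    unfolding walk_iff_map using cox_rotates(1)[OF n] by simp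
  moreover have "map abs [1..int n] = [1..int n]" by (rule map_idI) simp
  moreover have "sorted_wrt (<) [1..int n]" by (rule sorted_wrt_upto)
  ultimately show ?thesis using cox_B[OF n] by (simp add: cycle_lists_def)
qed

lemma path_count_cox:
  assumes n: "1 \<le> n"
  shows "path_count n (cox n) (map (\<lambda>i. i \<in> I) (rev [1..<Suc n])) = pattern_number n I"
proof -
  have "real (path_count n (cox n) (map (\<lambda>i. i \<in> I) (rev [1..<Suc n])))
      = split_count (length [1..int n]) (mset (map length ([] :: int list list))) (map (\<lambda>i. i \<in> I) (rev [1..<Suc n]))"
    by (rule path_count_eq_split_count[OF n cycle_lists_cox[OF n]]) (simp del: upt_Suc)
  also have "\<dots> = split_count n {#} (map (\<lambda>i. i \<in> I) (rev [1..<Suc n]))" by (simp del: upt_Suc)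
  also have "\<dots> = real (pattern_number n I)" by (rule split_count_full)
  finally show ?thesis by (simp only: of_nat_eq_iff)
qed

text \<open>
A factorization of length \<open>n\<close> exists because the number of those with good edges only is not zero.  A shorter one does not exist, because
the only odd function that is invariant under the Coxeter element is zero.
\<close>
lemma len_T_cox:
  assumes n: "1 \<le> n"
  shows "len_T n (cox n) = n"
proof (rule antisym)
  have "pattern_number n {} \<noteq> 0" by (simp add: pattern_number_def)
  then have "path_count n (cox n) (map (\<lambda>i. i \<in> {}) (rev [1..<Suc n])) \<noteq> 0"
    unfolding path_count_cox[OF n] .
  then obtain xs where xs: "set xs \<subseteq> reflections n" "length xs = n" "cox n = word_prod xs"
    using path_count_word[of n "cox n" "map (\<lambda>i. i \<in> {}) (rev [1..<Suc n])"] by (auto simp del: upt_Suc)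
  show "len_T n (cox n) \<le> n" using word_length_le[OF xs(1) xs(3)[symmetric]] xs(2) by simp
next
  obtain xs where xs: "length xs = len_T n (cox n)" "set xs \<subseteq> reflections n" "word_prod xs = cox n"
    using reflection_word[OF n cox_B[OF n]] .
  have "(3::nat) ^ n \<le> card (odd_fix n (cox n)) * 3 ^ len_T n (cox n)"
    using card_odd_fix_word[OF xs(2)] unfolding xs(1,3) .
  also have "card (odd_fix n (cox n)) \<le> 1"
    using cycle_lists_card_odd_fix[OF cycle_lists_cox[OF n]] by simp
  finally have "(3::nat) ^ n \<le> 3 ^ len_T n (cox n)" by simp
  then show "n \<le> len_T n (cox n)" by (simp add: power_increasing_iff)
qed

text \<open>
The same paths as in \<open>path_count\<close>, listed from the identity upwards; this is why the pattern is reversed.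
\<close>
definition paths :: "nat \<Rightarrow> (int \<Rightarrow> int) \<Rightarrow> bool list \<Rightarrow> (int \<Rightarrow> int) list set" where
  "paths n w R = {ws. length ws = Suc (length R) \<and> ws ! 0 = id \<and> ws ! length R = w \<and>
     (\<forall>i<length R. (\<exists>t\<in>reflections n. ws ! Suc i = ws ! i \<circ> t)
        \<and> (len_S n (ws ! Suc i) < len_S n (ws ! i)) = rev R ! i)}"

lemma paths_Cons:
  "paths n w (b # R) = (\<lambda>(t, ws). ws @ [w]) `
     (SIGMA t:{t \<in> reflections n. (len_S n w < len_S n (w \<circ> t)) = b}. paths n (w \<circ> t) R)" (is "?L = ?R")
proof
  let ?k = "length R"
  show "?L \<subseteq> ?R"
  proof
    fix vs assume vs: "vs \<in> ?L"
    then have l: "length vs = Suc (Suc ?k)" and last: "vs ! Suc ?k = w" and first: "vs ! 0 = id"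
      and steps: "\<And>i. i < Suc ?k \<Longrightarrow> (\<exists>t\<in>reflections n. vs ! Suc i = vs ! i \<circ> t)
        \<and> (len_S n (vs ! Suc i) < len_S n (vs ! i)) = (rev R @ [b]) ! i"
      by (simp_all add: paths_def)
    define ws where "ws = butlast vs"
    have lw: "length ws = Suc ?k" using l by (simp add: ws_def)
    have vsw: "vs = ws @ [w]"
      using last l unfolding ws_def by (metis append_butlast_last_id diff_Suc_1 last_conv_nth list.size(3) nat.distinct(1))
    have nth: "ws ! i = vs ! i" if "i \<le> ?k" for i using that lw by (simp add: vsw nth_append)
    obtain t where t: "t \<in> reflections n" "vs ! Suc ?k = vs ! ?k \<circ> t" using steps[of ?k] by blast
    have wt: "w \<circ> t = ws ! ?k"
      unfolding last[symmetric] t(2) comp_assoc reflection_comp_self[OF t(1)] comp_id nth[OF le_refl] ..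
    have "(len_S n w < len_S n (w \<circ> t)) = b"
      using steps[of ?k] last nth[of ?k] wt by (simp add: nth_append)
    moreover have "ws \<in> paths n (w \<circ> t) R"
      unfolding paths_def mem_Collect_eq
    proof (intro conjI allI impI)
      show "length ws = Suc ?k" "ws ! 0 = id" "ws ! ?k = w \<circ> t" using lw first nth[of 0] wt by simp_all
      fix i assume i: "i < ?k"
      then show "\<exists>t\<in>reflections n. ws ! Suc i = ws ! i \<circ> t"
        using steps[of i] nth[of i] nth[of "Suc i"] by simp
      show "(len_S n (ws ! Suc i) < len_S n (ws ! i)) = rev R ! i"
        using steps[of i] nth[of i] nth[of "Suc i"] i by (simp add: nth_append)
    qed
    ultimately have "(t, ws) \<in> (SIGMA t:{t \<in> reflections n. (len_S n w < len_S n (w \<circ> t)) = b}. paths n (w \<circ> t) R)"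
      using t(1) by blast
    then show "vs \<in> ?R" unfolding vsw by force
  qed
  show "?R \<subseteq> ?L"
  proof
    fix vs assume "vs \<in> ?R"
    then obtain t ws where t: "t \<in> reflections n" "(len_S n w < len_S n (w \<circ> t)) = b"
      and ws: "ws \<in> paths n (w \<circ> t) R" and vs: "vs = ws @ [w]" by auto
    have lw: "length ws = Suc ?k" "ws ! 0 = id" "ws ! ?k = w \<circ> t"
      and steps: "\<And>i. i < ?k \<Longrightarrow> (\<exists>t\<in>reflections n. ws ! Suc i = ws ! i \<circ> t)
        \<and> (len_S n (ws ! Suc i) < len_S n (ws ! i)) = rev R ! i"
      using ws by (simp_all only: paths_def mem_Collect_eq)
    have wtt: "w = w \<circ> t \<circ> t" unfolding comp_assoc reflection_comp_self[OF t(1)] comp_id ..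
    show "vs \<in> ?L"
      unfolding paths_def mem_Collect_eq
    proof (intro conjI allI impI)
      show "length vs = Suc (length (b # R))" "vs ! 0 = id" "vs ! length (b # R) = w"
        using lw(1,2) by (simp_all add: vs nth_append)
      fix i assume "i < length (b # R)"
      then consider "i < ?k" | "i = ?k" by force
      then show "\<exists>t\<in>reflections n. vs ! Suc i = vs ! i \<circ> t"
      proof cases
        case 1
        then show ?thesis using steps[of i] lw(1) by (simp add: vs nth_append)
      next
        case 2
        then have "vs ! Suc i = w" "vs ! i = w \<circ> t" using lw(1,3) by (simp_all only: vs nth_append, simp_all)
        then show ?thesis using t(1) wtt by (intro bexI[of _ t]) (simp_all only:)
      qed
      show "(len_S n (vs ! Suc i) < len_S n (vs ! i)) = rev (b # R) ! i"
        using \<open>i < length (b # R)\<close>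
      proof -
        consider "i < ?k" | "i = ?k" using \<open>i < length (b # R)\<close> by force
        then show ?thesis
        proof cases
          case 1
          then show ?thesis using steps[of i] lw(1) by (simp add: vs nth_append)
        next
          case 2
          then have "vs ! Suc i = w" "vs ! i = w \<circ> t" "rev (b # R) ! i = b"
            using lw(1,3) by (simp_all only: vs nth_append rev.simps, simp_all)
          then show ?thesis using t(2) by (simp only:)
        qed
      qed
    qed
  qed
qed

lemma card_paths:
  assumes "w \<in> B_group n"
  shows "finite (paths n w R) \<and> card (paths n w R) = path_count n w R"
  using assms
proof (induction R arbitrary: w)
  case Nil
  have "paths n w [] = (if w = id then {[id]} else {})"
    by (auto simp: paths_def length_Suc_conv)
  then show ?case by simp
next
  case (Cons b R)
  let ?T = "{t \<in> reflections n. (len_S n w < len_S n (w \<circ> t)) = b}"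
  have inj: "inj_on (\<lambda>(t, ws). ws @ [w]) (SIGMA t:?T. paths n (w \<circ> t) R)"
  proof (rule inj_onI)
    fix p p' assume p: "p \<in> (SIGMA t:?T. paths n (w \<circ> t) R)" "p' \<in> (SIGMA t:?T. paths n (w \<circ> t) R)"
      and eq: "(case p of (t, ws) \<Rightarrow> ws @ [w]) = (case p' of (t, ws) \<Rightarrow> ws @ [w])"
    obtain t ws t' ws' where pp: "p = (t, ws)" "p' = (t', ws')" by (cases p; cases p')
    have ws: "ws = ws'" using eq by (simp add: pp)
    have "ws ! length R = w \<circ> t" "ws' ! length R = w \<circ> t'" using p by (simp_all only: pp mem_Sigma_iff paths_def mem_Collect_eq)
    then have e: "w \<circ> t = w \<circ> t'" using ws by (simp only:)
    have "t = inv w \<circ> (w \<circ> t)" by (rule inv_comp_cancel(2)[OF Cons.prems, symmetric])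
    also have "\<dots> = t'" unfolding e by (rule inv_comp_cancel(2)[OF Cons.prems])
    finally show "p = p'" using ws by (simp add: pp)
  qed
  have IH: "finite (paths n (w \<circ> t) R) \<and> card (paths n (w \<circ> t) R) = path_count n (w \<circ> t) R" if "t \<in> ?T" for t
    by (rule Cons.IH) (use that Cons.prems reflection_B B_comp in blast)
  have fin: "finite ?T" by simp
  have "finite (paths n w (b # R))"
    unfolding paths_Cons by (intro finite_imageI finite_SigmaI fin conjunct1[OF IH])
  moreover have "card (paths n w (b # R)) = (\<Sum>t\<in>?T. card (paths n (w \<circ> t) R))"
    unfolding paths_Cons card_image[OF inj] by (rule card_SigmaI[OF fin]) (intro ballI conjunct1[OF IH])
  moreover have "\<dots> = path_count n w (b # R)"
    unfolding path_count.simps by (intro sum.cong refl conjunct2[OF IH])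
  ultimately show ?case by (simp only: simp_thms)
qed

section \<open>Parking functions with prescribed reluctant cars\<close>

lemma next_space_iterate:
  assumes "a \<in> {1..n}"
  shows "(next_space n ^^ k) a = (a - 1 + k) mod n + 1"
proof (induction k)
  case 0
  have "a - 1 < n" using assms by auto
  then show ?case using assms by simp
next
  case (Suc k)
  let ?r = "(a - 1 + k) mod n"
  have "?r < n" using assms by simp
  then show ?case using Suc by (auto simp: next_space_def mod_Suc)
qed

lemma park_at_free:
  assumes a: "a \<in> {1..n}" and Occ: "Occ \<subseteq> {1..n}" "card Occ < n"
  shows "park_at n Occ a \<in> {1..n} - Occ"
proof -
  have "\<not> {1..n} \<subseteq> Occ"
    using Occ card_mono[of Occ "{1..n}"] finite_subset[OF Occ(1)] by auto
  then obtain p where p: "p \<in> {1..n}" "p \<notin> Occ" by blast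
  have "a - 1 + (p + n - a) = (p - 1) + n" using a p by auto
  moreover have "p - 1 < n" "p - 1 + 1 = p" using p by auto
  ultimately have "(next_space n ^^ (p + n - a)) a = p"
    by (simp only: next_space_iterate[OF a] mod_add_self2 mod_less)
  then have "\<exists>k. (next_space n ^^ k) a \<notin> Occ" using p by metis
  then have "park_at n Occ a \<notin> Occ" unfolding park_at_def by (rule LeastI_ex)
  moreover have "park_at n Occ a \<in> {1..n}"
    using a unfolding park_at_def next_space_iterate[OF a] by (auto simp: Suc_le_eq)
  ultimately show ?thesis by blast
qed

text \<open>
The search for a space ends because not all spaces are occupied.
\<close>
lemma park_at_lucky_iff:
  assumes "a \<in> {1..n}" "Occ \<subseteq> {1..n}" "card Occ < n"
  shows "park_at n Occ a = a \<longleftrightarrow> a \<notin> Occ"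
proof
  show "park_at n Occ a = a \<Longrightarrow> a \<notin> Occ" using park_at_free[OF assms] by auto
  assume "a \<notin> Occ"
  then have "(LEAST k. (next_space n ^^ k) a \<notin> Occ) = 0" by (intro Least_eq_0) simp
  then show "park_at n Occ a = a" by (simp add: park_at_def)
qed

fun parking_product :: "nat \<Rightarrow> nat \<Rightarrow> bool list \<Rightarrow> nat" where
  "parking_product n k [] = 1"
| "parking_product n k (b # bs) = (if b then k else n - k) * parking_product n (Suc k) bs"

definition parkings :: "nat \<Rightarrow> nat set \<Rightarrow> bool list \<Rightarrow> nat list set" where
  "parkings n Occ bs = {\<alpha>. length \<alpha> = length bs \<and> set \<alpha> \<subseteq> {1..n} \<and> map2 (\<noteq>) (park n Occ \<alpha>) \<alpha> = bs}"

text \<open>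
The number of choices for the next car depends on the occupied spaces only through their number.
\<close>
lemma card_parkings:
  assumes "Occ \<subseteq> {1..n}" "card Occ + length bs \<le> n"
  shows "finite (parkings n Occ bs) \<and> card (parkings n Occ bs) = parking_product n (card Occ) bs"
  using assms
proof (induction bs arbitrary: Occ)
  case Nil
  have "parkings n Occ [] = {[]}" by (auto simp: parkings_def)
  then show ?case by simp
next
  case (Cons b bs)
  let ?A = "{a \<in> {1..n}. (a \<in> Occ) = b}"
  have fin: "finite Occ" using Cons.prems finite_subset by blast
  have IH: "finite (parkings n (insert (park_at n Occ a) Occ) bs) \<and>
     card (parkings n (insert (park_at n Occ a) Occ) bs) = parking_product n (Suc (card Occ)) bs"
    if "a \<in> {1..n}" for a
  proof -
    have "park_at n Occ a \<in> {1..n} - Occ"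
      using park_at_free[of a n Occ] that Cons.prems by simp
    then show ?thesis using Cons.IH[of "insert (park_at n Occ a) Occ"] Cons.prems fin by simp
  qed
  have lucky: "(park_at n Occ a \<noteq> a) = (a \<in> Occ)" if "a \<in> {1..n}" for a
    using park_at_lucky_iff[of a n Occ] that Cons.prems by simp
  have eq: "parkings n Occ (b # bs)
    = (\<lambda>(a, \<alpha>). a # \<alpha>) ` (SIGMA a:?A. parkings n (insert (park_at n Occ a) Occ) bs)" (is "?L = ?R")
  proof
    show "?L \<subseteq> ?R"
    proof
      fix \<beta> assume \<beta>: "\<beta> \<in> ?L"
      then obtain a \<alpha> where "\<beta> = a # \<alpha>" by (cases \<beta>) (auto simp: parkings_def)
      moreover from this \<beta> have "a \<in> {1..n}" by (simp add: parkings_def)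
      ultimately have "(a, \<alpha>) \<in> (SIGMA a:?A. parkings n (insert (park_at n Occ a) Occ) bs)"
        using \<beta> lucky[of a] by (simp add: parkings_def Let_def)
      then show "\<beta> \<in> ?R" using \<open>\<beta> = a # \<alpha>\<close> by force
    qed
    show "?R \<subseteq> ?L" using lucky by (auto simp: parkings_def Let_def)
  qed
  have inj: "inj_on (\<lambda>(a, \<alpha>). a # \<alpha>) X" for X :: "(nat \<times> nat list) set"
    by (auto simp: inj_on_def)
  have "card ?A = (if b then card Occ else n - card Occ)"
  proof (cases b)
    case True
    then have "?A = Occ" using Cons.prems by auto
    then show ?thesis using True by simp
  next
    case False
    then have "?A = {1..n} - Occ" by auto
    then show ?thesis using False Cons.prems fin by (simp add: card_Diff_subset)
  qed
  then have "card (parkings n Occ (b # bs)) = parking_product n (card Occ) (b # bs)"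
    unfolding eq card_image[OF inj] using IH by (subst card_SigmaI) auto
  moreover have "finite (parkings n Occ (b # bs))"
    unfolding eq using IH by (intro finite_imageI finite_SigmaI) auto
  ultimately show ?case by simp
qed

lemma parking_product_eq: "parking_product n 0 (map (\<lambda>i. i \<in> I) [1..<Suc n]) = pattern_number n I"
proof -
  have "parking_product n k (map (\<lambda>i. i \<in> I) [Suc k..<Suc n])
      = (\<Prod>i\<in>{Suc k..n}. if i \<in> I then i - 1 else n - i + 1)" if "k \<le> n" for k
    using that
  proof (induction k rule: inc_induct)
    case (step k)
    have "{Suc k..n} = insert (Suc k) {Suc (Suc k)..n}" using step.hyps by auto
    moreover have "[Suc k..<Suc n] = Suc k # [Suc (Suc k)..<Suc n]"
      using step.hyps by (subst upt_conv_Cons) auto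
    ultimately show ?case using step by (simp add: Suc_diff_Suc del: upt_Suc)
  qed simp
  from this[of 0] show ?thesis by (simp add: pattern_number_def)
qed

definition reluctant_set :: "nat \<Rightarrow> nat list \<Rightarrow> nat set" where
  "reluctant_set n \<alpha> = {i \<in> {1..n}. reluctant n \<alpha> i}"

lemma length_park [simp]: "length (park n Occ \<alpha>) = length \<alpha>"
  by (induction \<alpha> arbitrary: Occ) (auto simp: Let_def)

lemma card_reluctant_set:
  assumes "I \<subseteq> {1..n}"
  shows "card {\<alpha> \<in> PFB n. reluctant_set n \<alpha> = I} = pattern_number n I"
proof -
  have "reluctant_set n \<alpha> = I \<longleftrightarrow> map2 (\<noteq>) (park n {} \<alpha>) \<alpha> = map (\<lambda>i. i \<in> I) [1..<Suc n]"
    if "length \<alpha> = n" for \<alpha>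
  proof -
    have "map2 (\<noteq>) (park n {} \<alpha>) \<alpha> = map (\<lambda>i. i \<in> I) [1..<Suc n]
      \<longleftrightarrow> (\<forall>j<n. reluctant n \<alpha> (Suc j) = (Suc j \<in> I))"
      using that by (simp add: list_eq_iff_nth_eq lucky_def outcome_def del: upt_Suc)
    also have "\<dots> \<longleftrightarrow> (\<forall>i\<in>{1..n}. reluctant n \<alpha> i = (i \<in> I))"
      by (metis One_nat_def Suc_le_eq Suc_pred atLeastAtMost_iff less_Suc_eq_le zero_less_Suc)
    also have "\<dots> \<longleftrightarrow> reluctant_set n \<alpha> = I"
      using assms unfolding reluctant_set_def by blast
    finally show ?thesis by simp
  qed
  then have "{\<alpha> \<in> PFB n. reluctant_set n \<alpha> = I} = parkings n {} (map (\<lambda>i. i \<in> I) [1..<Suc n])"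
    by (auto simp: PFB_def parkings_def simp del: upt_Suc)
  then show ?thesis using card_parkings[of "{}" n] parking_product_eq by (simp del: upt_Suc)
qed

section \<open>A continuant with product value\<close>

text \<open>
The weighted sum over all ways to cover the path with the points \<open>1, \<dots>, k\<close> by single points of weight \<open>1 + q\<close> and by disjoint
pairs \<open>{b - 1, b}\<close> of weight \<open>q (x - b) / b\<close>.
\<close>
fun continuant :: "real \<Rightarrow> real \<Rightarrow> nat \<Rightarrow> real" where
  "continuant x q 0 = 1"
| "continuant x q (Suc 0) = 1 + q"
| "continuant x q (Suc (Suc k)) = (1 + q) * continuant x q (Suc k)
     + q * ((x - real (Suc (Suc k))) / real (Suc (Suc k))) * continuant x q k"

definition factor_prod :: "real \<Rightarrow> real \<Rightarrow> nat \<Rightarrow> real" where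
  "factor_prod x q j = (\<Prod>i = 1..j. (x - real i) + real i * q) / fact j"

lemma factor_prod_0 [simp]: "factor_prod x q 0 = 1"
  by (simp add: factor_prod_def)

lemma factor_prod_Suc:
  "real (Suc j) * factor_prod x q (Suc j) = ((x - real (Suc j)) + real (Suc j) * q) * factor_prod x q j"
  by (simp add: factor_prod_def field_simps del: of_nat_Suc)

definition continuant_coeff :: "real \<Rightarrow> nat \<Rightarrow> nat \<Rightarrow> real" where
  "continuant_coeff x k j = (if j \<le> k then (- 1) ^ (k - j) * ((x - 2 - real j) gchoose (k - j)) else 0)"

text \<open>
For fixed \<open>x\<close> and \<open>q\<close>, the three-term recurrence says that the generating function \<open>G\<close> of the continuants satisfies
\<open>(1 - t) (1 - q t) G' = ((1 + q) + q (x - 2) t) G\<close>.  Its solution is a product of powers of \<open>1 - t\<close> and \<open>1 - q t\<close>; writing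
\<open>1 - q t = (1 - t) + (1 - q) t\<close> and expanding by the binomial theorem gives the formula.  It is verified here by induction:
the recurrence of the products removes the factor \<open>q\<close>, and then the coefficients of each product agree by Pascal's rule and absorption.
\<close>
lemma continuant_expansion:
  "continuant x q k = (\<Sum>j\<le>k. continuant_coeff x k j * factor_prod x q j)"
proof (induction x q k rule: continuant.induct)
  case (1 x q)
  show ?case by (simp add: continuant_coeff_def)
next
  case (2 x q)
  have "factor_prod x q (Suc 0) = x - 1 + q" using factor_prod_Suc[of 0 x q] by simp
  then show ?case by (simp add: continuant_coeff_def atMost_Suc)
next
  case (3 x q m)
  define k where "k = Suc (Suc m)"
  define c where "c = continuant_coeff x"
  define E where "E = factor_prod x q"
  define d where "d j = (- 1) ^ (k - j) * ((x - 1 - real j) gchoose (k - j))" for j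
  have E: "real (Suc j) * q * E j = real (Suc j) * E (Suc j) - (x - 1 - real j) * E j" for j
    using factor_prod_Suc[of j x q] unfolding E_def by (simp add: algebra_simps)
  \<comment> \<open>Pascal's rule compares the terms that do not contain \<open>q\<close>.\<close>
  have pascal: "c k j - c (Suc m) j = d j" if "j \<le> k" for j
  proof (cases "j = k")
    case True then show ?thesis by (simp add: c_def continuant_coeff_def d_def k_def)
  next
    case False
    then have j: "j \<le> Suc m" using that k_def by simp
    have kj: "k - j = Suc (Suc m - j)" using j k_def by simp
    have "x - 1 - real j = (x - 2 - real j) + 1" by simp
    then have "(x - 1 - real j) gchoose (k - j)
      = ((x - 2 - real j) gchoose (Suc m - j)) + ((x - 2 - real j) gchoose Suc (Suc m - j))"
      unfolding kj using gbinomial_Suc_Suc by metis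
    then show ?thesis using j by (simp add: c_def continuant_coeff_def d_def kj k_def Suc_diff_le algebra_simps)
  qed
  \<comment> \<open>The coefficient of the terms with \<open>q\<close> acquires the factor \<open>j + 1\<close>, which is what the recurrence of the products needs.\<close>
  have absorb: "real k * c (Suc m) j + (x - real k) * c m j = real (Suc j) * c (Suc m) j"
    if "j \<le> Suc m" for j
  proof (cases "j = Suc m")
    case True then show ?thesis by (simp add: c_def continuant_coeff_def k_def)
  next
    case False
    then have j: "j \<le> m" using that by simp
    let ?a = "x - 2 - real j"
    have "?a * (?a gchoose (m - j)) = real (m - j) * (?a gchoose (m - j))
        + real (Suc (m - j)) * (?a gchoose (Suc (m - j)))"
      by (rule gbinomial_mult_1)
    moreover have "real (m - j) = real m - real j" using j by simp
    ultimately have "real (Suc (m - j)) * (?a gchoose (Suc (m - j))) = (x - real k) * (?a gchoose (m - j))"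
      by (simp add: k_def algebra_simps)
    moreover have "real (Suc (m - j)) = real k - real (Suc j)" using j by (simp add: k_def)
    ultimately have eq: "(x - real k) * (?a gchoose (m - j))
        = (real k - real (Suc j)) * (?a gchoose (Suc (m - j)))" by (simp only:)
    have "c m j = (- 1) ^ (m - j) * (?a gchoose (m - j))"
      and "c (Suc m) j = - ((- 1) ^ (m - j) * (?a gchoose (Suc (m - j))))"
      using j by (simp_all add: c_def continuant_coeff_def Suc_diff_le)
    then have "real k * c (Suc m) j + (x - real k) * c m j - real (Suc j) * c (Suc m) j
      = (- 1) ^ (m - j) * ((x - real k) * (?a gchoose (m - j))
        - (real k - real (Suc j)) * (?a gchoose (Suc (m - j))))"
      by (simp only:) (simp add: algebra_simps)
    then show ?thesis unfolding eq by simp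
  qed
  have fold_up: "(real k - real j) * d j + (x - 1 - real j) * c (Suc m) j = 0" if "j \<le> k" for j
  proof (cases "j = k")
    case True then show ?thesis by (simp add: c_def continuant_coeff_def k_def)
  next
    case False
    then have j: "j \<le> Suc m" using that k_def by simp
    have kj: "k - j = Suc (Suc m - j)" using j k_def by simp
    have r: "real k - real j = real (Suc (Suc m - j))" using j by (simp add: k_def)
    have "real (Suc (Suc m - j)) * ((x - 1 - real j) gchoose Suc (Suc m - j))
      = (x - 1 - real j) * ((x - 1 - real j - 1) gchoose (Suc m - j))"
      by (rule gbinomial_absorption)
    moreover have "x - 1 - real j - 1 = x - 2 - real j" by simp
    ultimately have "(real k - real j) * ((x - 1 - real j) gchoose (k - j))
      = (x - 1 - real j) * ((x - 2 - real j) gchoose (Suc m - j))"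
      unfolding r kj by simp
    then have "(real k - real j) * ((x - 1 - real j) gchoose (k - j))
      - (x - 1 - real j) * ((x - 2 - real j) gchoose (Suc m - j)) = 0" by (simp only: diff_self)
    moreover have "(real k - real j) * d j + (x - 1 - real j) * c (Suc m) j
      = (- 1) ^ (k - j) * ((real k - real j) * ((x - 1 - real j) gchoose (k - j))
        - (x - 1 - real j) * ((x - 2 - real j) gchoose (Suc m - j)))"
      using j unfolding d_def c_def continuant_coeff_def kj by (simp only: if_True power_Suc) (simp add: algebra_simps)
    ultimately show ?thesis by simp
  qed
  \<comment> \<open>After the recurrence of the products has replaced \<open>q\<close>, the index is shifted by one.\<close>
  have shift: "c (Suc m) (j - 1) = d j" if "j \<le> k" "1 \<le> j" for j
  proof -
    have "real (j - 1) = real j - 1" using that by simp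
    moreover have "x - 2 - (real j - 1) = x - 1 - real j" by simp
    moreover have "Suc m - (j - 1) = k - j" using that by (simp add: k_def)
    moreover have "j - 1 \<le> Suc m" using that by (simp add: k_def)
    ultimately show ?thesis by (simp only: c_def continuant_coeff_def d_def if_True)
  qed
  have ck: "c (Suc m) k = 0" "c m (Suc m) = 0" "c m k = 0" by (simp_all add: c_def continuant_coeff_def k_def)
  have "(\<Sum>j\<le>Suc m. c (Suc m) j * (real (Suc j) * E (Suc j)))
      = (\<Sum>j\<le>k. real j * d j * E j)"
  proof -
    have "(\<Sum>j\<le>k. real j * d j * E j) = (\<Sum>j\<le>Suc m. real (Suc j) * d (Suc j) * E (Suc j))"
      unfolding k_def by (subst sum.atMost_Suc_shift) simp
    also have "\<dots> = (\<Sum>j\<le>Suc m. c (Suc m) j * (real (Suc j) * E (Suc j)))"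
      by (rule sum.cong) (use shift[of "Suc _"] k_def in \<open>auto simp: mult_ac\<close>)
    finally show ?thesis by simp
  qed
  moreover have "(\<Sum>j\<le>Suc m. c (Suc m) j * ((x - 1 - real j) * E j))
      = (\<Sum>j\<le>k. c (Suc m) j * ((x - 1 - real j) * E j))"
    using ck by (simp add: k_def)
  ultimately have q1: "(\<Sum>j\<le>Suc m. c (Suc m) j * (real (Suc j) * q * E j))
      = (\<Sum>j\<le>k. (real j * d j - (x - 1 - real j) * c (Suc m) j) * E j)"
    unfolding E right_diff_distrib sum_subtractf by (simp add: sum_subtractf[symmetric] algebra_simps)
  have IH1: "continuant x q (Suc m) = (\<Sum>j\<le>k. c (Suc m) j * E j)"
    and IH1': "continuant x q (Suc m) = (\<Sum>j\<le>Suc m. c (Suc m) j * E j)"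
    and IH2: "continuant x q m = (\<Sum>j\<le>Suc m. c m j * E j)"
    using 3 ck by (simp_all add: k_def c_def E_def)
  have "real k * continuant x q (Suc m) + (x - real k) * continuant x q m
      = (\<Sum>j\<le>Suc m. (real k * c (Suc m) j + (x - real k) * c m j) * E j)"
    unfolding IH1' IH2 by (simp only: sum_distrib_left distrib_right sum.distrib mult.assoc)
  also have "\<dots> = (\<Sum>j\<le>Suc m. c (Suc m) j * (real (Suc j) * E j))"
    by (rule sum.cong) (use absorb in \<open>auto simp: mult_ac\<close>)
  finally have q2: "q * (real k * continuant x q (Suc m) + (x - real k) * continuant x q m)
      = (\<Sum>j\<le>k. (real j * d j - (x - 1 - real j) * c (Suc m) j) * E j)"
    unfolding q1[symmetric] by (simp add: sum_distrib_left mult_ac del: sum.atMost_Suc)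
  have "real k * (\<Sum>j\<le>k. c k j * E j) - real k * continuant x q (Suc m)
      = (\<Sum>j\<le>k. real k * d j * E j)"
    unfolding IH1 using pascal
    by (simp add: sum_distrib_left sum_subtractf[symmetric] right_diff_distrib[symmetric] left_diff_distrib[symmetric] mult.assoc)
  also have "\<dots> = (\<Sum>j\<le>k. (real j * d j - (x - 1 - real j) * c (Suc m) j) * E j)"
  proof (rule sum.cong)
    fix j assume "j \<in> {..k}"
    then have "real k * d j = real j * d j - (x - 1 - real j) * c (Suc m) j"
      using fold_up[of j] by (simp add: algebra_simps)
    then show "real k * d j * E j = (real j * d j - (x - 1 - real j) * c (Suc m) j) * E j" by simp
  qed simp
  finally have "real k * (\<Sum>j\<le>k. c k j * E j) = real k * continuant x q (Suc m)
      + q * (real k * continuant x q (Suc m) + (x - real k) * continuant x q m)"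
    using q2 by simp
  moreover have "\<dots> = real k * continuant x q k"
    by (simp add: k_def field_simps)
  moreover have "real k \<noteq> 0" by (simp add: k_def)
  ultimately have "(\<Sum>j\<le>k. c k j * E j) = continuant x q k" by simp
  then show ?case by (simp add: k_def c_def E_def)
qed

text \<open>
All terms but the last contain a binomial coefficient \<open>m choose (m + 1)\<close>.
\<close>
lemma continuant_diagonal:
  assumes "1 \<le> n"
  shows "continuant (real n) q (n - 1) = factor_prod (real n) q (n - 1)"
proof -
  have "continuant_coeff (real n) (n - 1) j = 0" if "j < n - 1" for j
  proof -
    have "real n - 2 - real j = real (n - 2 - j)" using that by simp
    then have "(real n - 2 - real j) gchoose (n - 1 - j) = real ((n - 2 - j) choose (n - 1 - j))"
      by (simp only: binomial_gbinomial)
    also have "\<dots> = 0" using that by simp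
    finally show ?thesis by (simp add: continuant_coeff_def)
  qed
  moreover have "continuant_coeff (real n) (n - 1) (n - 1) = 1" by (simp add: continuant_coeff_def)
  moreover have "{..n - 1} = insert (n - 1) {..<n - 1}" by auto
  ultimately show ?thesis unfolding continuant_expansion by simp
qed

text \<open>
The sets of right ends \<open>b\<close> of pairwise disjoint pairs \<open>{b - 1, b}\<close> of points in \<open>{1..k}\<close>.
\<close>
definition sparse :: "nat \<Rightarrow> nat set set" where
  "sparse k = {B. B \<subseteq> {2..k} \<and> (\<forall>b\<in>B. Suc b \<notin> B)}"

lemma sparse_finite: "finite (sparse k)" "B \<in> sparse k \<Longrightarrow> finite B"
  by (auto simp: sparse_def intro: finite_subset[of _ "Pow {2..k}"] finite_subset)

lemma sparse_Suc_Suc: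
  "sparse (Suc (Suc k)) = sparse (Suc k) \<union> insert (Suc (Suc k)) ` sparse k" (is "?L = ?R")
proof
  show "?L \<subseteq> ?R"
  proof
    fix B assume B: "B \<in> ?L"
    show "B \<in> ?R"
    proof (cases "Suc (Suc k) \<in> B")
      case False
      then have "B \<in> sparse (Suc k)" using B by (auto simp: sparse_def le_Suc_eq)
      then show ?thesis ..
    next
      case True
      have "Suc k \<notin> B" using B True by (auto simp: sparse_def)
      then have "B - {Suc (Suc k)} \<in> sparse k" using B by (auto simp: sparse_def le_Suc_eq)
      moreover have "B = insert (Suc (Suc k)) (B - {Suc (Suc k)})" using True by auto
      ultimately show ?thesis by blast
    qed
  qed
  show "?R \<subseteq> ?L" by (auto simp: sparse_def)
qed

lemma sparse_card: "B \<in> sparse k \<Longrightarrow> 2 * card B \<le> k"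
proof (induction k arbitrary: B rule: less_induct)
  case (less k)
  consider "k = 0" | "k = 1" | m where "k = Suc (Suc m)" by (metis One_nat_def not0_implies_Suc)
  then show ?case
  proof cases
    case 3
    from less.prems[unfolded 3 sparse_Suc_Suc] consider "B \<in> sparse (Suc m)"
      | B' where "B' \<in> sparse m" "B = insert (Suc (Suc m)) B'" by auto
    then show ?thesis
    proof cases
      case 1 then show ?thesis using less.IH[of "Suc m" B] 3 by simp
    next
      case 2
      then have "card B \<le> Suc (card B')" by (simp add: card_insert_le_m1 sparse_finite(2) card_insert_if)
      then show ?thesis using less.IH[of m B'] 3 2 by simp
    qed
  qed (use less.prems in \<open>auto simp: sparse_def\<close>)
qed

text \<open>
Either \<open>k\<close> is the right end of a pair, and the pair is removed, or it is a single point.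
\<close>
lemma continuant_sparse:
  "continuant x q k =
    (\<Sum>B\<in>sparse k. (\<Prod>b\<in>B. (x - real b) / real b) * q ^ card B * (1 + q) ^ (k - 2 * card B))"
proof (induction x q k rule: continuant.induct)
  case (1 x q)
  have "sparse 0 = {{}}" by (auto simp: sparse_def)
  then show ?case by simp
next
  case (2 x q)
  have "sparse (Suc 0) = {{}}" by (auto simp: sparse_def)
  then show ?case by simp
next
  case (3 x q k)
  let ?f = "\<lambda>k B. (\<Prod>b\<in>B. (x - real b) / real b) * q ^ card B * (1 + q) ^ (k - 2 * card B)"
  let ?n = "Suc (Suc k)"
  have notin: "?n \<notin> B" if "B \<in> sparse k" for B using that by (auto simp: sparse_def)
  have inj: "inj_on (insert ?n) (sparse k)"
    using notin by (intro inj_onI) (metis insert_ident)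
  have "(\<Sum>B\<in>sparse ?n. ?f ?n B) = (\<Sum>B\<in>sparse (Suc k). ?f ?n B) + (\<Sum>B\<in>insert ?n ` sparse k. ?f ?n B)"
    unfolding sparse_Suc_Suc by (rule sum.union_disjoint) (auto simp: sparse_finite, auto simp: sparse_def)
  also have "(\<Sum>B\<in>sparse (Suc k). ?f ?n B) = (1 + q) * (\<Sum>B\<in>sparse (Suc k). ?f (Suc k) B)"
    unfolding sum_distrib_left
  proof (rule sum.cong)
    fix B assume "B \<in> sparse (Suc k)"
    then have "?n - 2 * card B = Suc (Suc k - 2 * card B)" using sparse_card by fastforce
    then show "?f ?n B = (1 + q) * ?f (Suc k) B" by simp
  qed simp
  also have "(\<Sum>B\<in>insert ?n ` sparse k. ?f ?n B) = (\<Sum>B\<in>sparse k. ?f ?n (insert ?n B))"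
    using sum.reindex[OF inj, of "?f ?n"] by (simp add: comp_def)
  also have "\<dots> = q * ((x - real ?n) / real ?n) * (\<Sum>B\<in>sparse k. ?f k B)"
    unfolding sum_distrib_left
  proof (rule sum.cong)
    fix B assume B: "B \<in> sparse k"
    show "?f ?n (insert ?n B) = q * ((x - real ?n) / real ?n) * ?f k B"
      using notin[OF B] sparse_finite(2)[OF B] by (simp del: of_nat_Suc)
  qed simp
  finally show ?case using 3 by simp
qed

text \<open>
The factor for \<open>i = 1\<close> is \<open>n\<close>, and the other ones make up the product value of the continuant with \<open>x = n\<close> at the index \<open>n - 1\<close>.
\<close>
lemma gamma_expansion:
  assumes "1 \<le> n"
  shows "(\<Prod>i = 1..n. (real (n - i + 1) + real (i - 1) * q)) =
    (\<Sum>B\<in>sparse (n - 1). fact n * (\<Prod>b\<in>B. (real n - real b) / real b)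
       * q ^ card B * (1 + q) ^ (n - 1 - 2 * card B))"
proof -
  have "(\<Prod>i = 1..n. (real (n - i + 1) + real (i - 1) * q))
      = (\<Prod>i\<in>{0..n-1}. (real n - real i) + real i * q)"
    by (rule prod.reindex_bij_witness[of _ "\<lambda>i. i + 1" "\<lambda>i. i - 1"]) (use assms in \<open>auto simp: of_nat_diff\<close>)
  also have "{0..n-1} = insert 0 {1..n-1}" by auto
  also have "(\<Prod>i\<in>insert 0 {1..n-1}. (real n - real i) + real i * q) = real n * (fact (n - 1) * factor_prod (real n) q (n - 1))"
    by (simp add: factor_prod_def)
  also have "\<dots> = fact n * continuant (real n) q (n - 1)"
    using assms continuant_diagonal[OF assms] by (simp add: fact_reduce)
  finally show ?thesis
    unfolding continuant_sparse by (simp add: sum_distrib_left mult_ac)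
qed

section \<open>Sparse patterns and the gamma expansion\<close>

definition bad_set :: "nat \<Rightarrow> (int \<Rightarrow> int) list \<Rightarrow> nat set" where
  "bad_set n ws = {i \<in> {1..n}. bad_edge n (ws ! (i - 1)) (ws ! i)}"

lemma bad_set_subset: "bad_set n ws \<subseteq> {1..n}"
  unfolding bad_set_def by (rule Collect_restrict)

lemma reluctant_set_subset: "reluctant_set n \<alpha> \<subseteq> {1..n}"
  unfolding reluctant_set_def by (rule Collect_restrict)

lemma bad_set_paths:
  assumes n: "1 \<le> n" and I: "I \<subseteq> {1..n}"
  shows "{ws \<in> max_chains n. bad_set n ws = I} = paths n (cox n) (map (\<lambda>i. i \<in> I) (rev [1..<Suc n]))"
proof -
  let ?R = "map (\<lambda>i. i \<in> I) (rev [1..<Suc n])"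
  have lenR: "length ?R = n" by (simp del: upt_Suc)
  have R: "rev ?R ! i = (Suc i \<in> I)" if "i < n" for i
    using that by (simp add: rev_map del: upt_Suc)
  note c = len_T_cox[OF n]
  have eq: "ws \<in> max_chains n \<and> bad_set n ws = I \<longleftrightarrow> ws \<in> paths n (cox n) ?R" for ws
  proof -
    have "ws \<in> max_chains n \<longleftrightarrow> factor_chain n ws"
      using max_chains_factor_chain[OF n c cox_B[OF n]] factor_chain_max_chains[OF n c] by blast
    moreover have "bad_set n ws = I \<longleftrightarrow> (\<forall>i<n. (len_S n (ws ! Suc i) < len_S n (ws ! i)) = rev ?R ! i)"
      if ch: "factor_chain n ws"
    proof -
      have "bad_set n ws = I \<longleftrightarrow> (\<forall>k\<in>{1..n}. bad_edge n (ws ! (k - 1)) (ws ! k) = (k \<in> I))"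
        using I unfolding bad_set_def by blast
      also have "\<dots> \<longleftrightarrow> (\<forall>i<n. bad_edge n (ws ! i) (ws ! Suc i) = (Suc i \<in> I))"
      proof
        assume "\<forall>k\<in>{1..n}. bad_edge n (ws ! (k - 1)) (ws ! k) = (k \<in> I)"
        then show "\<forall>i<n. bad_edge n (ws ! i) (ws ! Suc i) = (Suc i \<in> I)"
          by (auto dest!: bspec[of _ _ "Suc _"])
      next
        assume *: "\<forall>i<n. bad_edge n (ws ! i) (ws ! Suc i) = (Suc i \<in> I)"
        show "\<forall>k\<in>{1..n}. bad_edge n (ws ! (k - 1)) (ws ! k) = (k \<in> I)"
        proof
          fix k assume "k \<in> {1..n}"
          then have "k - 1 < n" "Suc (k - 1) = k" by auto
          then show "bad_edge n (ws ! (k - 1)) (ws ! k) = (k \<in> I)" using * by metis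
        qed
      qed
      also have "\<dots> \<longleftrightarrow> (\<forall>i<n. (len_S n (ws ! Suc i) < len_S n (ws ! i)) = rev ?R ! i)"
        by (simp only: factor_chain_edges(1)[OF n c ch] R cong: imp_cong)
      finally show ?thesis .
    qed
    ultimately have "ws \<in> max_chains n \<and> bad_set n ws = I \<longleftrightarrow>
        factor_chain n ws \<and> (\<forall>i<n. (len_S n (ws ! Suc i) < len_S n (ws ! i)) = rev ?R ! i)" by blast
    also have "\<dots> \<longleftrightarrow> ws \<in> paths n (cox n) ?R"
      unfolding paths_def factor_chain_def mem_Collect_eq lenR by blast
    finally show ?thesis .
  qed
  show ?thesis unfolding eq by simp
qed

lemma card_bad_set:
  assumes "1 \<le> n" "I \<subseteq> {1..n}"
  shows "card {ws \<in> max_chains n. bad_set n ws = I} = pattern_number n I"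
  unfolding bad_set_paths[OF assms] path_count_cox[OF assms(1), symmetric]
  by (rule conjunct2[OF card_paths[OF cox_B[OF assms(1)]]])

lemma finite_max_chains:
  assumes "1 \<le> n"
  shows "finite (max_chains n)"
proof -
  have fin: "finite {ws \<in> max_chains n. bad_set n ws = I}" if "I \<in> Pow {1..n}" for I
    unfolding bad_set_paths[OF assms PowD[OF that]] by (rule conjunct1[OF card_paths[OF cox_B[OF assms]]])
  have "finite (\<Union>I\<in>Pow {1..n}. {ws \<in> max_chains n. bad_set n ws = I})"
    by (rule finite_UN_I[OF _ fin]) simp
  moreover have "(\<Union>I\<in>Pow {1..n}. {ws \<in> max_chains n. bad_set n ws = I}) = max_chains n"
    using bad_set_subset by blast
  ultimately show ?thesis by (simp only:)
qed

text \<open>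
Both the parking functions and the chains are counted by the pattern numbers; this lemma transfers sums over either of them to sums over patterns.
\<close>
lemma sum_by_pattern:
  fixes f :: "nat set \<Rightarrow> 'b :: comm_semiring_1"
  assumes "finite X" "\<And>x. x \<in> X \<Longrightarrow> S x \<subseteq> {1..n}"
    and "\<And>I. I \<subseteq> {1..n} \<Longrightarrow> card {x \<in> X. S x = I} = pattern_number n I"
  shows "(\<Sum>x\<in>X. f (S x)) = (\<Sum>I\<in>Pow {1..n}. of_nat (pattern_number n I) * f I)"
proof -
  have "(\<Sum>x\<in>X. f (S x)) = (\<Sum>I\<in>Pow {1..n}. \<Sum>x\<in>{x \<in> X. S x = I}. f (S x))"
    using assms(1,2) by (intro sum.group[symmetric]) auto
  also have "\<dots> = (\<Sum>I\<in>Pow {1..n}. of_nat (pattern_number n I) * f I)"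
  proof (rule sum.cong)
    fix I assume "I \<in> Pow {1..n}"
    then have "card {x \<in> X. S x = I} = pattern_number n I" using assms(3) by blast
    moreover have "(\<Sum>x\<in>{x \<in> X. S x = I}. f (S x)) = (\<Sum>x\<in>{x \<in> X. S x = I}. f I)"
      by (rule sum.cong) auto
    ultimately show "(\<Sum>x\<in>{x \<in> X. S x = I}. f (S x)) = of_nat (pattern_number n I) * f I" by simp
  qed simp
  finally show ?thesis .
qed

text \<open>
The condition that both families impose on the set of reluctant cars or of bad edges.
\<close>
definition sparse_patterns :: "nat \<Rightarrow> nat \<Rightarrow> nat set set" where
  "sparse_patterns n j = {I \<in> Pow {1..n}. card I = j \<and> (\<forall>i\<in>{1..<n}. \<not> (i \<in> I \<and> i + 1 \<in> I)) \<and> n \<notin> I}"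

definition gamma_coeff :: "nat \<Rightarrow> nat \<Rightarrow> nat" where
  "gamma_coeff n j = (\<Sum>I\<in>sparse_patterns n j. pattern_number n I)"

lemma card_sparse_pattern:
  assumes "finite X" "\<And>x. x \<in> X \<Longrightarrow> S x \<subseteq> {1..n}"
    and "\<And>I. I \<subseteq> {1..n} \<Longrightarrow> card {x \<in> X. S x = I} = pattern_number n I"
  shows "card {x \<in> X. S x \<in> sparse_patterns n j} = gamma_coeff n j"
proof -
  have "card {x \<in> X. S x \<in> sparse_patterns n j} = (\<Sum>x\<in>X. if S x \<in> sparse_patterns n j then 1 else 0)"
    using assms(1) by (simp add: sum.If_cases Int_def)
  also have "\<dots> = (\<Sum>I\<in>Pow {1..n}. pattern_number n I * (if I \<in> sparse_patterns n j then 1 else 0))"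
    using sum_by_pattern[OF assms, of "\<lambda>I. if I \<in> sparse_patterns n j then 1 else (0 :: nat)"] by simp
  also have "\<dots> = (\<Sum>I\<in>sparse_patterns n j. pattern_number n I)"
    by (intro sum.mono_neutral_cong_right) (auto simp: sparse_patterns_def)
  finally show ?thesis by (simp add: gamma_coeff_def)
qed

lemma finite_PFB: "finite (PFB n)"
  unfolding PFB_def using finite_lists_length_eq[of "{1..n}" n] by (simp add: conj_commute)

lemma card_PF_family:
  assumes n: "1 \<le> n"
  shows "card (PF_family n j) = gamma_coeff n j"
proof -
  have mem: "i \<in> reluctant_set n \<alpha> \<longleftrightarrow> reluctant n \<alpha> i" if "1 \<le> i" "i \<le> n" for i \<alpha>
    using that by (simp add: reluctant_set_def)
  have "(reluc n \<alpha> = j \<and> (\<forall>i\<in>{1..<n}. \<not> (reluctant n \<alpha> i \<and> reluctant n \<alpha> (i + 1))) \<and> lucky n \<alpha> n)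
      \<longleftrightarrow> reluctant_set n \<alpha> \<in> sparse_patterns n j" for \<alpha>
  proof -
    have "reluc n \<alpha> = card (reluctant_set n \<alpha>)" by (simp add: reluc_def reluctant_set_def)
    moreover have "reluctant_set n \<alpha> \<in> Pow {1..n}" using reluctant_set_subset by blast
    moreover have "lucky n \<alpha> n \<longleftrightarrow> n \<notin> reluctant_set n \<alpha>" using mem[of n] n by simp
    moreover have "(\<forall>i\<in>{1..<n}. \<not> (reluctant n \<alpha> i \<and> reluctant n \<alpha> (i + 1)))
        \<longleftrightarrow> (\<forall>i\<in>{1..<n}. \<not> (i \<in> reluctant_set n \<alpha> \<and> i + 1 \<in> reluctant_set n \<alpha>))"
      by (intro ball_cong refl) (simp add: mem)
    ultimately show ?thesis unfolding sparse_patterns_def by simp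
  qed
  then have "PF_family n j = {\<alpha> \<in> PFB n. reluctant_set n \<alpha> \<in> sparse_patterns n j}"
    unfolding PF_family_def by simp
  moreover have "card {\<alpha> \<in> PFB n. reluctant_set n \<alpha> \<in> sparse_patterns n j} = gamma_coeff n j"
    by (rule card_sparse_pattern[OF finite_PFB reluctant_set_subset card_reluctant_set])
  ultimately show ?thesis by (simp only:)
qed

lemma card_chain_family:
  assumes n: "1 \<le> n"
  shows "card (chain_family n j) = gamma_coeff n j"
proof -
  have mem: "i \<in> bad_set n ws \<longleftrightarrow> bad_edge n (ws ! (i - 1)) (ws ! i)" if "1 \<le> i" "i \<le> n" for i ws
    using that by (simp add: bad_set_def)
  have "(bad n ws = j \<and> (\<forall>i\<in>{1..<n}. \<not> (bad_edge n (ws ! (i - 1)) (ws ! i) \<and> bad_edge n (ws ! i) (ws ! (i + 1))))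
        \<and> good_edge n (ws ! (n - 1)) (ws ! n))
      \<longleftrightarrow> bad_set n ws \<in> sparse_patterns n j" if ws: "ws \<in> max_chains n" for ws
  proof -
    have ch: "factor_chain n ws"
      by (rule max_chains_factor_chain[OF n len_T_cox[OF n] cox_B[OF n] ws])
    have "bad n ws = card (bad_set n ws)" by (simp add: bad_def bad_set_def)
    moreover have "bad_set n ws \<in> Pow {1..n}" using bad_set_subset by blast
    moreover have "good_edge n (ws ! (n - 1)) (ws ! n) \<longleftrightarrow> n \<notin> bad_set n ws"
      using mem[of n ws] factor_chain_edges[OF n len_T_cox[OF n] ch, of "n - 1"] n by simp
    moreover have "(\<forall>i\<in>{1..<n}. \<not> (bad_edge n (ws ! (i - 1)) (ws ! i) \<and> bad_edge n (ws ! i) (ws ! (i + 1))))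
        \<longleftrightarrow> (\<forall>i\<in>{1..<n}. \<not> (i \<in> bad_set n ws \<and> i + 1 \<in> bad_set n ws))"
      by (intro ball_cong refl) (simp add: mem)
    ultimately show ?thesis unfolding sparse_patterns_def by simp
  qed
  then have "chain_family n j = {ws \<in> max_chains n. bad_set n ws \<in> sparse_patterns n j}"
    unfolding chain_family_def by blast
  moreover have "card {ws \<in> max_chains n. bad_set n ws \<in> sparse_patterns n j} = gamma_coeff n j"
    by (rule card_sparse_pattern[OF finite_max_chains[OF n] bad_set_subset card_bad_set[OF n]])
  ultimately show ?thesis by (simp only:)
qed

text \<open>
Under the reflection \<open>i = n + 1 - b\<close> the factor of a position outside of the pattern is \<open>b\<close>, and these factors alone would give \<open>fact n\<close>.
\<close>
lemma pattern_number_reflect: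
  assumes B: "B \<subseteq> {1..n}"
  shows "(of_nat (pattern_number n ((\<lambda>b. n + 1 - b) ` B)) :: 'a :: field_char_0)
    = fact n * (\<Prod>b\<in>B. (of_nat n - of_nat b) / of_nat b)"
proof -
  let ?r = "\<lambda>b. n + 1 - b"
  have mem: "i \<in> ?r ` B \<longleftrightarrow> ?r i \<in> B" if i: "i \<in> {1..n}" for i
  proof
    assume "i \<in> ?r ` B"
    then obtain b where "b \<in> B" "i = ?r b" by blast
    then show "?r i \<in> B" using B by (auto simp: subset_iff)
  next
    assume "?r i \<in> B"
    moreover have "i = ?r (?r i)" using i by auto
    ultimately show "i \<in> ?r ` B" by blast
  qed
  have "pattern_number n (?r ` B) = (\<Prod>b\<in>{1..n}. if b \<in> B then n - b else b)"
    unfolding pattern_number_def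
  proof (rule prod.reindex_bij_witness[of _ ?r ?r])
    fix a assume a: "a \<in> {1..n}"
    show "(if ?r a \<in> B then n - ?r a else ?r a) = (if a \<in> ?r ` B then a - 1 else n - a + 1)"
      unfolding mem[OF a] using a by auto
  qed auto
  then have "(of_nat (pattern_number n (?r ` B)) :: 'a) = (\<Prod>b\<in>{1..n}. of_nat b * (if b \<in> B then (of_nat n - of_nat b) / of_nat b else 1))"
    by (auto simp: of_nat_diff intro!: prod.cong)
  also have "\<dots> = fact n * (\<Prod>b\<in>{1..n}. if b \<in> B then (of_nat n - of_nat b) / of_nat b else 1)"
    unfolding prod.distrib by (simp add: fact_prod)
  also have "(\<Prod>b\<in>{1..n}. if b \<in> B then (of_nat n - of_nat b) / of_nat b else 1)
      = (\<Prod>b\<in>B. (of_nat n - of_nat b) / of_nat b :: 'a)"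
    using B by (subst prod.inter_restrict[symmetric]) (simp_all add: Int_absorb1)
  finally show ?thesis .
qed

text \<open>
Patterns that contain 1 contribute zero.  The others correspond by reflection to the sparse subsets of \<open>{2..n - 1}\<close>.
\<close>
lemma gamma_coeff_sparse:
  assumes n: "1 \<le> n"
  shows "(of_nat (gamma_coeff n j) :: 'a :: field_char_0)
    = (\<Sum>B\<in>{B \<in> sparse (n - 1). card B = j}. fact n * (\<Prod>b\<in>B. (of_nat n - of_nat b) / of_nat b))"
proof -
  let ?r = "\<lambda>b. n + 1 - b"
  let ?P = "{I \<in> sparse_patterns n j. 1 \<notin> I}"
  have inv: "?r ` ?r ` A = A" if "A \<subseteq> {1..n}" for A
    unfolding image_image using that by (force simp: subset_iff image_iff)
  have inj: "inj_on ?r A" if "A \<subseteq> {1..n}" for A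
    using that by (auto simp: inj_on_def subset_iff)
  have finP: "finite (sparse_patterns n j)"
    by (rule finite_subset[of _ "Pow {1..n}"]) (auto simp: sparse_patterns_def)
  have "pattern_number n I = 0" if "1 \<in> I" for I
    using that n unfolding pattern_number_def by (intro prod_zero) auto
  then have "gamma_coeff n j = (\<Sum>I\<in>?P. pattern_number n I)"
    unfolding gamma_coeff_def using finP by (intro sum.mono_neutral_right) auto
  then have "(of_nat (gamma_coeff n j) :: 'a) = (\<Sum>I\<in>?P. of_nat (pattern_number n I))" by simp
  also have "\<dots> = (\<Sum>B\<in>{B \<in> sparse (n - 1). card B = j}. of_nat (pattern_number n (?r ` B)))"
  proof (rule sum.reindex_bij_witness[of _ "\<lambda>B. ?r ` B" "\<lambda>I. ?r ` I"])
    fix I assume I: "I \<in> ?P"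
    then have sub: "I \<subseteq> {1..n}" "card I = j" "1 \<notin> I" "n \<notin> I"
      and sp: "\<And>i. i \<in> {1..<n} \<Longrightarrow> \<not> (i \<in> I \<and> i + 1 \<in> I)" by (auto simp: sparse_patterns_def)
    show "?r ` ?r ` I = I" by (rule inv[OF sub(1)])
    have "?r ` I \<subseteq> {2..n - 1}"
    proof
      fix b assume "b \<in> ?r ` I"
      then obtain i where i: "i \<in> I" "b = ?r i" by blast
      then have "i \<noteq> 1" "i \<noteq> n" "1 \<le> i" "i \<le> n" using sub by auto
      then show "b \<in> {2..n - 1}" using i by auto
    qed
    moreover have "Suc b \<notin> ?r ` I" if bI: "b \<in> ?r ` I" for b
    proof
      assume "Suc b \<in> ?r ` I"
      then obtain i where i: "i \<in> I" "Suc b = ?r i" by blast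
      obtain k where k: "k \<in> I" "b = ?r k" using bI by blast
      have "1 \<le> i" "i \<le> n" "k \<le> n" "1 \<le> k" using i k sub by auto
      then have "k = i + 1" "i \<in> {1..<n}" using i k by auto
      then show False using sp[of i] i k by simp
    qed
    ultimately show "?r ` I \<in> {B \<in> sparse (n - 1). card B = j}"
      using card_image[OF inj[OF sub(1)]] sub(2) by (auto simp: sparse_def)
    show "of_nat (pattern_number n (?r ` ?r ` I)) = (of_nat (pattern_number n I) :: 'a)" unfolding inv[OF sub(1)] ..
  next
    fix B assume B: "B \<in> {B \<in> sparse (n - 1). card B = j}"
    then have sub: "B \<subseteq> {2..n - 1}" "card B = j" and sp: "\<And>b. b \<in> B \<Longrightarrow> Suc b \<notin> B"
      by (auto simp: sparse_def)
    have B1: "B \<subseteq> {1..n}" using sub(1) by force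
    show "?r ` ?r ` B = B" by (rule inv[OF B1])
    have "?r ` B \<subseteq> {2..n - 1}" using sub(1) by force
    moreover have "\<not> (i \<in> ?r ` B \<and> i + 1 \<in> ?r ` B)" for i
    proof
      assume "i \<in> ?r ` B \<and> i + 1 \<in> ?r ` B"
      then obtain b d where bd: "b \<in> B" "i = ?r b" "d \<in> B" "i + 1 = ?r d" by blast
      have "b \<le> n" "d \<le> n" using bd B1 by auto
      then have "b = Suc d" using bd by auto
      then show False using sp bd by blast
    qed
    ultimately show "?r ` B \<in> ?P"
      using card_image[OF inj[OF B1]] sub(2) by (force simp: sparse_patterns_def)
  qed
  also have "\<dots> = (\<Sum>B\<in>{B \<in> sparse (n - 1). card B = j}. fact n * (\<Prod>b\<in>B. (of_nat n - of_nat b) / of_nat b))"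
  proof (rule sum.cong)
    fix B assume "B \<in> {B \<in> sparse (n - 1). card B = j}"
    then have "B \<subseteq> {1..n}" by (force simp: sparse_def)
    then show "(of_nat (pattern_number n (?r ` B)) :: 'a) = fact n * (\<Prod>b\<in>B. (of_nat n - of_nat b) / of_nat b)"
      by (rule pattern_number_reflect)
  qed simp
  finally show ?thesis .
qed

text \<open>
Index tuples are the increasing enumerations of sparse sets.
\<close>
lemma sum_B_tuples:
  fixes g :: "int \<Rightarrow> 'a :: comm_semiring_1"
  assumes n: "1 \<le> n"
  shows "(\<Sum>b\<in>B_tuples n j. \<Prod>i<j. g (b ! i)) = (\<Sum>B\<in>{B \<in> sparse (n - 1). card B = j}. \<Prod>b\<in>B. g (int b))"
proof (rule sum.reindex_bij_witness[of _ "\<lambda>B. map int (sorted_list_of_set B)" "\<lambda>b. nat ` set b"])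
  fix b assume b: "b \<in> B_tuples n j"
  then have len: "length b = j" and rng: "\<And>x. x \<in> set b \<Longrightarrow> 1 < x \<and> x < int n" and sorted: "sorted_wrt (<) b"
    and gap: "\<And>i. i + 1 < j \<Longrightarrow> b ! (i + 1) - b ! i > 1" by (auto simp: B_tuples_def)
  have dist: "distinct b" using sorted strict_sorted_iff by blast
  have inj: "inj_on nat (set b)" using rng by (force simp: inj_on_def)
  have "int ` nat ` set b = set b" using rng unfolding image_image by (force simp: image_iff)
  then have "set (map int (sorted_list_of_set (nat ` set b))) = set b" by simp
  moreover have "sorted_wrt (<) (map int (sorted_list_of_set (nat ` set b)))"
    by (simp add: sorted_wrt_map)
  ultimately show "map int (sorted_list_of_set (nat ` set b)) = b"
    using strict_sorted_equal[OF sorted] by metis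
  have "nat ` set b \<subseteq> {2..n - 1}" using rng by force
  moreover have "Suc x \<notin> nat ` set b" if xb: "x \<in> nat ` set b" for x
  proof
    assume "Suc x \<in> nat ` set b"
    then obtain y where y: "y \<in> set b" "Suc x = nat y" by blast
    obtain v where v: "v \<in> set b" "x = nat v" using xb by blast
    have yv: "y = v + 1" using y v rng[of y] rng[of v] by linarith
    obtain i where i: "i < length b" "b ! i = v" using v(1) unfolding in_set_conv_nth by blast
    obtain k where k: "k < length b" "b ! k = y" using y(1) unfolding in_set_conv_nth by blast
    note ik = i k
    have mono: "b ! p < b ! q" if "p < q" "q < length b" for p q
      using sorted that by (simp add: sorted_wrt_iff_nth_less)
    have "i < k"
    proof (rule ccontr)
      assume "\<not> i < k"
      then consider "k = i" | "k < i" by linarith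
      then show False using mono[of k i] ik yv by cases auto
    qed
    then have i1: "b ! i < b ! (i + 1)" "i + 1 < j" using mono[of i "i + 1"] ik len by simp_all
    have "b ! (i + 1) \<le> b ! k" using mono[of "i + 1" k] \<open>i < k\<close> ik by (cases "i + 1 = k") auto
    then show False using gap[OF i1(2)] ik yv by linarith
  qed
  moreover have "card (nat ` set b) = j" using card_image[OF inj] distinct_card[OF dist] len by simp
  ultimately show "nat ` set b \<in> {B \<in> sparse (n - 1). card B = j}" by (simp add: sparse_def)
  have "(\<Prod>x\<in>nat ` set b. g (int x)) = (\<Prod>x\<in>set b. g x)"
    using rng by (subst prod.reindex[OF inj]) (force intro!: prod.cong)
  also have "\<dots> = (\<Prod>i<j. g (b ! i))"
    using prod.reindex_bij_betw[OF bij_betw_nth[OF dist refl refl], of g] len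
    by (simp add: atLeast0LessThan)
  finally show "(\<Prod>x\<in>nat ` set b. g (int x)) = (\<Prod>i<j. g (b ! i))" .
next
  fix B assume "B \<in> {B \<in> sparse (n - 1). card B = j}"
  then have sub: "B \<subseteq> {2..n - 1}" "card B = j" and sp: "\<And>b. b \<in> B \<Longrightarrow> Suc b \<notin> B"
    by (auto simp: sparse_def)
  have fin: "finite B" using sub(1) finite_subset by blast
  let ?l = "sorted_list_of_set B"
  show "nat ` set (map int ?l) = B" using fin by (simp add: image_image)
  have len: "length ?l = j" using sub(2) by simp
  have gap: "int (?l ! (i + 1)) - int (?l ! i) > 1" if i: "i + 1 < j" for i
  proof -
    have "?l ! i < ?l ! (i + 1)"
      using strict_sorted_list_of_set[of B] i len by (simp add: sorted_wrt_iff_nth_less)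
    moreover have "?l ! i \<in> B" "?l ! (i + 1) \<in> B"
      using nth_mem[of i ?l] nth_mem[of "i + 1" ?l] i len fin by simp_all
    then have "?l ! (i + 1) \<noteq> Suc (?l ! i)" using sp by metis
    ultimately show ?thesis by linarith
  qed
  have "sorted_wrt (<) (map int ?l)" by (simp add: sorted_wrt_map)
  moreover have "set (map int ?l) \<subseteq> {1<..<int n}" using sub(1) fin by force
  ultimately show "map int ?l \<in> B_tuples n j"
    using gap len by (auto simp: B_tuples_def)
qed

text \<open>
Expanding the product of the factors \<open>(n - i + 1) + (i - 1) q\<close> over all patterns gives \<open>M_poly\<close>; expanding it by \<open>gamma_expansion\<close> gives the right-hand side.
It suffices to compare the values at integers \<open>q\<close>.
\<close>
lemma M_poly_expansion:
  assumes n: "1 \<le> n"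
  shows "M_poly n = (\<Sum>j = 0..(n - 1) div 2.
      of_nat (gamma_coeff n j) * [:0, 1:] ^ j * (1 + [:0, 1:]) ^ (n - 1 - 2 * j))"
proof (rule poly_eq_poly_eq_iff[THEN iffD1], rule ext)
  fix q :: int
  have "poly (M_poly n) q = (\<Sum>ws\<in>max_chains n. q ^ card (bad_set n ws))"
    by (simp add: M_poly_def poly_sum poly_monom bad_def bad_set_def)
  also have "\<dots> = (\<Sum>I\<in>Pow {1..n}. of_nat (pattern_number n I) * q ^ card I)"
    by (rule sum_by_pattern[OF finite_max_chains[OF n] bad_set_subset card_bad_set[OF n]])
  finally have "real_of_int (poly (M_poly n) q) = (\<Sum>I\<in>Pow {1..n}. real (pattern_number n I) * real_of_int q ^ card I)"
    by simp
  also have "\<dots> = (\<Prod>i\<in>{1..n}. real (i - 1) * real_of_int q + real (n - i + 1))"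
  proof (subst prod_add)
    show "(\<Sum>I\<in>Pow {1..n}. real (pattern_number n I) * real_of_int q ^ card I)
      = (\<Sum>I\<in>Pow {1..n}. (\<Prod>i\<in>I. real (i - 1) * real_of_int q) * (\<Prod>i\<in>{1..n} - I. real (n - i + 1)))"
    proof (rule sum.cong)
      fix I assume "I \<in> Pow {1..n}"
      then have I: "I \<subseteq> {1..n}" by simp
      have "real (pattern_number n I) = (\<Prod>i\<in>{1..n}. if i \<in> I then real (i - 1) else real (n - i + 1))"
        unfolding pattern_number_def of_nat_prod by (intro prod.cong) auto
      also have "\<dots> = (\<Prod>i\<in>{1..n} \<inter> I. real (i - 1)) * (\<Prod>i\<in>{1..n} \<inter> - I. real (n - i + 1))"
        by (simp add: prod.If_cases)
      also have "\<dots> = (\<Prod>i\<in>I. real (i - 1)) * (\<Prod>i\<in>{1..n} - I. real (n - i + 1))"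
        using I by (intro arg_cong2[of _ _ _ _ "(*)"] prod.cong) auto
      finally show "real (pattern_number n I) * real_of_int q ^ card I
        = (\<Prod>i\<in>I. real (i - 1) * real_of_int q) * (\<Prod>i\<in>{1..n} - I. real (n - i + 1))"
        by (simp add: prod.distrib)
    qed simp
  qed simp
  also have "\<dots> = (\<Prod>i = 1..n. (real (n - i + 1) + real (i - 1) * real_of_int q))"
    by (simp add: add.commute)
  also have "\<dots> = (\<Sum>B\<in>sparse (n - 1). fact n * (\<Prod>b\<in>B. (real n - real b) / real b)
       * real_of_int q ^ card B * (1 + real_of_int q) ^ (n - 1 - 2 * card B))"
    by (rule gamma_expansion[OF n])
  also have "\<dots> = (\<Sum>j = 0..(n - 1) div 2. \<Sum>B\<in>{B \<in> sparse (n - 1). card B = j}.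
       fact n * (\<Prod>b\<in>B. (real n - real b) / real b)
       * real_of_int q ^ card B * (1 + real_of_int q) ^ (n - 1 - 2 * card B))"
  proof (rule sum.group[symmetric])
    show "card ` sparse (n - 1) \<subseteq> {0..(n - 1) div 2}"
    proof
      fix m assume "m \<in> card ` sparse (n - 1)"
      then obtain B where "B \<in> sparse (n - 1)" "m = card B" by blast
      then show "m \<in> {0..(n - 1) div 2}" using sparse_card[of B "n - 1"] by simp
    qed
  qed (simp_all add: sparse_finite)
  also have "\<dots> = (\<Sum>j = 0..(n - 1) div 2. real (gamma_coeff n j)
       * real_of_int q ^ j * (1 + real_of_int q) ^ (n - 1 - 2 * j))"
    unfolding gamma_coeff_sparse[OF n, where 'a = real] sum_distrib_right
    by (intro sum.cong refl) auto
  also have "\<dots> = real_of_int (poly (\<Sum>j = 0..(n - 1) div 2.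
      of_nat (gamma_coeff n j) * [:0, 1:] ^ j * (1 + [:0, 1:]) ^ (n - 1 - 2 * j)) q)"
    by (simp add: poly_sum poly_power)
  finally show "poly (M_poly n) q = poly (\<Sum>j = 0..(n - 1) div 2.
      of_nat (gamma_coeff n j) * [:0, 1:] ^ j * (1 + [:0, 1:]) ^ (n - 1 - 2 * j)) q"
    by (simp only: of_int_eq_iff)
qed

theorem theorem1p4:
  fixes n :: nat
  assumes "n \<ge> 1"
  shows "\<exists>\<gamma> :: nat \<Rightarrow> nat.
    M_poly n = (\<Sum>j = 0..(n - 1) div 2.
      of_nat (\<gamma> j) * [:0, 1:] ^ j * (1 + [:0, 1:]) ^ (n - 1 - 2 * j)) \<and>
    (\<forall>j \<le> (n - 1) div 2.
      \<gamma> j = card (PF_family n j) \<and>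
      \<gamma> j = card (chain_family n j) \<and>
      (of_nat (\<gamma> j) :: rat) =
        fact n * (\<Sum>b\<in>B_tuples n j. \<Prod>i<j. (of_nat n - of_int (b ! i)) / of_int (b ! i)))"
proof (intro exI[of _ "gamma_coeff n"] conjI allI impI)
  show "M_poly n = (\<Sum>j = 0..(n - 1) div 2.
      of_nat (gamma_coeff n j) * [:0, 1:] ^ j * (1 + [:0, 1:]) ^ (n - 1 - 2 * j))"
    by (rule M_poly_expansion[OF assms])
  fix j
  show "gamma_coeff n j = card (PF_family n j)" "gamma_coeff n j = card (chain_family n j)"
    using card_PF_family[OF assms] card_chain_family[OF assms] by simp_all
  show "(of_nat (gamma_coeff n j) :: rat) =
        fact n * (\<Sum>b\<in>B_tuples n j. \<Prod>i<j. (of_nat n - of_int (b ! i)) / of_int (b ! i))"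
    using gamma_coeff_sparse[OF assms, of j, where 'a = rat]
      sum_B_tuples[OF assms, of "\<lambda>x. (of_nat n - of_int x) / of_int x :: rat" j]
    by (simp add: sum_distrib_left)
qed

end
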